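(* Consider a non-degenerate probability measure $\mu$ supported on $[0,1]$ and symmetric about the line $u=1/2$. Assume that the associated Cramér rate function $I(u)=\sup_{\theta\in\mathbb{R}}\{\theta u-K(\theta)\}$, where $K(\theta)=\log\int e^{\theta x}\mu(dx)$ is the cumulant generating function of $\mu$, is bounded on $[0,1]$ (i.e. $I(0)=I(1)$ is finite). Take $H_1$ a single edge and $H_2$ a finite simple graph with $p\ge2$ edges, and assume that the equation $K'''(\theta)K'(\theta)=-(p-2)\left(K''(\theta)\right)^2$ admits only one zero on $\mathbb{R}$. Let $\beta_1>-\beta_2$ and $\beta_2\ge0$. For large $n$ and $(\beta_1,\beta_2)$ sufficiently far away from the origin, a typical graph drawn from the $2$-parameter edge-weighted exponential random graph model $\mathbb{P}_n^\beta$ with edge-weight distribution $\mu$ looks like an Erdős–Rényi graph $G(n,u)$, where the edge presence probability $u$ depends on the distribution $\mu$, but its dual $\theta$ universally satisfies $\theta\asymp2(\beta_1+p\beta_2)$.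
   Context: Model: $\mathcal{G}_n$ is the set of simple edge-weighted complete labeled graphs $G_n$ on $n$ vertices (undirected, no loops or multiple edges), where the edge weights $x_{ij}$ between vertices $i$ and $j$ are iid real random variables with distribution $\mu$; this gives a probability measure $\mathbb{P}_n$ on $\mathcal{G}_n$ with expectation $\mathbb{E}_n$. The graphon of $G_n$ is the symmetric function $h^{G_n}:[0,1]^2\to[0,1]$ whose value at $(x,y)$ is the edge weight between vertices $\lceil nx\rceil$ and $\lceil ny\rceil$ (zero if these coincide, as there are no loops). For a finite simple graph $H$ with vertex set $\{1,\dots,k\}$ and edge set $E(H)$, $t(H,G_n)=\int_{[0,1]^k}\prod_{\{i,j\}\in E(H)}h^{G_n}(x_i,x_j)\,dx_1\cdots dx_k$. For real parameters $\beta=(\beta_1,\beta_2)$, $\mathbb{P}_n^\beta(G_n)=\exp\left(n^2\left(\beta_1t(H_1,G_n)+\beta_2t(H_2,G_n)-\psi_n^\beta\right)\right)\mathbb{P}_n(G_n)$, where $\psi_n^\beta=\frac{1}{n^2}\log\mathbb{E}_n\left(\exp\left(n^2(\beta_1t(H_1,G_n)+\beta_2t(H_2,G_n))\right)\right)$. "Looks like $G(n,u)$": for $\beta_2\ge0$, $\lim_{n\to\infty}\delta_\square(\tilde h^{G_n},\tilde u)=0$ almost surely, where $u$ is picked randomly from the set of maximizers of $\beta_1u+\beta_2u^p-\frac12I(u)$ over $\{u: I(u)<\infty\}$. Here, for symmetric measurable $f,h:[0,1]^2\to[0,1]$, $d_\square(f,h)=\sup_{S,T\subseteq[0,1]}\left|\int_{S\times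 T}(f-h)\,dx\,dy\right|$; $f\sim h$ if $f(x,y)=h_\sigma(x,y):=h(\sigma x,\sigma y)$ for some measure preserving bijection $\sigma$ of $[0,1]$; $\tilde h$ is the equivalence class of $h$; $\delta_\square(\tilde f,\tilde h)=\inf_{\sigma_1,\sigma_2}d_\square(f_{\sigma_1},h_{\sigma_2})$ over measure preserving bijections; and $\tilde u$ is the class of the constant graphon $u$. Duality: each $u\in(0,1)$ has a unique Legendre dual $\theta\in\mathbb{R}$, with $K'(\theta)=u$ and $I'(u)=\theta$. "Universally" means that the asymptotics do not depend on the particular $\mu$. The symbol $\asymp$ denotes agreement to leading order (ratio tending to $1$) as $(\beta_1,\beta_2)$ moves far away from the origin.
   Formalization: For p≥3 the claim fails in a thin strip along β1=-β2 (e.g. Bernoulli(1/2), p=3, β1 slightly above -β2, β2 large: maximizer near 0), so it is stated on β1+β2≥δ for every δ>0, with u, θ independent of δ; for p=2 the full region is kept. *)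

theory Defs
  imports "HOL-Probability.Probability" "HOL-Library.Landau_Symbols"
begin

definition cumulant :: "real measure \<Rightarrow> real \<Rightarrow> real" where
  "cumulant \<mu> \<theta> = ln (LINT x|\<mu>. exp (\<theta> * x))"

definition rate :: "real measure \<Rightarrow> real \<Rightarrow> ereal" where
  "rate \<mu> u = (SUP \<theta>. ereal (\<theta> * u - cumulant \<mu> \<theta>))"

definition legendre_dual :: "real measure \<Rightarrow> real \<Rightarrow> real \<Rightarrow> bool" where
  "legendre_dual \<mu> u \<theta> \<longleftrightarrow>
     (cumulant \<mu> has_real_derivative u) (at \<theta>) \<and>
     ((\<lambda>v. real_of_ereal (rate \<mu> v)) has_real_derivative \<theta>) (at u)"

definition maximizers :: "real measure \<Rightarrow> nat \<Rightarrow> real \<Rightarrow> real \<Rightarrow> real set" where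
  "maximizers \<mu> p \<beta>1 \<beta>2 =
     {u. is_arg_max (\<lambda>v. \<beta>1 * v + \<beta>2 * v ^ p - real_of_ereal (rate \<mu> v) / 2)
           (\<lambda>v. rate \<mu> v < \<infinity>) u}"

definition complete_edges :: "nat \<Rightarrow> nat set set" where
  "complete_edges n = {e. e \<subseteq> {1..n} \<and> card e = 2}"

text \<open>A finite simple graph with vertex set \<open>{1..k}\<close> is given by \<open>k\<close> and its edge set.\<close>

definition simple_graph :: "nat \<Rightarrow> nat set set \<Rightarrow> bool" where
  "simple_graph k E \<longleftrightarrow> E \<subseteq> complete_edges k"

text \<open>An edge-weighted complete graph is a family of reals indexed by \<open>complete_edges n\<close>;
  under the product measure the weights are iid with distribution \<open>\<mu>\<close>.\<close>

definition weighted_graphs :: "real measure \<Rightarrow> nat \<Rightarrow> (nat set \<Rightarrow> real) measure" where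
  "weighted_graphs \<mu> n = Pi\<^sub>M (complete_edges n) (\<lambda>_. \<mu>)"

text \<open>The pair below is not an edge when the two vertices coincide (no loops), nor when
  \<open>x = 0\<close> or \<open>y = 0\<close>, where the ceiling is not a vertex; the latter is a null set.\<close>

definition graphon :: "nat \<Rightarrow> (nat set \<Rightarrow> real) \<Rightarrow> real \<Rightarrow> real \<Rightarrow> real" where
  "graphon n w x y =
     (let e = {nat \<lceil>real n * x\<rceil>, nat \<lceil>real n * y\<rceil>}
      in if e \<in> complete_edges n then w e else 0)"

definition unit_measure :: "real measure" where
  "unit_measure = restrict_space lborel {0..1}"

text \<open>Since \<open>h\<close> is symmetric, listing the endpoints of an edge in increasing order is harmless.\<close>

definition hom_density :: "nat \<Rightarrow> nat set set \<Rightarrow> (real \<Rightarrow> real \<Rightarrow> real) \<Rightarrow> real" where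
  "hom_density k E h =
     (LINT x|Pi\<^sub>M {1..k} (\<lambda>_. unit_measure). (\<Prod>e\<in>E. h (x (Min e)) (x (Max e))))"

definition cut_dist :: "(real \<Rightarrow> real \<Rightarrow> real) \<Rightarrow> (real \<Rightarrow> real \<Rightarrow> real) \<Rightarrow> real" where
  "cut_dist f h =
     (SUP (S, T) \<in> sets unit_measure \<times> sets unit_measure.
        \<bar>LINT z:S \<times> T|unit_measure \<Otimes>\<^sub>M unit_measure. f (fst z) (snd z) - h (fst z) (snd z)\<bar>)"

definition mp_bijections :: "(real \<Rightarrow> real) set" where
  "mp_bijections =
     {\<sigma>. bij_betw \<sigma> {0..1} {0..1} \<and> \<sigma> \<in> measurable unit_measure unit_measure \<and>
         distr unit_measure unit_measure \<sigma> = unit_measure}"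

text \<open>The distance between the equivalence classes of \<open>f\<close> and \<open>h\<close>, expressed on representatives.\<close>

definition delta_cut :: "(real \<Rightarrow> real \<Rightarrow> real) \<Rightarrow> (real \<Rightarrow> real \<Rightarrow> real) \<Rightarrow> real" where
  "delta_cut f h =
     (INF (\<sigma>1, \<sigma>2) \<in> mp_bijections \<times> mp_bijections.
        cut_dist (\<lambda>x y. f (\<sigma>1 x) (\<sigma>1 y)) (\<lambda>x y. h (\<sigma>2 x) (\<sigma>2 y)))"

definition hamiltonian ::
  "nat \<Rightarrow> nat set set \<Rightarrow> real \<Rightarrow> real \<Rightarrow> nat \<Rightarrow> (nat set \<Rightarrow> real) \<Rightarrow> real" where
  "hamiltonian k E \<beta>1 \<beta>2 n w =
     \<beta>1 * hom_density 2 {{1, 2}} (graphon n w) + \<beta>2 * hom_density k E (graphon n w)"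

definition psi :: "real measure \<Rightarrow> nat \<Rightarrow> nat set set \<Rightarrow> real \<Rightarrow> real \<Rightarrow> nat \<Rightarrow> real" where
  "psi \<mu> k E \<beta>1 \<beta>2 n =
     1 / (real n)\<^sup>2 *
       ln (LINT w|weighted_graphs \<mu> n. exp ((real n)\<^sup>2 * hamiltonian k E \<beta>1 \<beta>2 n w))"

definition ergm ::
  "real measure \<Rightarrow> nat \<Rightarrow> nat set set \<Rightarrow> real \<Rightarrow> real \<Rightarrow> nat \<Rightarrow> (nat set \<Rightarrow> real) measure" where
  "ergm \<mu> k E \<beta>1 \<beta>2 n =
     density (weighted_graphs \<mu> n)
       (\<lambda>w. ennreal (exp ((real n)\<^sup>2 * (hamiltonian k E \<beta>1 \<beta>2 n w - psi \<mu> k E \<beta>1 \<beta>2 n))))"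

text \<open>Almost sure statements about \<open>(G\<^sub>n)\<^sub>n\<close> need a joint law of the whole sequence, while the model
  only fixes the marginal laws.  We quantify over all joint laws with these marginals;
  independence of the \<open>G\<^sub>n\<close> is one of them.\<close>

definition joint_law ::
  "(nat \<Rightarrow> (nat set \<Rightarrow> real) measure) \<Rightarrow> (nat \<Rightarrow> nat set \<Rightarrow> real) measure \<Rightarrow> bool" where
  "joint_law P Q \<longleftrightarrow>
     prob_space Q \<and> sets Q = sets (Pi\<^sub>M UNIV P) \<and> (\<forall>n. distr Q (P n) (\<lambda>\<omega>. \<omega> n) = P n)"

text \<open>In general the limiting constant is picked at random from the set of maximizers; resembling a
  single Erdos-Renyi graph means that this set is a singleton.\<close>

definition looks_like_ER ::
  "real measure \<Rightarrow> nat \<Rightarrow> nat set set \<Rightarrow> real \<Rightarrow> real \<Rightarrow> real \<Rightarrow> bool" where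
  "looks_like_ER \<mu> k E \<beta>1 \<beta>2 u \<longleftrightarrow>
     maximizers \<mu> (card E) \<beta>1 \<beta>2 = {u} \<and>
     (\<forall>Q. joint_law (ergm \<mu> k E \<beta>1 \<beta>2) Q \<longrightarrow>
        (AE G in Q. (\<lambda>n. delta_cut (graphon n (G n)) (\<lambda>_ _. u)) \<longlonglongrightarrow> 0))"

text \<open>The parameters tend to infinity inside the cone \<open>\<beta>1 > -\<beta>2\<close>, \<open>\<beta>2 \<ge> 0\<close>.  For \<open>p \<ge> 3\<close> the
  curve on which the two competing maximizers exchange their roles lies inside this cone and is
  asymptotic to the line \<open>\<beta>1 = -\<beta>2\<close>, so the distance to that line has to stay bounded below (by an
  arbitrarily small constant).  For \<open>p = 2\<close> the curve is on the line, and the whole cone is allowed.\<close>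

definition far_in_cone :: "nat \<Rightarrow> real \<Rightarrow> (real \<times> real) filter" where
  "far_in_cone p \<delta> =
     inf at_infinity
       (principal {(\<beta>1, \<beta>2). \<beta>1 > - \<beta>2 \<and> \<beta>2 \<ge> 0 \<and> (p = 2 \<or> \<beta>1 + \<beta>2 \<ge> \<delta>)})"

end

theory Submission
  imports Defs
begin

text \<open>Write \<open>L v = \<beta>1 v + \<beta>2 v^p - I(v)/2\<close> for the functional of the variational problem. The statement splits
into an analytic part, which says that far out in the cone \<open>L\<close> has exactly one maximizer \<open>u\<close> and that
\<open>u\<close> is close to 1, and a probabilistic part, which says that a unique maximizer \<open>u\<close> forces the random
graphs to converge to the constant \<open>u\<close> in cut distance.

\<^bold>\<open>Analytic part.\<close> Boundedness of \<open>I\<close> makes \<open>K'\<close> a bijection from the line onto \<open>(0,1)\<close>, so the points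
\<open>u = K'(\<theta>)\<close> can be parametrized by their duals, and \<open>d/d\<theta> L(K'(\<theta>)) = K''(\<theta>) (\<beta>1 + p \<beta>2 K'(\<theta>)^(p-1) - \<theta>/2)\<close>. The
derivative of the bracket is \<open>p (p-1) \<beta>2 g(\<theta>) - 1/2\<close> with \<open>g = K'' K'^(p-2)\<close>. The hypothesis on
\<open>K''' K' = -(p-2) (K'')^2\<close> says that \<open>g'\<close> has a single zero; since \<open>K'\<close> is bounded, \<open>g\<close> cannot increase for
ever, so \<open>g\<close> decreases strictly to the right of that zero. Hence the bracket cannot vanish
again to the right of a maximizer there, and at most one maximizer is close to 1
(\<open>unique_maximizer_near_1\<close>). Comparing a maximizer \<open>v\<close> with the point 1 gives
\<open>(\<beta>1+\<beta>2)(1-v) + \<beta>2 (v - v^p) \<le> (I(1) - I(v))/2\<close>: if \<open>v\<close> stays away from 1, then \<open>\<beta>1+\<beta>2\<close> is bounded, \<open>\<beta>2\<close> is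
large and \<open>v\<close> is close to 0, where \<open>I(v)\<close> is close to \<open>I(0) = I(1)\<close>; so \<open>\<beta>1+\<beta>2\<close> would have to be
small. For \<open>p = 2\<close> the reflection \<open>v \<mapsto> 1-v\<close> shows \<open>v \<ge> 1/2\<close> directly (\<open>maximizers_near_1\<close>). The
asymptotics of the dual is then the stationarity equation \<open>\<theta> = 2 (\<beta>1 + p \<beta>2 u^(p-1))\<close> with \<open>u \<rightarrow> 1\<close>.

\<^bold>\<open>Probabilistic part.\<close> By weak regularity each weighted graph is within \<open>\<epsilon>\<close> in cut norm of its
block averages \<open>B\<close> for some vertex colouring with a bounded number of colours (\<open>weak_regularity\<close>).
The counting lemma and the inequality of arithmetic and geometric means bound the Hamiltonian
by \<open>\<beta>1 B + \<beta>2 B^p\<close> averaged over pairs of vertices, that is, by the average of \<open>L(B) + I(B)/2\<close>. A graph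
that is far from \<open>u\<close> has \<open>B\<close> far from \<open>u\<close> on many pairs, which costs a fixed amount in the average
of \<open>L(B)\<close>. The term \<open>I(B)/2\<close> disappears under the expectation: \<open>I\<close> is up to \<open>\<eta>\<close> a maximum of finitely
many affine functions \<open>\<theta> v - K(\<theta>)\<close>, so \<open>exp\<close> of the sum of \<open>I(B)/2\<close> is at most a sum of exponential
tilts, and each tilt has expectation 1. There are only \<open>exp(O(n))\<close> colourings and boundedly many
choices of tilts, so a union bound suffices (\<open>far_graphs_weight\<close>). Tilting all
edges by the dual of \<open>u\<close> gives the matching lower bound on the partition function
(\<open>partition_function_eventually\<close>). The quotient is at most \<open>exp(-n)\<close> for large \<open>n\<close>, and
the lemma of Borel and Cantelli applies to every joint law of the sequence.\<close>

section \<open>The edge-weight distribution and its rate function\<close>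

text \<open>The quadratic remainder that justifies differentiation under the integral sign.\<close>

lemma exp_minus_affine_bound:
  fixes y :: real
  assumes "\<bar>y\<bar> \<le> 1"
  shows "\<bar>exp y - 1 - y\<bar> \<le> y\<^sup>2"
proof (cases "y \<ge> 0")
  case True
  have "exp y \<le> 1 + y + y\<^sup>2" using exp_bound[of y] assms True by auto
  moreover have "0 \<le> y\<^sup>2" by simp
  ultimately show ?thesis using exp_ge_add_one_self[of y] unfolding abs_le_iff by linarith
next
  case False
  define x where "x = - y"
  have x: "0 \<le> x" "x \<le> 1" using False assms by (auto simp: x_def)
  have "1 + x + x\<^sup>2/2 \<le> exp x" using x exp_lower_Taylor_quadratic by blast
  moreover have "1 + x + x\<^sup>2/2 > 0" using x by (simp add: add_pos_nonneg)
  ultimately have "exp (-x) \<le> 1 / (1 + x + x\<^sup>2/2)"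
    by (simp add: exp_minus inverse_eq_divide frac_le)
  also have "\<dots> \<le> 1 - x + x\<^sup>2"
  proof -
    have "(1 - x + x\<^sup>2) * (1 + x + x\<^sup>2/2) = 1 + (x^2/2 + x^3/2 + x^4/2)"
      by (simp add: field_simps power2_eq_square power3_eq_cube power4_eq_xxxx)
    also have "\<dots> \<ge> 1" using x by simp
    finally show ?thesis using \<open>1 + x + x\<^sup>2/2 > 0\<close> by (simp add: divide_le_eq)
  qed
  finally have "exp y \<le> 1 + y + y\<^sup>2" by (simp add: x_def)
  moreover have "0 \<le> y\<^sup>2" by simp
  ultimately show ?thesis using exp_ge_add_one_self[of y] unfolding abs_le_iff by linarith
qed

locale edge_weight = prob_space \<mu> for \<mu> :: "real measure" +
  assumes sets_eq: "sets \<mu> = sets borel"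
    and supported: "AE x in \<mu>. x \<in> {0..1}"
    and nondegenerate: "\<not> (\<exists>c. AE x in \<mu>. x = c)"
begin

lemma measurable_borel_iff: "f \<in> borel_measurable \<mu> \<longleftrightarrow> f \<in> borel_measurable borel"
  by (rule arg_cong[of _ _ "\<lambda>X. f \<in> X"]) (simp add: measurable_cong_sets[OF sets_eq])

text \<open>The derivatives of the moment generating function.\<close>

definition mom :: "nat \<Rightarrow> real \<Rightarrow> real" where
  "mom j \<theta> = (LINT x|\<mu>. x ^ j * exp (\<theta> * x))"

lemma integrable_bounded_on_unit:
  fixes f :: "real \<Rightarrow> real"
  assumes "f \<in> borel_measurable borel" "\<And>x. x \<in> {0..1} \<Longrightarrow> \<bar>f x\<bar> \<le> C"
  shows "integrable \<mu> f"
proof (rule integrable_const_bound[where B = C])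
  show "AE x in \<mu>. norm (f x) \<le> C" using supported assms(2) by auto
  show "f \<in> borel_measurable \<mu>" using assms(1) by (simp add: measurable_borel_iff)
qed

lemma exp_le_on_unit: "x \<in> {0..1} \<Longrightarrow> exp (\<theta> * x) \<le> exp \<bar>\<theta>\<bar>" for \<theta> x :: real
proof -
  assume x: "x \<in> {0..1}"
  have "\<theta> * x \<le> \<bar>\<theta>\<bar> * x" using x by (intro mult_right_mono) auto
  also have "\<dots> \<le> \<bar>\<theta>\<bar>" using x by (simp add: mult_left_le)
  finally show ?thesis by simp
qed

lemma pow_exp_bound: "x \<in> {0..1} \<Longrightarrow> \<bar>x ^ j * exp (\<theta> * x)\<bar> \<le> exp \<bar>\<theta>\<bar>" for \<theta> x :: real
proof -
  assume x: "x \<in> {0..1}"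
  have "x ^ j * exp (\<theta> * x) \<le> 1 * exp \<bar>\<theta>\<bar>"
    using x by (intro mult_mono exp_le_on_unit power_le_one) auto
  then show ?thesis using x by (simp add: abs_mult)
qed

lemma integrable_pow_exp [intro, simp]: "integrable \<mu> (\<lambda>x. x ^ j * exp (\<theta> * x))"
  by (rule integrable_bounded_on_unit[OF _ pow_exp_bound]) auto

lemma integrable_exp [intro, simp]: "integrable \<mu> (\<lambda>x. exp (\<theta> * x))"
  using integrable_pow_exp[of 0 \<theta>] by simp

lemma mom_has_derivative: "(mom j has_real_derivative mom (Suc j) \<theta>) (at \<theta>)"
proof -
  let ?C = "exp \<bar>\<theta>\<bar>"
  have bound: "\<bar>mom j (\<theta> + h) - mom j \<theta> - h * mom (Suc j) \<theta>\<bar> \<le> ?C * h\<^sup>2" if h: "\<bar>h\<bar> \<le> 1" for h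
  proof -
    let ?f = "\<lambda>x. x ^ j * exp ((\<theta> + h) * x) - x ^ j * exp (\<theta> * x) - h * (x ^ Suc j * exp (\<theta> * x))"
    have int: "integrable \<mu> ?f"
      by (intro Bochner_Integration.integrable_diff integrable_pow_exp integrable_mult_right)
    have eq: "mom j (\<theta> + h) - mom j \<theta> - h * mom (Suc j) \<theta> = (LINT x|\<mu>. ?f x)"
      unfolding mom_def
      by (simp only: Bochner_Integration.integral_diff Bochner_Integration.integrable_diff
          integrable_pow_exp integrable_mult_right integral_mult_right_zero)
    have "\<bar>?f x\<bar> \<le> ?C * h\<^sup>2" if x: "x \<in> {0..1}" for x
    proof -
      have "\<bar>h * x\<bar> \<le> 1" using h x by (simp add: abs_mult mult_le_one)
      then have "\<bar>exp (h*x) - 1 - h*x\<bar> \<le> (h*x)\<^sup>2" by (rule exp_minus_affine_bound)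
      also have "\<dots> \<le> h\<^sup>2" using x by (simp add: power_mult_distrib mult_left_le power_le_one)
      finally have *: "\<bar>exp (h*x) - 1 - h*x\<bar> \<le> h\<^sup>2" .
      have "?f x = (x ^ j * exp (\<theta> * x)) * (exp (h*x) - 1 - h*x)"
        by (simp add: algebra_simps exp_add)
      then have "\<bar>?f x\<bar> = \<bar>x ^ j * exp (\<theta> * x)\<bar> * \<bar>exp (h*x) - 1 - h*x\<bar>" by (simp only: abs_mult)
      also have "\<dots> \<le> ?C * h\<^sup>2"
        by (intro mult_mono pow_exp_bound x *) auto
      finally show ?thesis .
    qed
    then have "AE x in \<mu>. norm (?f x) \<le> ?C * h\<^sup>2" using supported by auto
    then have "norm (LINT x|\<mu>. ?f x) \<le> (LINT x|\<mu>. ?C * h\<^sup>2)"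
      by (intro order_trans[OF integral_norm_bound] integral_mono_AE integrable_norm int) auto
    then show ?thesis by (simp only: eq) (simp add: prob_space)
  qed
  have "((\<lambda>h. (mom j (\<theta> + h) - mom j \<theta>) / h - mom (Suc j) \<theta>) \<longlongrightarrow> 0) (at 0)"
  proof (rule Lim_null_comparison)
    show "\<forall>\<^sub>F h in at 0. norm ((mom j (\<theta> + h) - mom j \<theta>) / h - mom (Suc j) \<theta>) \<le> ?C * \<bar>h\<bar>"
      unfolding eventually_at
    proof (intro exI[of _ 1] conjI ballI impI)
      fix h :: real assume "h \<noteq> 0 \<and> dist h 0 < 1"
      then have h: "h \<noteq> 0" "\<bar>h\<bar> \<le> 1" by (auto simp: dist_real_def)
      have "(mom j (\<theta> + h) - mom j \<theta>) / h - mom (Suc j) \<theta>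
          = (mom j (\<theta> + h) - mom j \<theta> - h * mom (Suc j) \<theta>) / h" using h by (simp add: field_simps)
      then have "norm ((mom j (\<theta> + h) - mom j \<theta>) / h - mom (Suc j) \<theta>)
          = \<bar>mom j (\<theta> + h) - mom j \<theta> - h * mom (Suc j) \<theta>\<bar> / \<bar>h\<bar>" by (simp add: abs_divide)
      also have "\<dots> \<le> ?C * h\<^sup>2 / \<bar>h\<bar>" by (intro divide_right_mono bound h) auto
      also have "\<dots> = ?C * \<bar>h\<bar>" using h by (simp add: field_simps power2_eq_square)
      finally show "norm ((mom j (\<theta> + h) - mom j \<theta>) / h - mom (Suc j) \<theta>) \<le> ?C * \<bar>h\<bar>" .
    qed auto
    show "((\<lambda>h. ?C * \<bar>h\<bar>) \<longlongrightarrow> 0) (at 0)" by (auto intro!: tendsto_eq_intros)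
  qed
  then have "((\<lambda>h. (mom j (\<theta> + h) - mom j \<theta>) / h) \<longlongrightarrow> mom (Suc j) \<theta>) (at 0)"
    by (simp add: LIM_zero_iff)
  then show ?thesis by (simp add: DERIV_def)
qed

lemma mom_0_pos: "mom 0 \<theta> > 0"
proof -
  have "(LINT x|\<mu>. exp (\<theta> * x)) \<noteq> 0"
    using integral_nonneg_eq_0_iff_AE[OF integrable_exp[of \<theta>]] by simp
  moreover have "(LINT x|\<mu>. exp (\<theta> * x)) \<ge> 0" by simp
  ultimately show ?thesis unfolding mom_def by (simp add: order_less_le)
qed

text \<open>Non-degeneracy enters here: the integral vanishes only if the weight is almost surely \<open>c\<close>. With
  \<open>c\<close> the tilted mean this gives \<open>K'' > 0\<close>, and with \<open>c = 0\<close> and \<open>c = 1\<close> it gives \<open>0 < K' < 1\<close>.\<close>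

lemma integral_sq_exp_pos: "(LINT x|\<mu>. (x - c)\<^sup>2 * exp (\<theta> * x)) > 0"
proof -
  have int: "integrable \<mu> (\<lambda>x. (x - c)\<^sup>2 * exp (\<theta> * x))"
  proof (rule integrable_bounded_on_unit)
    fix x :: real assume x: "x \<in> {0..1}"
    have "(x - c)\<^sup>2 \<le> (1 + \<bar>c\<bar>)\<^sup>2" using x by (intro power2_le_iff_abs_le[THEN iffD2]) auto
    then have "(x - c)\<^sup>2 * exp (\<theta> * x) \<le> (1 + \<bar>c\<bar>)\<^sup>2 * exp \<bar>\<theta>\<bar>"
      by (intro mult_mono exp_le_on_unit x) auto
    then show "\<bar>(x - c)\<^sup>2 * exp (\<theta> * x)\<bar> \<le> (1 + \<bar>c\<bar>)\<^sup>2 * exp \<bar>\<theta>\<bar>" by (simp add: abs_mult)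
  qed auto
  have "(LINT x|\<mu>. (x - c)\<^sup>2 * exp (\<theta> * x)) \<noteq> 0"
  proof
    assume "(LINT x|\<mu>. (x - c)\<^sup>2 * exp (\<theta> * x)) = 0"
    then have "AE x in \<mu>. (x - c)\<^sup>2 * exp (\<theta> * x) = 0"
      using integral_nonneg_eq_0_iff_AE[OF int] by simp
    then have "AE x in \<mu>. x = c" by auto
    then show False using nondegenerate by blast
  qed
  moreover have "(LINT x|\<mu>. (x - c)\<^sup>2 * exp (\<theta> * x)) \<ge> 0" by simp
  ultimately show ?thesis by linarith
qed

lemma mom_variance_pos: "mom 2 \<theta> * mom 0 \<theta> - (mom 1 \<theta>)\<^sup>2 > 0"
proof -
  define c where "c = mom 1 \<theta> / mom 0 \<theta>"
  have "(LINT x|\<mu>. (x - c)\<^sup>2 * exp (\<theta> * x))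
      = (LINT x|\<mu>. x^2 * exp (\<theta> * x) - 2 * c * (x^1 * exp (\<theta> * x)) + c\<^sup>2 * (x^0 * exp (\<theta> * x)))"
    by (intro Bochner_Integration.integral_cong) (auto simp: power2_eq_square algebra_simps)
  also have "\<dots> = mom 2 \<theta> - 2 * c * mom 1 \<theta> + c\<^sup>2 * mom 0 \<theta>"
    unfolding mom_def
    by (simp only: Bochner_Integration.integral_diff Bochner_Integration.integral_add Bochner_Integration.integrable_diff
          integrable_pow_exp integrable_mult_right integral_mult_right_zero)
  finally have "mom 2 \<theta> - 2 * c * mom 1 \<theta> + c\<^sup>2 * mom 0 \<theta> > 0" using integral_sq_exp_pos[of c \<theta>] by simp
  then have "(mom 2 \<theta> - 2 * c * mom 1 \<theta> + c\<^sup>2 * mom 0 \<theta>) * mom 0 \<theta> > 0" using mom_0_pos by simp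
  then show ?thesis using mom_0_pos[of \<theta>] by (simp add: c_def field_simps power2_eq_square)
qed

lemma mom_1_bounds: "0 < mom 1 \<theta>" "mom 1 \<theta> < mom 0 \<theta>"
proof -
  have i2: "integrable \<mu> (\<lambda>x. x^2 * exp (\<theta> * x))" by simp
  have "mom 2 \<theta> \<le> mom 1 \<theta>" unfolding mom_def
  proof (rule integral_mono_AE)
    show "AE x in \<mu>. x\<^sup>2 * exp (\<theta> * x) \<le> x ^ 1 * exp (\<theta> * x)" using supported
    proof (rule eventually_mono)
      fix x :: real assume "x \<in> {0..1}"
      then have "x\<^sup>2 \<le> x ^ 1" by (simp add: power2_eq_square mult_left_le)
      then show "x\<^sup>2 * exp (\<theta> * x) \<le> x ^ 1 * exp (\<theta> * x)" by (simp add: mult_right_mono)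
    qed
  qed (rule integrable_pow_exp)+
  moreover have "mom 2 \<theta> > 0" using integral_sq_exp_pos[of 0 \<theta>] by (simp add: mom_def)
  ultimately show "0 < mom 1 \<theta>" by linarith
  have "(LINT x|\<mu>. (x - 1)\<^sup>2 * exp (\<theta> * x))
      = (LINT x|\<mu>. x^2 * exp (\<theta> * x) - 2 * (x^1 * exp (\<theta> * x)) + (x^0 * exp (\<theta> * x)))"
    by (intro Bochner_Integration.integral_cong) (auto simp: power2_eq_square algebra_simps)
  also have "\<dots> = mom 2 \<theta> - 2 * mom 1 \<theta> + mom 0 \<theta>"
    unfolding mom_def
    by (simp only: Bochner_Integration.integral_diff Bochner_Integration.integral_add Bochner_Integration.integrable_diff
          integrable_pow_exp integrable_mult_right integral_mult_right_zero)
  finally have "mom 2 \<theta> - 2 * mom 1 \<theta> + mom 0 \<theta> > 0" using integral_sq_exp_pos[of 1 \<theta>] by simp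
  then show "mom 1 \<theta> < mom 0 \<theta>" using \<open>mom 2 \<theta> \<le> mom 1 \<theta>\<close> by linarith
qed

abbreviation "K \<equiv> cumulant \<mu>"

text \<open>The first three derivatives of the cumulant generating function, as explicit quotients; this
  is what makes the third one visibly continuous.\<close>

definition K1 :: "real \<Rightarrow> real" where "K1 \<theta> = mom 1 \<theta> / mom 0 \<theta>"
definition K2 :: "real \<Rightarrow> real" where "K2 \<theta> = (mom 2 \<theta> * mom 0 \<theta> - (mom 1 \<theta>)\<^sup>2) / (mom 0 \<theta>)\<^sup>2"
definition K3 :: "real \<Rightarrow> real" where
  "K3 \<theta> = mom 3 \<theta> / mom 0 \<theta> - mom 1 \<theta> * mom 2 \<theta> / (mom 0 \<theta>)\<^sup>2 - 2 * K1 \<theta> * K2 \<theta>"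

lemma K_eq: "K \<theta> = ln (mom 0 \<theta>)" by (simp add: cumulant_def mom_def)

lemma exp_K: "exp (K \<theta>) = (LINT x|\<mu>. exp (\<theta> * x))"
  using mom_0_pos[of \<theta>] by (simp add: K_eq) (simp add: mom_def)

lemma K_deriv: "(K has_real_derivative K1 \<theta>) (at \<theta>)"
proof -
  have "K = (\<lambda>\<theta>. ln (mom 0 \<theta>))" by (auto simp: K_eq)
  moreover have "((\<lambda>\<theta>. ln (mom 0 \<theta>)) has_real_derivative K1 \<theta>) (at \<theta>)"
    using mom_0_pos[of \<theta>] by (auto intro!: derivative_eq_intros mom_has_derivative simp: K1_def)
  ultimately show ?thesis by simp
qed

lemma K1_deriv: "(K1 has_real_derivative K2 \<theta>) (at \<theta>)"
proof -
  have "K1 = (\<lambda>\<theta>. mom 1 \<theta> / mom 0 \<theta>)" by (auto simp: K1_def)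
  moreover have "((\<lambda>\<theta>. mom 1 \<theta> / mom 0 \<theta>) has_real_derivative K2 \<theta>) (at \<theta>)"
    using mom_0_pos[of \<theta>]
    by (auto intro!: derivative_eq_intros mom_has_derivative simp: K2_def power2_eq_square eval_nat_numeral)
  ultimately show ?thesis by simp
qed

lemma K2_alt: "K2 \<theta> = mom 2 \<theta> / mom 0 \<theta> - (K1 \<theta>)\<^sup>2"
  using mom_0_pos[of \<theta>] by (simp add: K1_def K2_def field_simps power2_eq_square)

lemma K2_deriv: "(K2 has_real_derivative K3 \<theta>) (at \<theta>)"
proof -
  have "K2 = (\<lambda>\<theta>. mom 2 \<theta> / mom 0 \<theta> - (K1 \<theta>)\<^sup>2)" by (auto simp: K2_alt)
  moreover have "((\<lambda>\<theta>. mom 2 \<theta> / mom 0 \<theta> - (K1 \<theta>)\<^sup>2) has_real_derivative K3 \<theta>) (at \<theta>)"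
    using mom_0_pos[of \<theta>]
    by (auto intro!: derivative_eq_intros mom_has_derivative K1_deriv simp: K3_def)
      (simp add: field_simps power2_eq_square eval_nat_numeral)
  ultimately show ?thesis by simp
qed

lemma mom_continuous: "continuous_on UNIV (mom j)"
  using DERIV_continuous_on mom_has_derivative by (metis has_field_derivative_at_within)

lemma K1_continuous: "isCont K1 \<theta>" using DERIV_isCont K1_deriv by blast
lemma K2_continuous: "isCont K2 \<theta>" using DERIV_isCont K2_deriv by blast

lemma K3_continuous: "continuous_on UNIV K3"
proof -
  have "mom 0 \<theta> \<noteq> 0" for \<theta> using mom_0_pos[of \<theta>] by simp
  moreover have "continuous_on UNIV K1" "continuous_on UNIV K2"
    using K1_continuous K2_continuous by (auto simp: continuous_on_eq_continuous_at)
  ultimately show ?thesis unfolding K3_def by (intro continuous_intros mom_continuous) auto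
qed

lemma K1_bounds: "0 < K1 \<theta>" "K1 \<theta> < 1"
  using mom_1_bounds[of \<theta>] mom_0_pos[of \<theta>] by (auto simp: K1_def)

lemma K2_pos: "K2 \<theta> > 0" using mom_variance_pos[of \<theta>] mom_0_pos[of \<theta>] by (auto simp: K2_def)

lemma deriv_K: "deriv K = K1" "deriv (deriv K) = K2" "deriv (deriv (deriv K)) = K3"
proof -
  show 1: "deriv K = K1" using DERIV_imp_deriv K_deriv by blast
  show 2: "deriv (deriv K) = K2" unfolding 1 using DERIV_imp_deriv K1_deriv by blast
  show "deriv (deriv (deriv K)) = K3" unfolding 2 using DERIV_imp_deriv K2_deriv by blast
qed

lemma K1_strict_mono: "strict_mono K1"
  by (rule DERIV_pos_imp_increasing[of _ _ K1, THEN strict_monoI]) (use K1_deriv K2_pos in blast)+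

lemma K_0: "K 0 = 0" by (simp add: cumulant_def prob_space)

lemma K_le: "\<theta> \<ge> 0 \<Longrightarrow> K \<theta> \<le> \<theta>" "\<theta> \<le> 0 \<Longrightarrow> K \<theta> \<le> 0"
proof -
  have "mom 0 \<theta> \<le> exp (max \<theta> 0)"
  proof -
    have "mom 0 \<theta> \<le> (LINT x|\<mu>. exp (max \<theta> 0))" unfolding mom_def
    proof (rule integral_mono_AE)
      show "AE x in \<mu>. x ^ 0 * exp (\<theta> * x) \<le> exp (max \<theta> 0)"
        using supported
      proof (rule eventually_mono)
        fix x :: real assume "x \<in> {0..1}"
        then have "\<theta> * x \<le> max \<theta> 0 * x" "max \<theta> 0 * x \<le> max \<theta> 0"
          by (auto intro!: mult_right_mono simp: mult_left_le)
        then show "x ^ 0 * exp (\<theta> * x) \<le> exp (max \<theta> 0)" by simp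
      qed
    qed auto
    then show ?thesis by (simp add: prob_space)
  qed
  then have "K \<theta> \<le> ln (exp (max \<theta> 0))" unfolding K_eq using mom_0_pos[of \<theta>]
    by (subst ln_le_cancel_iff) auto
  then show "\<theta> \<ge> 0 \<Longrightarrow> K \<theta> \<le> \<theta>" "\<theta> \<le> 0 \<Longrightarrow> K \<theta> \<le> 0" by auto
qed

text \<open>Convexity of \<open>K\<close> in the form in which the Legendre transform uses it.\<close>

lemma K_tangent: "K \<theta> + K1 \<theta> * (\<theta>' - \<theta>) \<le> K \<theta>'"
proof (cases \<theta> \<theta>' rule: linorder_cases)
  case less
  obtain z where "z > \<theta>" "z < \<theta>'" "K \<theta>' - K \<theta> = (\<theta>' - \<theta>) * K1 z"
    using MVT2[OF less, of K K1] K_deriv by blast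
  moreover have "K1 \<theta> \<le> K1 z" using \<open>z > \<theta>\<close> K1_strict_mono by (simp add: strict_mono_less_eq)
  ultimately show ?thesis using less by (smt (verit) mult.commute mult_left_mono)
next
  case greater
  obtain z where "z > \<theta>'" "z < \<theta>" "K \<theta> - K \<theta>' = (\<theta> - \<theta>') * K1 z"
    using MVT2[OF greater, of K K1] K_deriv by blast
  moreover have "K1 z \<le> K1 \<theta>" using \<open>z < \<theta>\<close> K1_strict_mono by (simp add: strict_mono_less_eq)
  ultimately have "K \<theta> - K \<theta>' \<le> (\<theta> - \<theta>') * K1 \<theta>" using greater by (simp add: mult_left_mono)
  then show ?thesis by (simp add: algebra_simps)
qed auto

lemma rate_K1: "rate \<mu> (K1 \<theta>) = ereal (\<theta> * K1 \<theta> - K \<theta>)"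
proof (rule antisym)
  show "rate \<mu> (K1 \<theta>) \<le> ereal (\<theta> * K1 \<theta> - K \<theta>)" unfolding rate_def
  proof (rule SUP_least)
    fix \<theta>' show "ereal (\<theta>' * K1 \<theta> - K \<theta>') \<le> ereal (\<theta> * K1 \<theta> - K \<theta>)"
      using K_tangent[of \<theta> \<theta>'] by (simp add: algebra_simps)
  qed
  show "ereal (\<theta> * K1 \<theta> - K \<theta>) \<le> rate \<mu> (K1 \<theta>)" unfolding rate_def by (rule SUP_upper) auto
qed

lemma rate_ge: "ereal (\<theta> * v - K \<theta>) \<le> rate \<mu> v" unfolding rate_def by (rule SUP_upper) auto

text \<open>Outside the convex hull of the support the linear functions \<open>\<theta> v - K \<theta>\<close> are unbounded, because
  \<open>K\<close> grows at most like \<open>max \<theta> 0\<close>. So the maximizers range over the unit interval only.\<close>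

lemma rate_outside: assumes "v \<notin> {0..1}" shows "rate \<mu> v = \<infinity>"
proof (rule ereal_top)
  fix B :: real
  show "ereal B \<le> rate \<mu> v"
  proof (cases "v > 1")
    case True
    define \<theta> where "\<theta> = \<bar>B\<bar> / (v - 1)"
    have "\<theta> \<ge> 0" "\<theta> * (v - 1) = \<bar>B\<bar>" using True by (auto simp: \<theta>_def)
    then have "B \<le> \<theta> * v - K \<theta>" using K_le(1)[of \<theta>] by (simp add: algebra_simps)
    then show ?thesis using rate_ge[of \<theta> v] by (meson ereal_less_eq(3) order_trans)
  next
    case False
    then have v: "v < 0" using assms by auto
    define \<theta> where "\<theta> = \<bar>B\<bar> / v"
    have "\<theta> \<le> 0" "\<theta> * v = \<bar>B\<bar>" using v by (auto simp: \<theta>_def divide_nonneg_neg)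
    then have "B \<le> \<theta> * v - K \<theta>" using K_le(2)[of \<theta>] by (simp add: algebra_simps)
    then show ?thesis using rate_ge[of \<theta> v] by (meson ereal_less_eq(3) order_trans)
  qed
qed

end

text \<open>Under these assumptions the rate is finite on the whole interval and takes its largest value
  at both ends, so that the maximizers can be studied with a real-valued continuous function.\<close>

locale symmetric_edge_weight = edge_weight +
  assumes symmetric: "distr \<mu> borel (\<lambda>x. 1 - x) = \<mu>"
    and bounded_rate: "\<exists>C. \<forall>u\<in>{0..1}. rate \<mu> u \<le> ereal C"
begin

definition J :: "real \<Rightarrow> real" where "J v = real_of_ereal (rate \<mu> v)"

lemma rate_nonneg: "rate \<mu> v \<ge> 0" using rate_ge[of 0 v] by (simp add: K_0 zero_ereal_def)

lemma rate_eq_J: assumes "v \<in> {0..1}" shows "rate \<mu> v = ereal (J v)"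
proof -
  obtain C where "rate \<mu> v \<le> ereal C" using bounded_rate assms by blast
  then show ?thesis unfolding J_def using rate_nonneg[of v]
    by (cases "rate \<mu> v") auto
qed

lemma rate_finite_iff: "rate \<mu> v < \<infinity> \<longleftrightarrow> v \<in> {0..1}"
  using rate_eq_J[of v] rate_outside[of v] by auto

lemma J_ge: "v \<in> {0..1} \<Longrightarrow> \<theta> * v - K \<theta> \<le> J v"
  using rate_ge[of \<theta> v] rate_eq_J[of v] by simp

text \<open>Together with \<open>J_ge\<close> this lets the real-valued rate be handled as a supremum of affine functions.\<close>

lemma J_least: assumes "v \<in> {0..1}" "\<And>\<theta>. \<theta> * v - K \<theta> \<le> B" shows "J v \<le> B"
proof -
  have "rate \<mu> v \<le> ereal B" unfolding rate_def by (rule SUP_least) (simp add: assms(2))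
  then show ?thesis using rate_eq_J[OF assms(1)] by simp
qed

lemma J_nonneg: "v \<in> {0..1} \<Longrightarrow> J v \<ge> 0"
  using J_ge[of v 0] by (simp add: K_0)

lemma J_near_sup:
  assumes "v \<in> {0..1}" "\<epsilon> > 0" shows "\<exists>\<theta>. J v - \<epsilon> < \<theta> * v - K \<theta>"
proof (rule ccontr)
  assume "\<nexists>\<theta>. J v - \<epsilon> < \<theta> * v - K \<theta>"
  then have "J v \<le> J v - \<epsilon>" by (intro J_least assms(1)) (auto simp: not_less)
  then show False using assms by simp
qed

lemma K_reflect: "K \<theta> = \<theta> + K (- \<theta>)"
proof -
  have [measurable_cong]: "sets \<mu> = sets borel" by (rule sets_eq)
  have "exp (K \<theta>) = (LINT x|distr \<mu> borel (\<lambda>x. 1 - x). exp (\<theta> * x))"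
    by (simp add: symmetric exp_K)
  also have "\<dots> = (LINT x|\<mu>. exp (\<theta> * (1 - x)))" by (subst integral_distr) auto
  also have "\<dots> = (LINT x|\<mu>. exp \<theta> * exp (- \<theta> * x))"
    by (intro Bochner_Integration.integral_cong) (auto simp: algebra_simps simp flip: exp_add)
  also have "\<dots> = exp (\<theta> + K (- \<theta>))" using exp_K[of "-\<theta>"] by (simp add: exp_add)
  finally show ?thesis by simp
qed

lemma J_reflect: assumes "v \<in> {0..1}" shows "J (1 - v) = J v"
proof -
  have le: "J (1 - v) \<le> J v" if "v \<in> {0..1}" for v
  proof (rule J_least)
    fix \<theta> show "\<theta> * (1 - v) - K \<theta> \<le> J v"
      using J_ge[OF that, of "-\<theta>"] K_reflect[of \<theta>] by (simp add: algebra_simps)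
  qed (use that in auto)
  show ?thesis using le[of v] le[of "1 - v"] assms by auto
qed

lemma J_0_eq_1: "J 0 = J 1" using J_reflect[of 1] by simp

lemma J_le_J1: assumes "v \<in> {0..1}" shows "J v \<le> J 1"
proof (rule J_least[OF assms])
  fix \<theta>
  have "\<theta> * v \<le> max \<theta> 0"
    using assms mult_left_le[of v \<theta>] mult_nonpos_nonneg[of \<theta> v] by (cases "\<theta> \<ge> 0") auto
  then have "\<theta> * v - K \<theta> \<le> max \<theta> 0 - K \<theta>" by (rule diff_right_mono)
  also have "\<dots> \<le> J 1" using J_ge[of 1 \<theta>] J_ge[of 0 \<theta>] J_0_eq_1 by (simp add: max_def)
  finally show "\<theta> * v - K \<theta> \<le> J 1" .
qed

lemma J_convex: "convex_on {0..1} J"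
proof (intro convex_onI)
  fix t x y :: real
  assume t: "0 < t" "t < 1" and x: "x \<in> {0..1}" and y: "y \<in> {0..1}"
  have conv: "(1 - t) *\<^sub>R x + t *\<^sub>R y \<in> {0..1}"
    using convexD[OF convex_real_interval(5)[of 0 1] x y, of "1 - t" t] t by simp
  show "J ((1 - t) *\<^sub>R x + t *\<^sub>R y) \<le> (1 - t) * J x + t * J y"
  proof (rule J_least[OF conv])
    fix \<theta>
    have "\<theta> * ((1 - t) *\<^sub>R x + t *\<^sub>R y) - K \<theta> = (1 - t) * (\<theta> * x - K \<theta>) + t * (\<theta> * y - K \<theta>)"
      by (simp add: algebra_simps)
    also have "\<dots> \<le> (1 - t) * J x + t * J y"
      using t by (intro add_mono mult_left_mono J_ge x y) auto
    finally show "\<theta> * ((1 - t) *\<^sub>R x + t *\<^sub>R y) - K \<theta> \<le> (1 - t) * J x + t * J y" .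
  qed
qed auto

text \<open>Lower semicontinuity holds for a supremum of affine functions; upper semicontinuity holds
  because the common value at the ends is the largest one.\<close>

lemma J_continuous_endpoint:
  assumes "e \<in> {0, 1}" shows "(J \<longlongrightarrow> J e) (at e within {0..1})"
proof (rule tendstoI)
  fix \<epsilon> :: real assume "\<epsilon> > 0"
  have e: "e \<in> {0..1}" "J e = J 1" using assms J_0_eq_1 by auto
  obtain \<theta> where \<theta>: "J e - \<epsilon> < \<theta> * e - K \<theta>" using J_near_sup[OF e(1) \<open>\<epsilon> > 0\<close>] by blast
  have "((\<lambda>v. \<theta> * v - K \<theta>) \<longlongrightarrow> \<theta> * e - K \<theta>) (at e within {0..1})" by (intro tendsto_intros)
  then have "\<forall>\<^sub>F v in at e within {0..1}. J e - \<epsilon> < \<theta> * v - K \<theta>" by (rule order_tendstoD(1)[OF _ \<theta>])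
  moreover have "\<forall>\<^sub>F v in at e within {0..1}. v \<in> {0..1}" by (auto simp: eventually_at_filter)
  ultimately show "\<forall>\<^sub>F v in at e within {0..1}. dist (J v) (J e) < \<epsilon>"
  proof eventually_elim
    case (elim v)
    then show ?case using J_ge[of v \<theta>] J_le_J1[of v] e \<open>\<epsilon> > 0\<close> by (auto simp: dist_real_def)
  qed
qed

lemma J_continuous: "continuous_on {0..1} J"
  unfolding continuous_on_def
proof
  fix v :: real assume v: "v \<in> {0..1}"
  show "(J \<longlongrightarrow> J v) (at v within {0..1})"
  proof (cases "v \<in> {0, 1}")
    case True then show ?thesis by (rule J_continuous_endpoint)
  next
    case False
    then have "v \<in> {0<..<1}" using v by auto
    moreover have "continuous_on {0<..<1} J"
      by (rule convex_on_continuous[OF open_greaterThanLessThan convex_on_subset[OF J_convex]]) auto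
    ultimately have "isCont J v" by (simp add: continuous_on_eq_continuous_at)
    then show ?thesis unfolding isCont_def by (rule tendsto_within_subset) simp
  qed
qed

text \<open>Compactness of the interval and continuity of the rate: up to an error \<open>\<eta>\<close> finitely many of
  the affine functions already give the supremum. Finiteness is what permits a union bound.\<close>

lemma finite_dual_net:
  assumes "\<eta> > 0"
  obtains \<Theta> where "finite \<Theta>" "\<And>v. v \<in> {0..1} \<Longrightarrow> \<exists>\<theta>\<in>\<Theta>. J v \<le> \<theta> * v - K \<theta> + \<eta>"
proof -
  define f where "f \<theta> v = J v - (\<theta> * v - K \<theta>)" for \<theta> v
  have "continuous_on {0..1} (f \<theta>)" for \<theta> unfolding f_def by (intro continuous_intros J_continuous)
  then have "\<exists>A. open A \<and> A \<inter> {0..1} = f \<theta> -` {..<\<eta>} \<inter> {0..1}" for \<theta>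
    by (metis continuous_on_open_invariant open_lessThan)
  then obtain A where A: "\<And>\<theta>. open (A \<theta>)" "\<And>\<theta>. A \<theta> \<inter> {0..1} = f \<theta> -` {..<\<eta>} \<inter> {0..1}" by metis
  have "{0..1} \<subseteq> (\<Union>\<theta>\<in>UNIV. A \<theta>)"
  proof
    fix v :: real assume v: "v \<in> {0..1}"
    obtain \<theta> where "J v - \<eta> < \<theta> * v - K \<theta>" using J_near_sup[OF v assms] by blast
    then have "v \<in> f \<theta> -` {..<\<eta>} \<inter> {0..1}" using v by (auto simp: f_def)
    then show "v \<in> (\<Union>\<theta>\<in>UNIV. A \<theta>)" using A(2) by blast
  qed
  then obtain \<Theta> where \<Theta>: "\<Theta> \<subseteq> UNIV" "finite \<Theta>" "{0..1} \<subseteq> (\<Union>\<theta>\<in>\<Theta>. A \<theta>)"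
    using compactE_image[of "{0..1}" UNIV A] A(1) by (metis compact_Icc)
  show ?thesis
  proof (rule that[OF \<Theta>(2)])
    fix v :: real assume v: "v \<in> {0..1}"
    then obtain \<theta> where "\<theta> \<in> \<Theta>" "v \<in> A \<theta>" using \<Theta>(3) by blast
    then have "f \<theta> v < \<eta>" using A(2)[of \<theta>] v by blast
    then show "\<exists>\<theta>\<in>\<Theta>. J v \<le> \<theta> * v - K \<theta> + \<eta>" using \<open>\<theta> \<in> \<Theta>\<close> by (intro bexI[of _ \<theta>]) (auto simp: f_def)
  qed
qed

lemma J_K1: "J (K1 \<theta>) = \<theta> * K1 \<theta> - K \<theta>" by (simp add: J_def rate_K1)

lemma K1_in: "K1 \<theta> \<in> {0..1}" "K1 \<theta> \<in> {0<..<1}" using K1_bounds[of \<theta>] by auto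

text \<open>The rate at 1 bounds \<open>\<theta> - K \<theta>\<close>, and \<open>K \<theta> \<le> \<theta> K'(\<theta>)\<close> by convexity. With its mirror image at 0
  this shows that \<open>K'\<close> exhausts \<open>(0,1)\<close>.\<close>

lemma K1_lower: "\<theta> > 0 \<Longrightarrow> K1 \<theta> \<ge> 1 - J 1 / \<theta>"
  using K_tangent[of \<theta> 0] J_ge[of 1 \<theta>] by (simp add: K_0 field_simps)

lemma K1_upper: "\<theta> < 0 \<Longrightarrow> K1 \<theta> \<le> J 1 / (- \<theta>)"
  using K_tangent[of \<theta> 0] J_ge[of 0 \<theta>] J_0_eq_1 by (simp add: K_0 field_simps)

lemma J1_nonneg: "J 1 \<ge> 0" by (rule J_nonneg) auto

lemma K1_surj: assumes "u \<in> {0<..<1}" shows "\<exists>\<theta>. K1 \<theta> = u"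
proof -
  define b where "b = (J 1 + 1) / (1 - u)"
  define a where "a = - (J 1 + 1) / u"
  have b: "b > 0" "K1 b \<ge> u"
  proof -
    show "b > 0" using assms J1_nonneg by (auto simp: b_def)
    have "J 1 / b \<le> 1 - u" using assms J1_nonneg by (auto simp: b_def field_simps)
    then show "K1 b \<ge> u" using K1_lower[OF \<open>b > 0\<close>] by linarith
  qed
  have a: "a < 0" "K1 a \<le> u"
  proof -
    show "a < 0" using assms J1_nonneg by (auto simp: a_def divide_neg_pos)
    have "J 1 / (- a) \<le> u" using assms J1_nonneg by (auto simp: a_def field_simps)
    then show "K1 a \<le> u" using K1_upper[OF \<open>a < 0\<close>] by linarith
  qed
  show ?thesis using IVT[of K1 a u b] a b K1_continuous by auto
qed

text \<open>Near \<open>K'(\<theta>)\<close> each point \<open>v\<close> is \<open>K'(t)\<close> with \<open>t\<close> close to \<open>\<theta>\<close>, and the two supporting lines at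
  \<open>K'(\<theta>)\<close> and at \<open>v\<close> squeeze the difference quotient between \<open>\<theta>\<close> and \<open>t\<close>.\<close>

lemma J_deriv: "(J has_real_derivative \<theta>) (at (K1 \<theta>))"
  unfolding has_field_derivative_iff
proof (rule tendstoI)
  let ?u = "K1 \<theta>"
  fix \<epsilon> :: real assume "\<epsilon> > 0"
  let ?I = "{K1 (\<theta> - \<epsilon>)<..<K1 (\<theta> + \<epsilon>)}"
  have "?u \<in> ?I" using \<open>\<epsilon> > 0\<close> K1_strict_mono by (auto simp: strict_mono_less)
  then have "\<forall>\<^sub>F v in at ?u. v \<in> ?I" by (intro eventually_at_in_open') auto
  moreover have "\<forall>\<^sub>F v in at ?u. v \<noteq> ?u" by (simp add: eventually_neq_at_within)
  ultimately show "\<forall>\<^sub>F v in at ?u. dist ((J v - J ?u) / (v - ?u)) \<theta> < \<epsilon>"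
  proof eventually_elim
    case (elim v)
    then have "v \<in> {0<..<1}" using K1_in(2)[of "\<theta> - \<epsilon>"] K1_in(2)[of "\<theta> + \<epsilon>"] by auto
    then obtain t where t: "v = K1 t" using K1_surj by metis
    then have "\<theta> - \<epsilon> < t" "t < \<theta> + \<epsilon>" using elim K1_strict_mono by (auto simp: strict_mono_less)
    then have td: "\<bar>t - \<theta>\<bar> < \<epsilon>" by auto
    have 1: "J v - J ?u \<ge> \<theta> * (v - ?u)" using J_ge[of v \<theta>] K1_in(1)[of t] by (simp add: J_K1 t algebra_simps)
    have 2: "J v - J ?u \<le> t * (v - ?u)" using J_ge[of ?u t] K1_in(1)[of \<theta>] by (simp add: J_K1 t algebra_simps)
    have ne: "v - ?u \<noteq> 0" using elim by simp
    have "(J v - J ?u) / (v - ?u) - \<theta> = (J v - J ?u - \<theta> * (v - ?u)) / (v - ?u)"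
      using ne by (simp add: field_simps)
    then have "\<bar>(J v - J ?u) / (v - ?u) - \<theta>\<bar> = \<bar>J v - J ?u - \<theta> * (v - ?u)\<bar> / \<bar>v - ?u\<bar>"
      by (simp add: abs_divide)
    also have "\<dots> \<le> \<bar>(t - \<theta>) * (v - ?u)\<bar> / \<bar>v - ?u\<bar>"
      using 1 2 by (intro divide_right_mono) (auto simp: algebra_simps)
    also have "\<dots> = \<bar>t - \<theta>\<bar>" using ne by (simp add: abs_mult)
    finally show ?case using td by (simp add: dist_real_def)
  qed
qed

lemma legendre_dual_K1: "legendre_dual \<mu> (K1 \<theta>) \<theta>"
  unfolding legendre_dual_def using K_deriv J_deriv[of \<theta>] unfolding J_def[abs_def] by simp

end

section \<open>Maximizers of the variational problem\<close>

locale ferromagnetic_model = symmetric_edge_weight +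
  fixes p :: nat
  assumes p_ge_2: "p \<ge> 2"
    and one_zero: "\<exists>!\<theta>. (deriv ^^ 3) (cumulant \<mu>) \<theta> * deriv (cumulant \<mu>) \<theta>
                        = - (real p - 2) * ((deriv ^^ 2) (cumulant \<mu>) \<theta>)\<^sup>2"
begin

definition objective :: "real \<Rightarrow> real \<Rightarrow> real \<Rightarrow> real" where
  "objective \<beta>1 \<beta>2 v = \<beta>1 * v + \<beta>2 * v ^ p - J v / 2"

lemma maximizers_iff:
  "u \<in> maximizers \<mu> p \<beta>1 \<beta>2 \<longleftrightarrow>
     u \<in> {0..1} \<and> (\<forall>v\<in>{0..1}. objective \<beta>1 \<beta>2 v \<le> objective \<beta>1 \<beta>2 u)"
  unfolding maximizers_def is_arg_max_def objective_def J_def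
  by (auto simp only: rate_finite_iff mem_Collect_eq not_less)

lemma objective_continuous: "continuous_on {0..1} (objective \<beta>1 \<beta>2)"
  unfolding objective_def by (intro continuous_intros J_continuous) auto

lemma maximizer_exists: "maximizers \<mu> p \<beta>1 \<beta>2 \<noteq> {}"
proof -
  obtain u where "u \<in> {0..1}" "\<forall>v\<in>{0..1}. objective \<beta>1 \<beta>2 v \<le> objective \<beta>1 \<beta>2 u"
    using continuous_attains_sup[OF compact_Icc _ objective_continuous[of \<beta>1 \<beta>2]] by auto
  then have "u \<in> maximizers \<mu> p \<beta>1 \<beta>2" unfolding maximizers_iff by blast
  then show ?thesis by blast
qed

lemma abs_pow_diff_le: "\<bar>x ^ p - y ^ p\<bar> \<le> real p * \<bar>x - y\<bar>" if "x \<in> {0..1}" "y \<in> {0..1}" for x y :: real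
proof -
  have "norm (x ^ p - y ^ p) \<le> real p * norm (x - y)"
    using that by (intro norm_power_diff) auto
  then show ?thesis by simp
qed

text \<open>The slope of the rate is unbounded at both ends of the interval, while the polynomial part is
  Lipschitz, so moving inwards from an end increases the objective.\<close>

lemma maximizer_interior:
  assumes u: "u \<in> maximizers \<mu> p \<beta>1 \<beta>2" shows "u \<in> {0<..<1}"
proof -
  have u01: "u \<in> {0..1}" and max: "\<And>v. v \<in> {0..1} \<Longrightarrow> objective \<beta>1 \<beta>2 v \<le> objective \<beta>1 \<beta>2 u"
    using u maximizers_iff by auto
  define c where "c = \<bar>\<beta>1\<bar> + \<bar>\<beta>2\<bar> * real p"
  have lip: "\<bar>(\<beta>1 * v + \<beta>2 * v ^ p) - (\<beta>1 * u + \<beta>2 * u ^ p)\<bar> \<le> c * \<bar>v - u\<bar>" if "v \<in> {0..1}" for v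
  proof -
    have "(\<beta>1 * v + \<beta>2 * v ^ p) - (\<beta>1 * u + \<beta>2 * u ^ p) = \<beta>1 * (v - u) + \<beta>2 * (v ^ p - u ^ p)"
      by (simp add: algebra_simps)
    also have "\<bar>\<dots>\<bar> \<le> \<bar>\<beta>1\<bar> * \<bar>v - u\<bar> + \<bar>\<beta>2\<bar> * \<bar>v ^ p - u ^ p\<bar>"
      by (metis abs_mult abs_triangle_ineq)
    also have "\<dots> \<le> \<bar>\<beta>1\<bar> * \<bar>v - u\<bar> + \<bar>\<beta>2\<bar> * (real p * \<bar>v - u\<bar>)"
      by (intro add_left_mono mult_left_mono abs_pow_diff_le that u01) auto
    finally show ?thesis by (simp add: c_def algebra_simps)
  qed
  have J_drop: "J u - J v \<le> 2 * c * \<bar>v - u\<bar>" if "v \<in> {0..1}" for v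
    using max[OF that] lip[OF that] by (simp add: objective_def)
  have "u \<noteq> 1"
  proof
    assume "u = 1"
    \<comment> \<open>At the dual \<open>\<theta>\<close> the rate has slope \<open>\<theta>\<close>, which exceeds twice the Lipschitz constant \<open>c\<close>.\<close>
    define \<theta> where "\<theta> = 2 * c + 1"
    have "\<theta> * (1 - K1 \<theta>) \<le> 2 * c * (1 - K1 \<theta>)"
      using J_drop[OF K1_in(1)[of \<theta>]] J_ge[of 1 \<theta>] K1_bounds[of \<theta>] \<open>u = 1\<close>
      by (simp add: J_K1 algebra_simps)
    then show False using K1_bounds[of \<theta>] by (simp add: \<theta>_def algebra_simps)
  qed
  moreover have "u \<noteq> 0"
  proof
    assume "u = 0"
    define \<theta> where "\<theta> = - (2 * c + 1)"
    have "- \<theta> * K1 \<theta> \<le> 2 * c * K1 \<theta>"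
      using J_drop[OF K1_in(1)[of \<theta>]] J_ge[of 0 \<theta>] K1_bounds[of \<theta>] \<open>u = 0\<close>
      by (simp add: J_K1 algebra_simps)
    then show False using K1_bounds[of \<theta>] by (simp add: \<theta>_def algebra_simps)
  qed
  ultimately show ?thesis using u01 by auto
qed

lemma maximizer_has_dual:
  assumes "u \<in> maximizers \<mu> p \<beta>1 \<beta>2" obtains \<theta> where "u = K1 \<theta>"
  using K1_surj[OF maximizer_interior[OF assms]] by metis

text \<open>The derivative of the objective along \<open>\<theta> \<mapsto> K'(\<theta>)\<close>, up to the positive factor \<open>K''(\<theta>)\<close>.\<close>

definition force :: "real \<Rightarrow> real \<Rightarrow> real \<Rightarrow> real" where
  "force \<beta>1 \<beta>2 \<theta> = \<beta>1 + \<beta>2 * real p * K1 \<theta> ^ (p - 1) - \<theta> / 2"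

text \<open>Up to a constant factor, the part of the derivative of \<open>force\<close> that depends on \<open>\<theta>\<close>.\<close>

definition g :: "real \<Rightarrow> real" where "g \<theta> = K2 \<theta> * K1 \<theta> ^ (p - 2)"

lemma objective_K1_deriv:
  "((\<lambda>\<theta>. objective \<beta>1 \<beta>2 (K1 \<theta>)) has_real_derivative K2 \<theta> * force \<beta>1 \<beta>2 \<theta>) (at \<theta>)"
  unfolding objective_def J_K1
  by (auto intro!: derivative_eq_intros K1_deriv K_deriv simp: force_def algebra_simps)

lemma force_deriv:
  "(force \<beta>1 \<beta>2 has_real_derivative \<beta>2 * real p * (real p - 1) * g \<theta> - 1 / 2) (at \<theta>)"
proof -
  have "((\<lambda>\<theta>. \<beta>1 + \<beta>2 * real p * K1 \<theta> ^ (p - 1) - \<theta> / 2) has_real_derivative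
      \<beta>2 * real p * (real (p - 1) * K1 \<theta> ^ (p - 1 - 1) * K2 \<theta>) - 1 / 2) (at \<theta>)"
    by (auto intro!: derivative_eq_intros K1_deriv simp: algebra_simps)
  then show ?thesis unfolding force_def[abs_def] g_def using p_ge_2
    by (simp add: of_nat_diff algebra_simps numeral_2_eq_2)
qed

text \<open>First and second order conditions. The second is stated for \<open>force\<close>: if its derivative were
  positive at the maximizer, the objective would increase to the right.\<close>

lemma maximizer_stationary:
  assumes "K1 \<theta> \<in> maximizers \<mu> p \<beta>1 \<beta>2"
  shows "force \<beta>1 \<beta>2 \<theta> = 0" and "\<beta>2 * real p * (real p - 1) * g \<theta> \<le> 1 / 2"
proof -
  have max: "objective \<beta>1 \<beta>2 (K1 \<theta>') \<le> objective \<beta>1 \<beta>2 (K1 \<theta>)" for \<theta>'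
    using assms K1_in(1)[of \<theta>'] maximizers_iff by auto
  have "K2 \<theta> * force \<beta>1 \<beta>2 \<theta> = 0"
    by (rule DERIV_local_max[OF objective_K1_deriv, of 1]) (use max in auto)
  then show F0: "force \<beta>1 \<beta>2 \<theta> = 0" using K2_pos[of \<theta>] by simp
  show "\<beta>2 * real p * (real p - 1) * g \<theta> \<le> 1 / 2"
  proof (rule ccontr)
    assume "\<not> ?thesis"
    then obtain d where d: "d > 0" "\<And>h. 0 < h \<Longrightarrow> h < d \<Longrightarrow> force \<beta>1 \<beta>2 \<theta> < force \<beta>1 \<beta>2 (\<theta> + h)"
      using DERIV_pos_inc_right[OF force_deriv[of \<beta>1 \<beta>2 \<theta>]] by auto
    obtain z where z: "\<theta> < z" "z < \<theta> + d / 2"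
        "objective \<beta>1 \<beta>2 (K1 (\<theta> + d / 2)) - objective \<beta>1 \<beta>2 (K1 \<theta>) = (\<theta> + d / 2 - \<theta>) * (K2 z * force \<beta>1 \<beta>2 z)"
      using MVT2[of \<theta> "\<theta> + d / 2" "\<lambda>\<theta>. objective \<beta>1 \<beta>2 (K1 \<theta>)" "\<lambda>\<theta>. K2 \<theta> * force \<beta>1 \<beta>2 \<theta>"]
        objective_K1_deriv d(1) by auto
    have "force \<beta>1 \<beta>2 z > 0" using d(2)[of "z - \<theta>"] z d(1) F0 by auto
    then have "(\<theta> + d / 2 - \<theta>) * (K2 z * force \<beta>1 \<beta>2 z) > 0" using d(1) K2_pos[of z] by simp
    then show False using max[of "\<theta> + d / 2"] z(3) by linarith
  qed
qed

lemma g_pos: "g \<theta> > 0" unfolding g_def using K2_pos[of \<theta>] K1_bounds[of \<theta>] by simp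

lemma g_le_K2: "g \<theta> \<le> K2 \<theta>"
  unfolding g_def using K2_pos[of \<theta>] K1_bounds[of \<theta>] by (intro mult_left_le power_le_one) auto

text \<open>This has the sign of the derivative of \<open>g\<close>; its zeros are those of the equation in \<open>one_zero\<close>.\<close>

definition q :: "real \<Rightarrow> real" where "q \<theta> = K3 \<theta> * K1 \<theta> + (real p - 2) * (K2 \<theta>)\<^sup>2"

lemma g_deriv: "(g has_real_derivative K1 \<theta> ^ (p - 2) / K1 \<theta> * q \<theta>) (at \<theta>)"
proof -
  have "(g has_real_derivative K3 \<theta> * K1 \<theta> ^ (p - 2) + K2 \<theta> * (real (p - 2) * K1 \<theta> ^ (p - 2 - 1) * K2 \<theta>)) (at \<theta>)"
    unfolding g_def[abs_def] by (auto intro!: derivative_eq_intros K1_deriv K2_deriv)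
  also have "K3 \<theta> * K1 \<theta> ^ (p - 2) + K2 \<theta> * (real (p - 2) * K1 \<theta> ^ (p - 2 - 1) * K2 \<theta>)
      = K1 \<theta> ^ (p - 2) / K1 \<theta> * q \<theta>"
  proof (cases "p - 2")
    case 0
    then have "p = 2" using p_ge_2 by simp
    then show ?thesis unfolding q_def using K1_bounds[of \<theta>] by simp
  next
    case (Suc m)
    then have "real p - 2 = real (Suc m)" using p_ge_2 by linarith
    then show ?thesis using Suc K1_bounds[of \<theta>] by (simp add: q_def field_simps power2_eq_square)
  qed
  finally show ?thesis .
qed

lemma q_eventually_nonzero: "\<exists>\<theta>0. \<forall>\<theta>>\<theta>0. q \<theta> \<noteq> 0"
proof -
  have "(deriv ^^ 3) K = K3" "(deriv ^^ 2) K = K2"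
    using deriv_K by (simp_all add: eval_nat_numeral)
  then have "\<exists>!\<theta>. K3 \<theta> * K1 \<theta> = - (real p - 2) * (K2 \<theta>)\<^sup>2"
    using one_zero by (simp add: deriv_K)
  then obtain \<theta>0 where "\<And>\<theta>. q \<theta> = 0 \<Longrightarrow> \<theta> = \<theta>0" unfolding q_def by (metis add.commute add_eq_0_iff minus_mult_left)
  then show ?thesis by (metis less_irrefl)
qed

lemma q_continuous: "isCont q \<theta>"
  unfolding q_def using K1_continuous K2_continuous K3_continuous
  by (intro continuous_intros) (auto simp: continuous_on_eq_continuous_at)

text \<open>To the right of its last zero \<open>q\<close> has a constant sign. If it were positive, then \<open>K'' \<ge> g\<close> would
  stay above a positive constant and \<open>K'\<close> would be unbounded.\<close>

lemma g_eventually_decreasing: "\<exists>\<theta>0. \<forall>\<theta>1 \<theta>2. \<theta>0 < \<theta>1 \<longrightarrow> \<theta>1 < \<theta>2 \<longrightarrow> g \<theta>2 < g \<theta>1"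
proof -
  obtain \<theta>0 where \<theta>0: "\<And>\<theta>. \<theta> > \<theta>0 \<Longrightarrow> q \<theta> \<noteq> 0" using q_eventually_nonzero by blast
  have neg: "q a < 0" if a: "a > \<theta>0" for a
  proof (rule ccontr)
    assume "\<not> q a < 0"
    then have "q a > 0" using \<theta>0[OF a] by auto
    have pos: "q b > 0" if "b \<ge> a" for b
    proof (rule ccontr)
      assume "\<not> q b > 0"
      then have "\<exists>x. a \<le> x \<and> x \<le> b \<and> q x = 0"
        using \<open>q a > 0\<close> q_continuous that by (intro IVT2) auto
      then show False using \<theta>0 a by force
    qed
    have incr: "g a \<le> g b" if "b \<ge> a" for b
    proof (rule DERIV_nonneg_imp_nondecreasing[OF that])
      fix x assume "a \<le> x" "x \<le> b"
      then have "K1 x ^ (p - 2) / K1 x * q x \<ge> 0"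
        using pos[of x] K1_bounds[of x] by (simp add: order_less_imp_le)
      then show "\<exists>y. (g has_real_derivative y) (at x) \<and> 0 \<le> y" using g_deriv by blast
    qed
    \<comment> \<open>An interval so long that \<open>K'\<close> would grow by 1 on it.\<close>
    define t where "t = 1 / g a"
    have "t > 0" using g_pos[of a] by (simp add: t_def)
    then obtain z where z: "a < z" "z < a + t" "K1 (a + t) - K1 a = (a + t - a) * K2 z"
      using MVT2[of a "a + t" K1 K2] K1_deriv by auto
    have "g a \<le> K2 z" using incr[of z] g_le_K2[of z] z by linarith
    then have "t * g a \<le> K1 (a + t) - K1 a" using z \<open>t > 0\<close> by simp
    then have "1 \<le> K1 (a + t) - K1 a" using g_pos[of a] by (simp add: t_def)
    then show False using K1_bounds[of "a + t"] K1_bounds[of a] by linarith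
  qed
  have "g b < g a" if "\<theta>0 < a" "a < b" for a b
  proof (rule DERIV_neg_imp_decreasing[OF that(2)])
    fix x assume "a \<le> x" "x \<le> b"
    then have "K1 x ^ (p - 2) / K1 x * q x < 0"
      using neg[of x] K1_bounds[of x] that by (intro mult_pos_neg) auto
    then show "\<exists>y. (g has_real_derivative y) (at x) \<and> y < 0" using g_deriv by blast
  qed
  then show ?thesis by blast
qed

text \<open>At a maximizer the derivative of \<open>force\<close> is non-positive; where \<open>g\<close> decreases strictly it is
  negative from there on, so \<open>force\<close> has no second zero further to the right.\<close>

lemma unique_maximizer_near_1:
  "\<exists>a<1. \<forall>\<beta>1 \<beta>2 u v. 0 \<le> \<beta>2 \<longrightarrow> u \<in> maximizers \<mu> p \<beta>1 \<beta>2 \<longrightarrow> v \<in> maximizers \<mu> p \<beta>1 \<beta>2 \<longrightarrow>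
     a < u \<longrightarrow> a < v \<longrightarrow> u = v"
proof -
  obtain \<theta>0 where \<theta>0: "\<And>\<theta>1 \<theta>2. \<theta>0 < \<theta>1 \<Longrightarrow> \<theta>1 < \<theta>2 \<Longrightarrow> g \<theta>2 < g \<theta>1"
    using g_eventually_decreasing by blast
  have no_two: False
    if "0 \<le> \<beta>2" and a: "K1 a \<in> maximizers \<mu> p \<beta>1 \<beta>2" and b: "K1 b \<in> maximizers \<mu> p \<beta>1 \<beta>2"
      and ab: "\<theta>0 < a" "a < b" for a b \<beta>1 \<beta>2
  proof -
    obtain z where z: "a < z" "z < b"
      "force \<beta>1 \<beta>2 b - force \<beta>1 \<beta>2 a = (b - a) * (\<beta>2 * real p * (real p - 1) * g z - 1 / 2)"
      using MVT2[OF ab(2), of "force \<beta>1 \<beta>2" "\<lambda>\<theta>. \<beta>2 * real p * (real p - 1) * g \<theta> - 1 / 2"] force_deriv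
      by blast
    have "\<beta>2 * real p * (real p - 1) * g z - 1 / 2 = 0"
      using z ab maximizer_stationary(1)[OF a] maximizer_stationary(1)[OF b] by simp
    moreover have "\<beta>2 * real p * (real p - 1) * g a \<le> 1 / 2" by (rule maximizer_stationary(2)[OF a])
    moreover have "g z < g a" using \<theta>0 ab z by blast
    moreover have "\<beta>2 * real p * (real p - 1) \<ge> 0" using that(1) p_ge_2 by simp
    ultimately show False
      using mult_strict_left_mono[of "g z" "g a" "\<beta>2 * real p * (real p - 1)"]
      by (cases "\<beta>2 * real p * (real p - 1) = 0") auto
  qed
  show ?thesis
  proof (intro exI[of _ "K1 \<theta>0"] conjI allI impI K1_bounds(2))
    fix \<beta>1 \<beta>2 u v
    assume b: "0 \<le> \<beta>2" and u: "u \<in> maximizers \<mu> p \<beta>1 \<beta>2" and v: "v \<in> maximizers \<mu> p \<beta>1 \<beta>2"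
      and a: "K1 \<theta>0 < u" "K1 \<theta>0 < v"
    obtain x where x: "u = K1 x" using maximizer_has_dual[OF u] .
    obtain y where y: "v = K1 y" using maximizer_has_dual[OF v] .
    have "\<theta>0 < x" "\<theta>0 < y" using a x y K1_strict_mono by (auto simp: strict_mono_less)
    then show "u = v" using no_two[OF b, of x \<beta>1 y] no_two[OF b, of y \<beta>1 x] u v x y
      by (cases x y rule: linorder_cases) auto
  qed
qed

text \<open>The comparison of a maximizer with the point 1. For \<open>p \<ge> 3\<close> a competing maximizer near 0 is
  excluded by the distance \<open>\<delta>\<close> to the line \<open>\<beta>1 = -\<beta>2\<close>, for \<open>p = 2\<close> by the reflection of the interval.\<close>

lemma maximizers_near_1:
  assumes "a < 1" "\<delta> > 0"
  shows "\<exists>R. \<forall>\<beta>1 \<beta>2. \<beta>1 > - \<beta>2 \<longrightarrow> \<beta>2 \<ge> 0 \<longrightarrow> (p = 2 \<or> \<beta>1 + \<beta>2 \<ge> \<delta>) \<longrightarrow> R \<le> norm (\<beta>1, \<beta>2) \<longrightarrow>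
           (\<forall>u \<in> maximizers \<mu> p \<beta>1 \<beta>2. a < u)"
proof -
  define C where "C = J 1"
  have C0: "C \<ge> 0" using J1_nonneg by (simp add: C_def)
  have "\<forall>\<^sub>F v in at 0 within {0..1}. dist (J v) (J 0) < 2 * \<delta> * (1 - a)"
    using J_continuous_endpoint[of 0] assms by (intro tendstoD) auto
  then obtain \<rho>' where \<rho>': "\<rho>' > 0" "\<And>v. v \<in> {0..1} \<Longrightarrow> v \<noteq> 0 \<Longrightarrow> v < \<rho>' \<Longrightarrow> dist (J v) (J 0) < 2 * \<delta> * (1 - a)"
    unfolding eventually_at by (auto simp: dist_real_def)
  define \<rho> where "\<rho> = min \<rho>' (1/2)"
  have \<rho>: "\<rho> > 0" "\<rho> \<le> 1/2" using \<rho>'(1) by (auto simp: \<rho>_def)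
  have Jclose: "C - J v < 2 * \<delta> * (1 - a)" if "v \<in> {0..1}" "v < \<rho>" for v
  proof (cases "v = 0")
    case True then show ?thesis using assms by (simp add: C_def J_0_eq_1)
  next
    case False
    then show ?thesis using \<rho>'(2)[of v] that J_0_eq_1 by (auto simp: \<rho>_def C_def dist_real_def abs_less_iff)
  qed
  \<comment> \<open>A maximizer below \<open>a\<close> forces \<open>\<beta>1 + \<beta>2 \<le> S\<close>, and it lies below \<open>\<rho>\<close> as soon as \<open>\<beta>2 \<ge> B\<close>.\<close>
  define S where "S = C / (2 * (1 - a))"
  define B where "B = (C + 1) / (\<rho> * (1 - a))"
  show ?thesis
  proof (intro exI[of _ "S + 2 * B"] allI impI ballI)
    fix \<beta>1 \<beta>2 u
    assume b: "\<beta>1 > - \<beta>2" "\<beta>2 \<ge> 0" "p = 2 \<or> \<beta>1 + \<beta>2 \<ge> \<delta>" "S + 2 * B \<le> norm (\<beta>1, \<beta>2)"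
      and u: "u \<in> maximizers \<mu> p \<beta>1 \<beta>2"
    show "a < u"
    proof (rule ccontr)
      assume "\<not> a < u"
      then have ua: "u \<le> a" by simp
      have u01: "0 < u" "u < 1" using maximizer_interior[OF u] by auto
      define s where "s = \<beta>1 + \<beta>2"
      have "objective \<beta>1 \<beta>2 1 \<le> objective \<beta>1 \<beta>2 u" using u maximizers_iff by auto
      then have main: "s * (1 - u) + \<beta>2 * (u - u ^ p) \<le> (C - J u) / 2"
        by (simp add: objective_def s_def C_def algebra_simps diff_divide_distrib)
      have Ju: "J u \<ge> 0" by (rule J_nonneg) (use u01 in auto)
      have pow: "u - u ^ p \<ge> u * (1 - a)"
      proof -
        have "u ^ p = u * u ^ (p - 1)" using p_ge_2 by (metis Suc_diff_1 less_le_trans pos2 power_Suc)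
        moreover have "u ^ (p - 1) \<le> u ^ 1" using u01 p_ge_2 by (intro power_decreasing) auto
        ultimately show ?thesis using u01 ua by (auto simp: right_diff_distrib intro: mult_left_mono order_trans)
      qed
      then have pow0: "u - u ^ p \<ge> 0" using u01 assms by (smt (verit) mult_nonneg_nonneg)
      have s0: "s > 0" using b by (simp add: s_def)
      have "s * (1 - a) \<le> s * (1 - u)" using s0 ua by simp
      moreover have b2: "\<beta>2 * (u - u ^ p) \<ge> 0" using pow0 b(2) by simp
      ultimately have "s * (1 - a) \<le> C / 2" using main Ju by simp
      then have "s \<le> S" using assms by (simp add: S_def field_simps)
      moreover have "norm (\<beta>1, \<beta>2) \<le> \<bar>\<beta>1\<bar> + \<bar>\<beta>2\<bar>"
        using sqrt_sum_squares_le_sum_abs by (simp add: norm_prod_def)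
      ultimately have "B \<le> \<beta>2" using b by (simp add: s_def)
      have "\<beta>2 * (u * (1 - a)) \<le> C / 2"
        using mult_left_mono[OF pow b(2)] main Ju mult_pos_pos[OF s0, of "1 - u"] u01 by simp
      have "u < \<rho>"
      proof (rule ccontr)
        assume "\<not> u < \<rho>"
        then have "B * (\<rho> * (1 - a)) \<le> \<beta>2 * (u * (1 - a))"
          using \<open>B \<le> \<beta>2\<close> b \<rho> assms by (intro mult_mono mult_right_mono) auto
        moreover have "B * (\<rho> * (1 - a)) = C + 1" using \<rho> assms by (simp add: B_def)
        ultimately show False using \<open>\<beta>2 * (u * (1 - a)) \<le> C / 2\<close> C0 by simp
      qed
      show False
      proof (cases "p = 2")
        case True
        have "objective \<beta>1 \<beta>2 (1 - u) \<le> objective \<beta>1 \<beta>2 u" using u maximizers_iff by auto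
        moreover have "J (1 - u) = J u" by (rule J_reflect) (use u01 in auto)
        ultimately have "s * (2 * u - 1) \<ge> 0"
          unfolding objective_def by (simp add: True s_def power2_eq_square algebra_simps)
        then have "u \<ge> 1 / 2" using s0 by (simp add: zero_le_mult_iff)
        then show False using \<open>u < \<rho>\<close> \<rho> by simp
      next
        case False
        then have "\<delta> * (1 - a) \<le> s * (1 - a)" using b(3) assms by (simp add: s_def)
        also have "\<dots> \<le> s * (1 - u)" by fact
        also have "\<dots> \<le> (C - J u) / 2" using main b2 by simp
        also have "\<dots> < \<delta> * (1 - a)" using Jclose[of u] u01 \<open>u < \<rho>\<close> by simp
        finally show False by simp
      qed
    qed
  qed
qed

lemma eventually_far_in_cone:
  "(\<forall>\<^sub>F (\<beta>1, \<beta>2) in far_in_cone p \<delta>. P \<beta>1 \<beta>2) \<longleftrightarrow>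
   (\<exists>R. \<forall>\<beta>1 \<beta>2. \<beta>1 > - \<beta>2 \<longrightarrow> \<beta>2 \<ge> 0 \<longrightarrow> (p = 2 \<or> \<beta>1 + \<beta>2 \<ge> \<delta>) \<longrightarrow> R \<le> norm (\<beta>1, \<beta>2) \<longrightarrow> P \<beta>1 \<beta>2)"
  unfolding far_in_cone_def eventually_inf_principal eventually_at_infinity
  by (auto split: prod.splits)

lemma unique_maximizer_far_in_cone:
  assumes "a < 1" "\<delta> > 0"
  shows "\<forall>\<^sub>F (\<beta>1, \<beta>2) in far_in_cone p \<delta>. \<exists>\<theta>. maximizers \<mu> p \<beta>1 \<beta>2 = {K1 \<theta>} \<and> a < K1 \<theta>"
proof -
  obtain a' where a': "a' < 1" "\<And>\<beta>1 \<beta>2 u v. 0 \<le> \<beta>2 \<Longrightarrow> u \<in> maximizers \<mu> p \<beta>1 \<beta>2 \<Longrightarrow> v \<in> maximizers \<mu> p \<beta>1 \<beta>2 \<Longrightarrow>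
     a' < u \<Longrightarrow> a' < v \<Longrightarrow> u = v" using unique_maximizer_near_1 by blast
  obtain R where R: "\<And>\<beta>1 \<beta>2 u. \<beta>1 > - \<beta>2 \<Longrightarrow> \<beta>2 \<ge> 0 \<Longrightarrow> p = 2 \<or> \<beta>1 + \<beta>2 \<ge> \<delta> \<Longrightarrow> R \<le> norm (\<beta>1, \<beta>2) \<Longrightarrow>
           u \<in> maximizers \<mu> p \<beta>1 \<beta>2 \<Longrightarrow> max a a' < u"
    using maximizers_near_1[of "max a a'" \<delta>] assms a'(1) unfolding max_less_iff_conj[of _ _ 1] by blast
  show ?thesis unfolding eventually_far_in_cone
  proof (rule exI[of _ R], intro allI impI)
    fix \<beta>1 \<beta>2 :: real
    assume b: "\<beta>1 > - \<beta>2" "\<beta>2 \<ge> 0" "p = 2 \<or> \<beta>1 + \<beta>2 \<ge> \<delta>" "R \<le> norm (\<beta>1, \<beta>2)"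
    obtain u where u: "u \<in> maximizers \<mu> p \<beta>1 \<beta>2" using maximizer_exists by blast
    then obtain \<theta> where \<theta>: "u = K1 \<theta>" using maximizer_has_dual by blast
    have "v = u" if "v \<in> maximizers \<mu> p \<beta>1 \<beta>2" for v
      using a'(2)[OF b(2) that u] R[OF b that] R[OF b u] by simp
    then have "maximizers \<mu> p \<beta>1 \<beta>2 = {K1 \<theta>}" using u \<theta> by blast
    moreover have "a < K1 \<theta>" using R[OF b u] \<theta> by simp
    ultimately show "\<exists>\<theta>. maximizers \<mu> p \<beta>1 \<beta>2 = {K1 \<theta>} \<and> a < K1 \<theta>" by blast
  qed
qed

text \<open>Replacing \<open>u\<close> by 1 in \<open>\<theta> = 2 (\<beta>1 + p \<beta>2 u^(p-1))\<close> causes a relative error of at most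
  \<open>p (1 - u^(p-1))\<close>, because \<open>\<beta>2 < \<beta>1 + p \<beta>2\<close> in the cone.\<close>

lemma dual_asymp_equiv:
  assumes "\<delta> > 0"
    and \<theta>: "\<forall>\<^sub>F (\<beta>1, \<beta>2) in far_in_cone p \<delta>. maximizers \<mu> p \<beta>1 \<beta>2 = {K1 (\<theta> (\<beta>1, \<beta>2))}"
  shows "\<theta> \<sim>[far_in_cone p \<delta>] (\<lambda>(\<beta>1, \<beta>2). 2 * (\<beta>1 + real p * \<beta>2))"
proof (rule asymp_equivI', rule tendstoI)
  fix \<epsilon> :: real assume "\<epsilon> > 0"
  \<comment> \<open>One factor \<open>p\<close> bounds \<open>p \<beta>2 / (\<beta>1 + p \<beta>2)\<close>, the other one compares \<open>1 - u^(p-1)\<close> with \<open>1 - u\<close>.\<close>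
  define a where "a = 1 - \<epsilon> / (real p * real p)"
  have "a < 1" using \<open>\<epsilon> > 0\<close> p_ge_2 by (simp add: a_def)
  from unique_maximizer_far_in_cone[OF this \<open>\<delta> > 0\<close>]
  have near: "\<forall>\<^sub>F (\<beta>1, \<beta>2) in far_in_cone p \<delta>. \<exists>\<theta>. maximizers \<mu> p \<beta>1 \<beta>2 = {K1 \<theta>} \<and> a < K1 \<theta>" .
  have cone: "\<forall>\<^sub>F (\<beta>1, \<beta>2) in far_in_cone p \<delta>. \<beta>1 > - \<beta>2 \<and> \<beta>2 \<ge> 0"
    unfolding eventually_far_in_cone by auto
  show "\<forall>\<^sub>F \<beta> in far_in_cone p \<delta>. dist (\<theta> \<beta> / (case \<beta> of (\<beta>1, \<beta>2) \<Rightarrow> 2 * (\<beta>1 + real p * \<beta>2))) 1 < \<epsilon>"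
    using near cone \<theta>
  proof eventually_elim
    case (elim \<beta>)
    obtain \<beta>1 \<beta>2 where \<beta>: "\<beta> = (\<beta>1, \<beta>2)" by force
    define t where "t = \<theta> (\<beta>1, \<beta>2)"
    have b: "\<beta>1 > - \<beta>2" "\<beta>2 \<ge> 0" and max: "maximizers \<mu> p \<beta>1 \<beta>2 = {K1 t}" and "a < K1 t"
      using elim by (auto simp: \<beta> t_def)
    define D where "D = \<beta>1 + real p * \<beta>2"
    have "t = 2 * (\<beta>1 + \<beta>2 * real p * K1 t ^ (p - 1))"
      using maximizer_stationary(1)[of t \<beta>1 \<beta>2] max by (simp add: force_def)
    then have t: "t = 2 * D - 2 * (real p * \<beta>2 * (1 - K1 t ^ (p - 1)))"
      by (simp add: D_def algebra_simps)
    have "\<beta>2 * 1 \<le> \<beta>2 * (real p - 1)" using p_ge_2 b by (intro mult_left_mono) auto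
    then have D: "\<beta>2 < D" using b by (simp add: D_def algebra_simps)
    then have D0: "D > 0" using b by simp
    have pw: "1 - K1 t ^ (p - 1) \<le> real p * (1 - K1 t)" "1 - K1 t ^ (p - 1) \<ge> 0"
    proof -
      have "1 - K1 t ^ p \<le> real p * (1 - K1 t)"
        using abs_pow_diff_le[of 1 "K1 t"] K1_bounds[of t] by (simp add: power_le_one)
      moreover have "K1 t ^ p \<le> K1 t ^ (p - 1)" using K1_bounds[of t] by (intro power_decreasing) auto
      ultimately show "1 - K1 t ^ (p - 1) \<le> real p * (1 - K1 t)" by simp
      show "1 - K1 t ^ (p - 1) \<ge> 0" using K1_bounds[of t] by (simp add: power_le_one)
    qed
    have "t / (2 * D) - 1 = - (real p * (\<beta>2 / D) * (1 - K1 t ^ (p - 1)))"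
      using D0 by (subst t) (simp add: field_simps)
    then have "\<bar>t / (2 * D) - 1\<bar> = real p * (\<beta>2 / D) * (1 - K1 t ^ (p - 1))"
      using D0 b pw(2) by simp
    also have "\<dots> \<le> real p * 1 * (real p * (1 - K1 t))"
      using D D0 b pw by (intro mult_mono) auto
    also have "\<dots> < \<epsilon>"
      using \<open>a < K1 t\<close> p_ge_2 by (simp add: a_def field_simps)
    finally show ?case by (simp add: \<beta> D_def t_def dist_real_def)
  qed
qed

end

section \<open>Homomorphism sums and the cut norm\<close>

lemma complete_edgesD:
  assumes "e \<in> complete_edges k"
  shows "e = {Min e, Max e}" "Min e < Max e" "Min e \<in> {1..k}" "Max e \<in> {1..k}" "finite e"
proof -
  from assms have e: "e \<subseteq> {1..k}" "card e = 2" by (auto simp: complete_edges_def)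
  then obtain a b where ab: "e = {a, b}" "a \<noteq> b" by (auto simp: card_2_iff)
  then show "e = {Min e, Max e}" "Min e < Max e" by (auto simp: min_def max_def)
  show "finite e" using ab by simp
  then have "Min e \<in> e" "Max e \<in> e" using ab by auto
  then show "Min e \<in> {1..k}" "Max e \<in> {1..k}" using e by auto
qed

lemma finite_complete_edges [simp, intro]: "finite (complete_edges n)"
  by (rule finite_subset[of _ "Pow {1..n}"]) (auto simp: complete_edges_def)

lemma simple_graph_finite: "simple_graph k E \<Longrightarrow> finite E"
  unfolding simple_graph_def using finite_complete_edges finite_subset by blast

lemma sum_pairs_eq_edges:
  fixes F :: "nat \<Rightarrow> nat \<Rightarrow> real"
  assumes sym: "\<And>i j. F i j = F j i"
  shows "(\<Sum>i\<in>{1..n}. \<Sum>j\<in>{1..n}. F i j) = 2 * (\<Sum>e\<in>complete_edges n. F (Min e) (Max e)) + (\<Sum>i\<in>{1..n}. F i i)"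
proof -
  define L where "L = {(i, j). i \<in> {1..n} \<and> j \<in> {1..n} \<and> i < j}"
  define U where "U = {(i, j). i \<in> {1..n} \<and> j \<in> {1..n} \<and> j < i}"
  define D where "D = {(i, j). i \<in> {1..n} \<and> j \<in> {1..n} \<and> i = j}"
  have fin: "finite L" "finite U" "finite D"
    by (rule finite_subset[of _ "{1..n} \<times> {1..n}"]; force simp: L_def U_def D_def)+
  have split: "{1..n} \<times> {1..n} = L \<union> (U \<union> D)" by (auto simp: L_def U_def D_def)
  have disj: "L \<inter> (U \<union> D) = {}" "U \<inter> D = {}" by (auto simp: L_def U_def D_def)
  have e1: "(\<Sum>(i, j)\<in>L. F i j) = (\<Sum>e\<in>complete_edges n. F (Min e) (Max e))"
  proof (rule sum.reindex_bij_witness[where i = "\<lambda>e. (Min e, Max e)" and j = "\<lambda>(i, j). {i, j}"])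
    fix e assume e: "e \<in> complete_edges n"
    show "(case (Min e, Max e) of (i, j) \<Rightarrow> {i, j}) = e" using complete_edgesD(1)[OF e] by simp
    show "(Min e, Max e) \<in> L" using complete_edgesD[OF e] by (simp add: L_def)
  qed (auto simp: L_def complete_edges_def)
  have e2: "(\<Sum>(i, j)\<in>U. F i j) = (\<Sum>(i, j)\<in>L. F i j)"
    by (rule sum.reindex_bij_witness[where i = prod.swap and j = prod.swap]) (auto simp: U_def L_def sym)
  have e3: "(\<Sum>(i, j)\<in>D. F i j) = (\<Sum>i\<in>{1..n}. F i i)"
    by (rule sum.reindex_bij_witness[where i = "\<lambda>i. (i, i)" and j = fst]) (auto simp: D_def)
  show ?thesis
    unfolding sum.cartesian_product split
    using disj fin by (subst sum.union_disjoint; simp add: sum.union_disjoint e1 e2 e3)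
qed

text \<open>Redrawing one coordinate: the map \<open>(x, i) \<mapsto> (x(a := i), x a)\<close> is an involution. This serves
  as Fubini's theorem for sums over all maps from \<open>I\<close> to \<open>V\<close>.\<close>

lemma sum_PiE_resample:
  fixes G :: "('i \<Rightarrow> 'v) \<Rightarrow> real"
  assumes "a \<in> I"
  shows "(\<Sum>x\<in>I \<rightarrow>\<^sub>E V. \<Sum>i\<in>V. G (x(a := i))) = real (card V) * (\<Sum>x\<in>I \<rightarrow>\<^sub>E V. G x)"
proof -
  have "(\<Sum>x\<in>I \<rightarrow>\<^sub>E V. \<Sum>i\<in>V. G (x(a := i))) = (\<Sum>(x, i)\<in>(I \<rightarrow>\<^sub>E V) \<times> V. G (x(a := i)))"
    by (simp add: sum.cartesian_product)
  also have "\<dots> = (\<Sum>(x, i)\<in>(I \<rightarrow>\<^sub>E V) \<times> V. G x)"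
    by (rule sum.reindex_bij_witness[where i = "\<lambda>(x, i). (x(a := i), x a)" and j = "\<lambda>(x, i). (x(a := i), x a)"])
      (use assms in \<open>auto simp: PiE_iff extensional_def\<close>)
  also have "\<dots> = real (card V) * (\<Sum>x\<in>I \<rightarrow>\<^sub>E V. G x)"
    by (simp add: sum.cartesian_product[symmetric] sum_distrib_left)
  finally show ?thesis .
qed

lemma sum_PiE_resample2:
  fixes G :: "('i \<Rightarrow> 'v) \<Rightarrow> real"
  assumes "a \<in> I" "b \<in> I"
  shows "(\<Sum>x\<in>I \<rightarrow>\<^sub>E V. \<Sum>i\<in>V. \<Sum>j\<in>V. G (x(a := i, b := j))) = (real (card V))\<^sup>2 * (\<Sum>x\<in>I \<rightarrow>\<^sub>E V. G x)"
  using sum_PiE_resample[OF assms(1), of "\<lambda>x. \<Sum>j\<in>V. G (x(b := j))" V] sum_PiE_resample[OF assms(2), of G V]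
  by (simp add: power2_eq_square)

lemma sum_PiE_pair:
  fixes h :: "'v \<Rightarrow> 'v \<Rightarrow> real"
  assumes "finite I" "a \<in> I" "b \<in> I" "a \<noteq> b" "finite V"
  shows "(real (card V))\<^sup>2 * (\<Sum>x\<in>I \<rightarrow>\<^sub>E V. h (x a) (x b)) = real (card V) ^ card I * (\<Sum>i\<in>V. \<Sum>j\<in>V. h i j)"
  using sum_PiE_resample2[OF assms(2,3), of "\<lambda>x. h (x a) (x b)" V] assms by (simp add: card_PiE)

text \<open>The cut norm of the kernel \<open>M\<close>, normalized by the number of pairs, is at most \<open>\<epsilon>\<close>.\<close>

definition cut_small :: "'v set \<Rightarrow> real \<Rightarrow> ('v \<Rightarrow> 'v \<Rightarrow> real) \<Rightarrow> bool" where
  "cut_small V \<epsilon> M \<longleftrightarrow> (\<forall>S\<subseteq>V. \<forall>T\<subseteq>V. \<bar>\<Sum>i\<in>S. \<Sum>j\<in>T. M i j\<bar> \<le> \<epsilon> * (real (card V))\<^sup>2)"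

lemma weighted_sum_le_subset_sum:
  fixes f a :: "'v \<Rightarrow> real"
  assumes "finite V" "\<And>i. i \<in> V \<Longrightarrow> a i \<in> {0..1}"
  shows "(\<Sum>i\<in>V. a i * f i) \<le> (\<Sum>i\<in>{i\<in>V. f i > 0}. f i)"
proof -
  have "(\<Sum>i\<in>V. a i * f i) \<le> (\<Sum>i\<in>V. if f i > 0 then f i else 0)"
  proof (rule sum_mono)
    fix i assume "i \<in> V"
    then show "a i * f i \<le> (if f i > 0 then f i else 0)"
      using assms(2)[of i] mult_left_le_one_le[of "f i" "a i"] mult_nonneg_nonpos[of "a i" "f i"] by auto
  qed
  also have "\<dots> = (\<Sum>i\<in>{i\<in>V. f i > 0}. f i)" using assms(1) by (simp add: sum.If_cases Int_def)
  finally show ?thesis .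
qed

text \<open>A bilinear form on weights in the unit interval is largest at weights 0 and 1.\<close>

lemma cut_small_weighted_upper:
  assumes "finite V" "cut_small V \<epsilon> M"
    "\<And>i. i \<in> V \<Longrightarrow> a i \<in> {0..1}" "\<And>i. i \<in> V \<Longrightarrow> b i \<in> {0..1}"
  shows "(\<Sum>i\<in>V. \<Sum>j\<in>V. M i j * (a i * b j)) \<le> \<epsilon> * (real (card V))\<^sup>2"
proof -
  define S where "S = {i\<in>V. (\<Sum>j\<in>V. M i j * b j) > 0}"
  define T where "T = {j\<in>V. (\<Sum>i\<in>S. M i j) > 0}"
  have "(\<Sum>i\<in>V. \<Sum>j\<in>V. M i j * (a i * b j)) = (\<Sum>i\<in>V. a i * (\<Sum>j\<in>V. M i j * b j))"
    by (simp add: sum_distrib_left mult_ac)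
  also have "\<dots> \<le> (\<Sum>i\<in>S. \<Sum>j\<in>V. M i j * b j)"
    unfolding S_def by (rule weighted_sum_le_subset_sum) (use assms in auto)
  also have "\<dots> = (\<Sum>j\<in>V. b j * (\<Sum>i\<in>S. M i j))"
    by (subst sum.swap) (simp add: sum_distrib_left mult_ac)
  also have "\<dots> \<le> (\<Sum>j\<in>T. \<Sum>i\<in>S. M i j)"
    unfolding T_def by (rule weighted_sum_le_subset_sum) (use assms in auto)
  also have "\<dots> = (\<Sum>i\<in>S. \<Sum>j\<in>T. M i j)" by (rule sum.swap)
  also have "\<dots> \<le> \<epsilon> * (real (card V))\<^sup>2"
  proof -
    have "S \<subseteq> V" "T \<subseteq> V" by (auto simp: S_def T_def)
    then have "\<bar>\<Sum>i\<in>S. \<Sum>j\<in>T. M i j\<bar> \<le> \<epsilon> * (real (card V))\<^sup>2"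
      using assms(2) unfolding cut_small_def by blast
    then show ?thesis by linarith
  qed
  finally show ?thesis .
qed

lemma cut_small_weighted:
  assumes "finite V" "cut_small V \<epsilon> M"
    "\<And>i. i \<in> V \<Longrightarrow> a i \<in> {0..1}" "\<And>i. i \<in> V \<Longrightarrow> b i \<in> {0..1}"
  shows "\<bar>\<Sum>i\<in>V. \<Sum>j\<in>V. M i j * (a i * b j)\<bar> \<le> \<epsilon> * (real (card V))\<^sup>2"
proof -
  have "cut_small V \<epsilon> (\<lambda>i j. - M i j)" using assms(2) by (simp add: cut_small_def sum_negf)
  from cut_small_weighted_upper[OF assms(1) this, of a b] assms(3,4)
  have "- (\<Sum>i\<in>V. \<Sum>j\<in>V. M i j * (a i * b j)) \<le> \<epsilon> * (real (card V))\<^sup>2" by (simp add: sum_negf)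
  then show ?thesis using cut_small_weighted_upper[OF assms(1,2), of a b] assms(3,4) by auto
qed

text \<open>Unnormalized homomorphism density with a kernel for each edge, so that kernels can be
  exchanged one edge at a time.\<close>

definition hom_sum :: "'v set \<Rightarrow> nat \<Rightarrow> nat set set \<Rightarrow> (nat set \<Rightarrow> 'v \<Rightarrow> 'v \<Rightarrow> real) \<Rightarrow> real" where
  "hom_sum V k E W = (\<Sum>x\<in>{1..k} \<rightarrow>\<^sub>E V. \<Prod>e\<in>E. W e (x (Min e)) (x (Max e)))"

lemma hom_sum_cong:
  assumes "\<And>e i j. e \<in> E \<Longrightarrow> i \<in> V \<Longrightarrow> j \<in> V \<Longrightarrow> W e i j = W' e i j" "simple_graph k E"
  shows "hom_sum V k E W = hom_sum V k E W'"
  unfolding hom_sum_def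
proof (intro sum.cong prod.cong refl)
  fix x e assume "x \<in> {1..k} \<rightarrow>\<^sub>E V" "e \<in> E"
  moreover have "e \<in> complete_edges k" using \<open>e \<in> E\<close> assms(2) by (auto simp: simple_graph_def)
  ultimately show "W e (x (Min e)) (x (Max e)) = W' e (x (Min e)) (x (Max e))"
    using complete_edgesD[of e k] by (intro assms(1)) (auto simp: PiE_iff)
qed

text \<open>With all coordinates but the ends \<open>a\<close> and \<open>b\<close> of \<open>e0\<close> fixed, the remaining edges contribute a
  function of \<open>x a\<close> times a function of \<open>x b\<close>: no other edge of a simple graph contains both.
  So the difference is a weighted cut of the difference of the two kernels.\<close>

lemma hom_sum_change_edge:
  fixes V :: "'v set"
  assumes V: "finite V" "V \<noteq> {}" and graph: "simple_graph k E" and e0: "e0 \<in> E"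
    and W: "\<And>e i j. e \<in> E \<Longrightarrow> i \<in> V \<Longrightarrow> j \<in> V \<Longrightarrow> W e i j \<in> {0..1}"
    and same: "\<And>e. e \<noteq> e0 \<Longrightarrow> W' e = W e"
    and cut: "cut_small V \<epsilon> (\<lambda>i j. W e0 i j - W' e0 i j)"
  shows "\<bar>hom_sum V k E W - hom_sum V k E W'\<bar> \<le> \<epsilon> * real (card V) ^ k"
proof -
  define a where "a = Min e0"
  define b where "b = Max e0"
  have "e0 \<in> complete_edges k" using e0 graph by (auto simp: simple_graph_def)
  note ab = complete_edgesD[OF this, folded a_def b_def]
  define E' where "E' = E - {e0}"
  have finE: "finite E" by (rule simple_graph_finite[OF graph])
  define M where "M i j = W e0 i j - W' e0 i j" for i j
  define R where "R F x = (\<Prod>e\<in>F. W e (x (Min e)) (x (Max e)))" for F and x :: "nat \<Rightarrow> 'v"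
  define Ea where "Ea = {e\<in>E'. a \<in> e}"
  define Eb where "Eb = {e\<in>E'. a \<notin> e}"
  have diff: "hom_sum V k E W - hom_sum V k E W' = (\<Sum>x\<in>{1..k} \<rightarrow>\<^sub>E V. M (x a) (x b) * R E' x)"
    unfolding hom_sum_def sum_subtractf[symmetric]
  proof (rule sum.cong[OF refl])
    fix x
    have "(\<Prod>e\<in>E. W' e (x (Min e)) (x (Max e))) = W' e0 (x a) (x b) * R E' x"
      unfolding R_def E'_def a_def b_def by (subst prod.remove[OF finE e0]) (simp add: same)
    moreover have "(\<Prod>e\<in>E. W e (x (Min e)) (x (Max e))) = W e0 (x a) (x b) * R E' x"
      unfolding R_def E'_def a_def b_def by (subst prod.remove[OF finE e0]) simp
    ultimately show "(\<Prod>e\<in>E. W e (x (Min e)) (x (Max e))) - (\<Prod>e\<in>E. W' e (x (Min e)) (x (Max e))) = M (x a) (x b) * R E' x"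
      by (simp add: M_def algebra_simps)
  qed
  have edge: "e = {Min e, Max e}" "Min e \<in> {1..k}" "Max e \<in> {1..k}" if "e \<in> E" for e
    using complete_edgesD[of e k] graph that by (auto simp: simple_graph_def)
  have R01: "R F x \<in> {0..1}" if "F \<subseteq> E" "\<And>v. v \<in> {1..k} \<Longrightarrow> x v \<in> V" for F x
    unfolding R_def using that W edge by (auto intro!: prod_nonneg prod_le_1 simp: subset_iff)
  have fixed: "\<bar>\<Sum>i\<in>V. \<Sum>j\<in>V. M i j * R E' (x(a := i, b := j))\<bar> \<le> \<epsilon> * (real (card V))\<^sup>2"
    if x: "x \<in> {1..k} \<rightarrow>\<^sub>E V" for x
  proof -
    have "R E' (x(a := i, b := j)) = R Ea (x(a := i)) * R Eb (x(b := j))" for i j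
    proof -
      have "R E' y = R Ea y * R Eb y" for y
        unfolding R_def Ea_def Eb_def using finE
        by (subst prod.union_disjoint[symmetric]) (auto intro!: prod.cong simp: E'_def)
      moreover have "R Ea (x(a := i, b := j)) = R Ea (x(a := i))"
        unfolding R_def
      proof (intro prod.cong refl)
        fix e assume e: "e \<in> Ea"
        then have "e \<in> E" "e \<noteq> e0" "a \<in> e" by (auto simp: Ea_def E'_def)
        have "b \<notin> e"
        proof
          assume "b \<in> e"
          then have "e = {a, b}" using edge(1)[OF \<open>e \<in> E\<close>] \<open>a \<in> e\<close> ab(2)
            by (metis insert_iff less_irrefl singletonD doubleton_eq_iff)
          then show False using ab(1) \<open>e \<noteq> e0\<close> by simp
        qed
        then have "Min e \<noteq> b" "Max e \<noteq> b" using edge(1)[OF \<open>e \<in> E\<close>] by auto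
        then show "W e ((x(a := i, b := j)) (Min e)) ((x(a := i, b := j)) (Max e)) =
          W e ((x(a := i)) (Min e)) ((x(a := i)) (Max e))" by simp
      qed
      moreover have "R Eb (x(a := i, b := j)) = R Eb (x(b := j))"
        unfolding R_def
      proof (intro prod.cong refl)
        fix e assume e: "e \<in> Eb"
        then have "e \<in> E" "a \<notin> e" by (auto simp: Eb_def E'_def)
        then have "Min e \<noteq> a" "Max e \<noteq> a" using edge(1)[OF \<open>e \<in> E\<close>] by auto
        then show "W e ((x(a := i, b := j)) (Min e)) ((x(a := i, b := j)) (Max e)) =
          W e ((x(b := j)) (Min e)) ((x(b := j)) (Max e))" using ab(2) by (simp add: fun_upd_twist)
      qed
      ultimately show ?thesis by simp
    qed
    moreover have "\<bar>\<Sum>i\<in>V. \<Sum>j\<in>V. M i j * (R Ea (x(a := i)) * R Eb (x(b := j)))\<bar> \<le> \<epsilon> * (real (card V))\<^sup>2"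
      using x ab(3,4) unfolding M_def
      by (intro cut_small_weighted V cut R01) (auto simp: Ea_def Eb_def E'_def PiE_iff)
    ultimately show ?thesis by simp
  qed
  have n0: "real (card V) > 0" using V by (simp add: card_gt_0_iff)
  have "(real (card V))\<^sup>2 * \<bar>hom_sum V k E W - hom_sum V k E W'\<bar>
      = \<bar>\<Sum>x\<in>{1..k} \<rightarrow>\<^sub>E V. \<Sum>i\<in>V. \<Sum>j\<in>V. M i j * R E' (x(a := i, b := j))\<bar>"
    using sum_PiE_resample2[OF ab(3,4), of "\<lambda>x. M (x a) (x b) * R E' x" V] ab(2) n0
    by (simp add: diff abs_mult)
  also have "\<dots> \<le> (\<Sum>x\<in>{1..k} \<rightarrow>\<^sub>E V. \<epsilon> * (real (card V))\<^sup>2)"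
    by (intro order_trans[OF sum_abs] sum_mono fixed)
  also have "\<dots> = (real (card V))\<^sup>2 * (\<epsilon> * real (card V) ^ k)"
    using V by (simp add: card_PiE)
  finally show ?thesis using n0 by simp
qed

text \<open>The counting lemma, by exchanging the kernels edge by edge.\<close>

lemma hom_sum_counting:
  fixes A B :: "'v \<Rightarrow> 'v \<Rightarrow> real"
  assumes V: "finite V" "V \<noteq> {}" and graph: "simple_graph k E"
    and A: "\<And>i j. i \<in> V \<Longrightarrow> j \<in> V \<Longrightarrow> A i j \<in> {0..1}"
    and B: "\<And>i j. i \<in> V \<Longrightarrow> j \<in> V \<Longrightarrow> B i j \<in> {0..1}"
    and cut: "cut_small V \<epsilon> (\<lambda>i j. A i j - B i j)"
  shows "\<bar>hom_sum V k E (\<lambda>_. A) - hom_sum V k E (\<lambda>_. B)\<bar> \<le> real (card E) * \<epsilon> * real (card V) ^ k"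
proof -
  \<comment> \<open>The kernels have been exchanged on the edges in \<open>F\<close>.\<close>
  define W where "W F e = (if e \<in> F then B else A)" for F and e :: "nat set"
  have finE: "finite E" by (rule simple_graph_finite[OF graph])
  have "\<bar>hom_sum V k E (W {}) - hom_sum V k E (W F)\<bar> \<le> real (card F) * \<epsilon> * real (card V) ^ k"
    if "finite F" "F \<subseteq> E" for F
    using that
  proof (induction F)
    case (insert e F)
    have "\<bar>hom_sum V k E (W F) - hom_sum V k E (W (insert e F))\<bar> \<le> \<epsilon> * real (card V) ^ k"
    proof (rule hom_sum_change_edge[OF V graph])
      show "cut_small V \<epsilon> (\<lambda>i j. W F e i j - W (insert e F) e i j)"
        using cut insert.hyps by (simp add: W_def)
    qed (use insert A B in \<open>auto simp: W_def\<close>)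
    moreover have "real (card (insert e F)) * \<epsilon> * real (card V) ^ k
        = real (card F) * \<epsilon> * real (card V) ^ k + \<epsilon> * real (card V) ^ k"
      using insert.hyps by (simp add: algebra_simps)
    ultimately show ?case using insert.IH insert.prems by simp
  qed simp
  from this[OF finE order_refl]
  have "\<bar>hom_sum V k E (W {}) - hom_sum V k E (W E)\<bar> \<le> real (card E) * \<epsilon> * real (card V) ^ k" .
  moreover have "hom_sum V k E (W {}) = hom_sum V k E (\<lambda>_. A)" "hom_sum V k E (W E) = hom_sum V k E (\<lambda>_. B)"
    by (auto intro!: hom_sum_cong graph simp: W_def)
  ultimately show ?thesis by simp
qed

text \<open>With as many factors as the exponent, the inequality between the means replaces the generalized
  inequality of Hoelder: each factor is integrated separately afterwards.\<close>

lemma prod_le_mean_power: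
  fixes f :: "'e \<Rightarrow> real"
  assumes "finite E" "E \<noteq> {}" "\<And>e. e \<in> E \<Longrightarrow> f e \<ge> 0"
  shows "(\<Prod>e\<in>E. f e) \<le> (\<Sum>e\<in>E. f e ^ card E) / real (card E)"
proof -
  have c: "card E > 0" using assms by (simp add: card_gt_0_iff)
  have p0: "(\<Prod>e\<in>E. f e) \<ge> 0" using assms by (intro prod_nonneg) auto
  have "(\<Prod>e\<in>E. f e ^ card E) = (\<Prod>e\<in>E. f e) ^ card E" by (simp add: prod_power_distrib)
  then have "(\<Prod>e\<in>E. f e ^ card E) powr (1 / card E) = (\<Prod>e\<in>E. f e)"
    using c p0 by (simp add: real_root_power_cancel flip: root_powr_inverse)
  moreover have "(\<Prod>e\<in>E. f e ^ card E) powr (1 / card E) \<le> (\<Sum>e\<in>E. f e ^ card E / real (card E))"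
    by (rule arith_geom_mean) (use assms in auto)
  ultimately show ?thesis by (simp add: sum_divide_distrib)
qed

text \<open>After the inequality between the means each term depends on a single pair of vertices, and all
  edges contribute the same sum. This reduces the variational problem over kernels to a scalar one.\<close>

lemma hom_sum_le_power_mean:
  fixes B :: "'v \<Rightarrow> 'v \<Rightarrow> real"
  assumes V: "finite V" and graph: "simple_graph k E" and E: "E \<noteq> {}"
    and B: "\<And>i j. i \<in> V \<Longrightarrow> j \<in> V \<Longrightarrow> B i j \<ge> 0"
  shows "(real (card V))\<^sup>2 * hom_sum V k E (\<lambda>_. B) \<le> real (card V) ^ k * (\<Sum>i\<in>V. \<Sum>j\<in>V. B i j ^ card E)"
proof -
  have finE: "finite E" by (rule simple_graph_finite[OF graph])
  have edge: "Min e \<in> {1..k}" "Max e \<in> {1..k}" "Min e \<noteq> Max e" if "e \<in> E" for e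
    using complete_edgesD[of e k] graph that by (auto simp: simple_graph_def)
  have "hom_sum V k E (\<lambda>_. B) \<le> (\<Sum>x\<in>{1..k} \<rightarrow>\<^sub>E V. (\<Sum>e\<in>E. B (x (Min e)) (x (Max e)) ^ card E) / real (card E))"
    unfolding hom_sum_def
    using edge B by (intro sum_mono prod_le_mean_power finE E) (auto simp: PiE_iff)
  also have "\<dots> = (\<Sum>e\<in>E. \<Sum>x\<in>{1..k} \<rightarrow>\<^sub>E V. B (x (Min e)) (x (Max e)) ^ card E) / real (card E)"
    by (subst sum.swap) (simp add: sum_divide_distrib)
  finally have "(real (card V))\<^sup>2 * hom_sum V k E (\<lambda>_. B)
      \<le> (\<Sum>e\<in>E. (real (card V))\<^sup>2 * (\<Sum>x\<in>{1..k} \<rightarrow>\<^sub>E V. B (x (Min e)) (x (Max e)) ^ card E)) / real (card E)"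
    by (simp add: mult_left_mono sum_distrib_left[symmetric] flip: times_divide_eq_right)
  also have "\<dots> = (\<Sum>e\<in>E. real (card V) ^ k * (\<Sum>i\<in>V. \<Sum>j\<in>V. B i j ^ card E)) / real (card E)"
  proof -
    have "(real (card V))\<^sup>2 * (\<Sum>x\<in>{1..k} \<rightarrow>\<^sub>E V. B (x (Min e)) (x (Max e)) ^ card E)
      = real (card V) ^ k * (\<Sum>i\<in>V. \<Sum>j\<in>V. B i j ^ card E)" if "e \<in> E" for e
      using sum_PiE_pair[OF _ edge[OF that] V, of "\<lambda>i j. B i j ^ card E"] by simp
    then show ?thesis by simp
  qed
  also have "\<dots> = real (card V) ^ k * (\<Sum>i\<in>V. \<Sum>j\<in>V. B i j ^ card E)"
    using finE E by (simp add: card_gt_0_iff)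
  finally show ?thesis .
qed

section \<open>Partition averages and weak regularity\<close>

text \<open>The conditional expectation of \<open>f\<close> under the uniform distribution on \<open>X\<close>, given \<open>\<phi>\<close>.\<close>

definition class_avg :: "'a set \<Rightarrow> ('a \<Rightarrow> real) \<Rightarrow> ('a \<Rightarrow> 'c) \<Rightarrow> 'a \<Rightarrow> real" where
  "class_avg X f \<phi> x = (\<Sum>y\<in>{y\<in>X. \<phi> y = \<phi> x}. f y) / real (card {y\<in>X. \<phi> y = \<phi> x})"

lemma class_avg_inner:
  assumes "finite X"
  shows "(\<Sum>x\<in>X. f x * g (\<phi> x)) = (\<Sum>x\<in>X. class_avg X f \<phi> x * g (\<phi> x))"
proof -
  have "(\<Sum>x\<in>{x\<in>X. \<phi> x = y}. f x * g (\<phi> x)) = (\<Sum>x\<in>{x\<in>X. \<phi> x = y}. class_avg X f \<phi> x * g (\<phi> x))"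
    if "y \<in> \<phi> ` X" for y
  proof -
    have pos: "card {x\<in>X. \<phi> x = y} > 0" using that assms by (auto simp: card_gt_0_iff)
    have "(\<Sum>x\<in>{x\<in>X. \<phi> x = y}. class_avg X f \<phi> x * g (\<phi> x))
      = (\<Sum>x\<in>{x\<in>X. \<phi> x = y}. (\<Sum>x\<in>{x\<in>X. \<phi> x = y}. f x) / real (card {x\<in>X. \<phi> x = y}) * g y)"
      by (intro sum.cong) (auto simp: class_avg_def)
    also have "\<dots> = (\<Sum>x\<in>{x\<in>X. \<phi> x = y}. f x) * g y" using pos by simp
    also have "\<dots> = (\<Sum>x\<in>{x\<in>X. \<phi> x = y}. f x * g (\<phi> x))" by (auto simp: sum_distrib_right)
    finally show ?thesis by simp
  qed
  then show ?thesis by (simp add: sum.image_gen[OF assms, of _ \<phi>])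
qed

lemma class_avg_01:
  assumes "finite X" "x \<in> X" "\<And>y. y \<in> X \<Longrightarrow> f y \<in> {0..1}"
  shows "class_avg X f \<phi> x \<in> {0..1}"
proof -
  have pos: "card {y\<in>X. \<phi> y = \<phi> x} > 0" using assms by (auto simp: card_gt_0_iff)
  have "(\<Sum>y\<in>{y\<in>X. \<phi> y = \<phi> x}. f y) \<le> (\<Sum>y\<in>{y\<in>X. \<phi> y = \<phi> x}. 1)"
    using assms(3) by (intro sum_mono) auto
  moreover have "(\<Sum>y\<in>{y\<in>X. \<phi> y = \<phi> x}. f y) \<ge> 0" using assms(3) by (intro sum_nonneg) auto
  ultimately show ?thesis using pos by (simp add: class_avg_def)
qed

text \<open>The theorem of Pythagoras for nested conditional expectations.\<close>

lemma class_avg_energy_increment: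
  assumes X: "finite X" and r: "\<And>x. \<phi> x = r (\<phi>' x)"
  shows "(\<Sum>x\<in>X. (class_avg X f \<phi> x)\<^sup>2) + (\<Sum>x\<in>X. (class_avg X f \<phi>' x - class_avg X f \<phi> x)\<^sup>2)
       = (\<Sum>x\<in>X. (class_avg X f \<phi>' x)\<^sup>2)"
proof -
  define h where "h c = (\<Sum>y\<in>{y\<in>X. \<phi> y = c}. f y) / real (card {y\<in>X. \<phi> y = c})" for c
  have h: "class_avg X f \<phi> x = h (\<phi> x)" for x by (simp add: class_avg_def h_def)
  have "(\<Sum>x\<in>X. class_avg X f \<phi>' x * class_avg X f \<phi> x) = (\<Sum>x\<in>X. f x * h (\<phi> x))"
    using class_avg_inner[OF X, of f "\<lambda>c. h (r c)" \<phi>'] by (simp add: h r)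
  also have "\<dots> = (\<Sum>x\<in>X. (class_avg X f \<phi> x)\<^sup>2)"
    using class_avg_inner[OF X, of f h \<phi>] by (simp add: h power2_eq_square)
  finally have "(\<Sum>x\<in>X. class_avg X f \<phi>' x * class_avg X f \<phi> x) = (\<Sum>x\<in>X. (class_avg X f \<phi> x)\<^sup>2)" .
  then show ?thesis
    by (simp add: power2_diff sum.distrib sum_subtractf mult.assoc sum_distrib_left[symmetric])
qed

text \<open>A set \<open>D\<close> that detects a large difference between \<open>f\<close> and its average forces the energy to grow
  when the partition is refined so as to make \<open>D\<close> measurable.\<close>

lemma class_avg_violation:
  assumes X: "finite X" and r: "\<And>x. \<phi> x = r (\<phi>' x)" and D: "\<And>x. x \<in> X \<Longrightarrow> x \<in> D \<longleftrightarrow> \<phi>' x \<in> D'"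
    and large: "\<bar>\<Sum>x\<in>X \<inter> D. f x - class_avg X f \<phi> x\<bar> > \<epsilon> * real (card X)" and "\<epsilon> > 0"
  shows "(\<Sum>x\<in>X. (class_avg X f \<phi>' x)\<^sup>2) \<ge> (\<Sum>x\<in>X. (class_avg X f \<phi> x)\<^sup>2) + \<epsilon>\<^sup>2 * real (card X)"
proof -
  define i :: "'a \<Rightarrow> real" where "i x = indicator D x" for x
  have i: "i x = indicator D' (\<phi>' x)" if "x \<in> X" for x using D[OF that] by (simp add: i_def indicator_def)
  have X0: "real (card X) > 0"
    using large X \<open>\<epsilon> > 0\<close> by (cases "X = {}") (auto simp: card_gt_0_iff)
  have "(\<Sum>x\<in>X \<inter> D. f x - class_avg X f \<phi> x) = (\<Sum>x\<in>X. (f x - class_avg X f \<phi> x) * i x)"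
    unfolding sum.inter_restrict[OF X] by (intro sum.cong refl) (simp add: i_def)
  also have "\<dots> = (\<Sum>x\<in>X. f x * i x) - (\<Sum>x\<in>X. class_avg X f \<phi> x * i x)"
    by (simp add: algebra_simps sum_subtractf)
  also have "(\<Sum>x\<in>X. f x * i x) = (\<Sum>x\<in>X. class_avg X f \<phi>' x * i x)"
    using class_avg_inner[OF X, of f "indicator D'" \<phi>'] i by simp
  also have "\<dots> - (\<Sum>x\<in>X. class_avg X f \<phi> x * i x) = (\<Sum>x\<in>X. (class_avg X f \<phi>' x - class_avg X f \<phi> x) * i x)"
    by (simp add: algebra_simps sum_subtractf)
  finally have eq: "(\<Sum>x\<in>X \<inter> D. f x - class_avg X f \<phi> x) = \<dots>" .
  have "(\<epsilon> * real (card X))\<^sup>2 \<le> \<bar>\<Sum>x\<in>X \<inter> D. f x - class_avg X f \<phi> x\<bar>\<^sup>2"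
    using large \<open>\<epsilon> > 0\<close> X0 by (intro power_mono) auto
  also have "\<dots> = (\<Sum>x\<in>X. (class_avg X f \<phi>' x - class_avg X f \<phi> x) * i x)\<^sup>2" by (simp add: eq)
  also have "\<dots> \<le> (\<Sum>x\<in>X. (class_avg X f \<phi>' x - class_avg X f \<phi> x)\<^sup>2) * (\<Sum>x\<in>X. (i x)\<^sup>2)"
    by (rule Cauchy_Schwarz_ineq_sum)
  also have "\<dots> \<le> (\<Sum>x\<in>X. (class_avg X f \<phi>' x - class_avg X f \<phi> x)\<^sup>2) * (\<Sum>x\<in>X. 1)"
    by (intro mult_left_mono sum_mono sum_nonneg) (auto simp: i_def split: split_indicator)
  finally have "\<epsilon>\<^sup>2 * real (card X) * real (card X) \<le> (\<Sum>x\<in>X. (class_avg X f \<phi>' x - class_avg X f \<phi> x)\<^sup>2) * real (card X)"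
    by (simp add: power2_eq_square mult_ac)
  then have "\<epsilon>\<^sup>2 * real (card X) \<le> (\<Sum>x\<in>X. (class_avg X f \<phi>' x - class_avg X f \<phi> x)\<^sup>2)"
    using X0 by (simp only: mult_le_cancel_right)
  then show ?thesis using class_avg_energy_increment[of X \<phi> r \<phi>' f, OF X r] by linarith
qed

definition block_avg :: "'v set \<Rightarrow> ('v \<Rightarrow> 'c) \<Rightarrow> ('v \<Rightarrow> 'v \<Rightarrow> real) \<Rightarrow> 'v \<Rightarrow> 'v \<Rightarrow> real" where
  "block_avg V c A i j = class_avg (V \<times> V) (\<lambda>(i, j). A i j) (\<lambda>(i, j). (c i, c j)) (i, j)"

lemma block_avg_inner:
  assumes "finite V"
  shows "(\<Sum>i\<in>V. \<Sum>j\<in>V. A i j * g (c i) (c j)) = (\<Sum>i\<in>V. \<Sum>j\<in>V. block_avg V c A i j * g (c i) (c j))"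
  using class_avg_inner[of "V \<times> V" "\<lambda>(i, j). A i j" "\<lambda>(a, b). g a b" "\<lambda>(i, j). (c i, c j)"] assms
  by (simp add: sum.cartesian_product block_avg_def case_prod_unfold)

lemma block_avg_01:
  assumes "finite V" "i \<in> V" "j \<in> V" "\<And>i j. i \<in> V \<Longrightarrow> j \<in> V \<Longrightarrow> A i j \<in> {0..1}"
  shows "block_avg V c A i j \<in> {0..1}"
  unfolding block_avg_def using assms by (intro class_avg_01) auto

lemma block_avg_cong:
  assumes "i \<in> V" "j \<in> V" "\<And>i. i \<in> V \<Longrightarrow> c i = c' i"
  shows "block_avg V c A i j = block_avg V c' A i j"
proof -
  have "{y \<in> V \<times> V. (case y of (i, j) \<Rightarrow> (c i, c j)) = (c i, c j)} =
        {y \<in> V \<times> V. (case y of (i, j) \<Rightarrow> (c' i, c' j)) = (c' i, c' j)}"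
    using assms by auto
  then show ?thesis by (simp add: block_avg_def class_avg_def)
qed

lemma block_avg_sym:
  assumes "\<And>i j. i \<in> V \<Longrightarrow> j \<in> V \<Longrightarrow> A i j = A j i"
  shows "block_avg V c A i j = block_avg V c A j i"
proof -
  let ?S = "\<lambda>i j. {y \<in> V \<times> V. (case y of (i, j) \<Rightarrow> (c i, c j)) = (c i, c j)}"
  have "bij_betw prod.swap (?S i j) (?S j i)"
    by (rule bij_betwI[where g = prod.swap]) auto
  moreover have "(\<Sum>(i, j)\<in>?S i j. A i j) = (\<Sum>(i, j)\<in>?S j i. A i j)"
    by (rule sum.reindex_bij_witness[where i = prod.swap and j = prod.swap]) (use assms in auto)
  ultimately show ?thesis by (simp add: block_avg_def class_avg_def bij_betw_same_card)
qed

lemma block_avg_factor: "\<exists>h. \<forall>i j. block_avg V c A i j = h (c i) (c j)"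
  unfolding block_avg_def class_avg_def
  by (intro exI[of _ "\<lambda>a b. (\<Sum>y\<in>{y \<in> V \<times> V. (case y of (i, j) \<Rightarrow> (c i, c j)) = (a, b)}. case y of (i, j) \<Rightarrow> A i j) /
      real (card {y \<in> V \<times> V. (case y of (i, j) \<Rightarrow> (c i, c j)) = (a, b)})"]) simp

text \<open>Refining by a violating pair of sets multiplies the number of colours by four and increases
  the energy by a fixed amount, so after \<open>m\<close> rounds either no pair violates or the energy is large.\<close>

lemma weak_regularity_colours:
  assumes "finite (V :: 'v set)" "\<epsilon> > 0"
  shows "(\<exists>c :: 'v \<Rightarrow> nat. c ` V \<subseteq> {..<4 ^ m} \<and> cut_small V \<epsilon> (\<lambda>i j. A i j - block_avg V c A i j)) \<or>
     (\<exists>c :: 'v \<Rightarrow> nat. c ` V \<subseteq> {..<4 ^ m} \<and>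
        (\<Sum>x\<in>V \<times> V. (block_avg V c A (fst x) (snd x))\<^sup>2) \<ge> real m * \<epsilon>\<^sup>2 * (real (card V))\<^sup>2)"
proof (induction m)
  case 0
  then show ?case by (auto intro!: exI[of _ "\<lambda>_. 0"] sum_nonneg)
next
  case (Suc m)
  then show ?case
  proof
    assume "\<exists>c :: 'v \<Rightarrow> nat. c ` V \<subseteq> {..<4 ^ m} \<and> cut_small V \<epsilon> (\<lambda>i j. A i j - block_avg V c A i j)"
    then obtain c :: "'v \<Rightarrow> nat" where "c ` V \<subseteq> {..<4 ^ m}" "cut_small V \<epsilon> (\<lambda>i j. A i j - block_avg V c A i j)" by blast
    moreover have "{..<4 ^ m} \<subseteq> {..<4 ^ Suc m :: nat}" by auto
    ultimately show ?thesis by (intro disjI1 exI[of _ c] conjI) (rule subset_trans)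
  next
    assume "\<exists>c :: 'v \<Rightarrow> nat. c ` V \<subseteq> {..<4 ^ m} \<and>
        (\<Sum>x\<in>V \<times> V. (block_avg V c A (fst x) (snd x))\<^sup>2) \<ge> real m * \<epsilon>\<^sup>2 * (real (card V))\<^sup>2"
    then obtain c :: "'v \<Rightarrow> nat" where c: "c ` V \<subseteq> {..<4 ^ m}"
      and en: "(\<Sum>x\<in>V \<times> V. (block_avg V c A (fst x) (snd x))\<^sup>2) \<ge> real m * \<epsilon>\<^sup>2 * (real (card V))\<^sup>2" by blast
    show ?thesis
    proof (cases "cut_small V \<epsilon> (\<lambda>i j. A i j - block_avg V c A i j)")
      case True
      moreover have "{..<4 ^ m} \<subseteq> {..<4 ^ Suc m :: nat}" by auto
      ultimately show ?thesis using c by (intro disjI1 exI[of _ c] conjI) (rule subset_trans)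
    next
      case False
      then obtain S T where ST: "S \<subseteq> V" "T \<subseteq> V"
        and viol: "\<bar>\<Sum>i\<in>S. \<Sum>j\<in>T. A i j - block_avg V c A i j\<bar> > \<epsilon> * (real (card V))\<^sup>2"
        by (auto simp: cut_small_def not_le)
      \<comment> \<open>The two low bits of the new colour record membership in \<open>S\<close> and in \<open>T\<close>.\<close>
      define c' where "c' i = 4 * c i + 2 * of_bool (i \<in> S) + of_bool (i \<in> T)" for i
      have c_c': "c i = c' i div 4" for i by (auto simp: c'_def)
      have S_c': "i \<in> S \<longleftrightarrow> c' i mod 4 \<in> {2, 3}" for i by (auto simp: c'_def)
      have T_c': "i \<in> T \<longleftrightarrow> c' i mod 4 \<in> {1, 3}" for i by (auto simp: c'_def)
      have range: "c' ` V \<subseteq> {..<4 ^ Suc m}"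
      proof
        fix y assume "y \<in> c' ` V"
        then obtain i where "i \<in> V" "y = c' i" by auto
        moreover have "c i < 4 ^ m" using c \<open>i \<in> V\<close> by auto
        ultimately show "y \<in> {..<4 ^ Suc m}" by (auto simp: c'_def)
      qed
      have "(\<Sum>x\<in>V \<times> V. (class_avg (V \<times> V) (\<lambda>(i, j). A i j) (\<lambda>(i, j). (c' i, c' j)) x)\<^sup>2)
         \<ge> (\<Sum>x\<in>V \<times> V. (class_avg (V \<times> V) (\<lambda>(i, j). A i j) (\<lambda>(i, j). (c i, c j)) x)\<^sup>2) + \<epsilon>\<^sup>2 * real (card (V \<times> V))"
      proof (rule class_avg_violation[where r = "\<lambda>(a, b). (a div 4, b div 4)" and D = "S \<times> T"
            and D' = "{(a, b). a mod 4 \<in> {2, 3} \<and> b mod 4 \<in> {1, 3}}"])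
        have "(V \<times> V) \<inter> (S \<times> T) = S \<times> T" using ST by auto
        then have "(\<Sum>x\<in>(V \<times> V) \<inter> (S \<times> T). (case x of (i, j) \<Rightarrow> A i j) - class_avg (V \<times> V) (\<lambda>(i, j). A i j) (\<lambda>(i, j). (c i, c j)) x)
          = (\<Sum>i\<in>S. \<Sum>j\<in>T. A i j - block_avg V c A i j)"
          by (simp add: sum.cartesian_product block_avg_def case_prod_unfold)
        then show "\<epsilon> * real (card (V \<times> V)) < \<bar>\<Sum>x\<in>(V \<times> V) \<inter> (S \<times> T). (case x of (i, j) \<Rightarrow> A i j) - class_avg (V \<times> V) (\<lambda>(i, j). A i j) (\<lambda>(i, j). (c i, c j)) x\<bar>"
          using viol by (simp add: card_cartesian_product power2_eq_square)
      qed (use assms c_c' S_c' T_c' in auto)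
      then have "(\<Sum>x\<in>V \<times> V. (block_avg V c' A (fst x) (snd x))\<^sup>2) \<ge> real (Suc m) * \<epsilon>\<^sup>2 * (real (card V))\<^sup>2"
        using en by (simp add: block_avg_def card_cartesian_product power2_eq_square algebra_simps)
      then show ?thesis using range by (intro disjI2 exI[of _ c'] conjI)
    qed
  qed
qed

text \<open>The weak regularity lemma of Frieze and Kannan. The number of colours depends on \<open>\<epsilon>\<close> only, so
  that the number of colourings of \<open>n\<close> vertices is exponential in \<open>n\<close> and not in \<open>n^2\<close>.\<close>

lemma weak_regularity:
  assumes "\<epsilon> > 0"
  shows "\<exists>m::nat. \<forall>(V :: 'v set) A. finite V \<longrightarrow> (\<forall>i\<in>V. \<forall>j\<in>V. A i j \<in> {0..1}) \<longrightarrow>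
     (\<exists>c \<in> V \<rightarrow>\<^sub>E {..<m}. cut_small V \<epsilon> (\<lambda>i j. A i j - block_avg V c A i j))"
proof -
  \<comment> \<open>After \<open>M\<close> rounds the energy would exceed its trivial bound \<open>n^2\<close>.\<close>
  obtain M :: nat where M: "real M * \<epsilon>\<^sup>2 > 1" using assms reals_Archimedean3[of "\<epsilon>\<^sup>2"] by auto
  show ?thesis
  proof (intro exI[of _ "4 ^ M :: nat"] allI impI)
    fix V :: "'v set" and A :: "'v \<Rightarrow> 'v \<Rightarrow> real"
    assume V: "finite V" and A: "\<forall>i\<in>V. \<forall>j\<in>V. A i j \<in> {0..1}"
    have "\<exists>c :: 'v \<Rightarrow> nat. c ` V \<subseteq> {..<4 ^ M} \<and> cut_small V \<epsilon> (\<lambda>i j. A i j - block_avg V c A i j)"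
    proof (cases "V = {}")
      case True then show ?thesis by (auto simp: cut_small_def)
    next
      case False
      have bound: "(\<Sum>x\<in>V \<times> V. (block_avg V c A (fst x) (snd x))\<^sup>2) < real M * \<epsilon>\<^sup>2 * (real (card V))\<^sup>2" for c :: "'v \<Rightarrow> nat"
      proof -
        have "(block_avg V c A (fst x) (snd x))\<^sup>2 \<le> 1" if "x \<in> V \<times> V" for x
          using block_avg_01[OF V, of "fst x" "snd x" A c] A that by (auto simp: power_le_one)
        then have "(\<Sum>x\<in>V \<times> V. (block_avg V c A (fst x) (snd x))\<^sup>2) \<le> (\<Sum>x\<in>V \<times> V. 1)" by (rule sum_mono)
        also have "\<dots> = 1 * (real (card V))\<^sup>2" by (simp add: card_cartesian_product power2_eq_square)
        also have "\<dots> < real M * \<epsilon>\<^sup>2 * (real (card V))\<^sup>2"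
          using M False V by (intro mult_strict_right_mono) (auto simp: card_gt_0_iff)
        finally show ?thesis .
      qed
      from weak_regularity_colours[OF V assms, of M A] show ?thesis
      proof (elim disjE exE conjE)
        fix c :: "'v \<Rightarrow> nat"
        assume "real M * \<epsilon>\<^sup>2 * (real (card V))\<^sup>2 \<le> (\<Sum>x\<in>V \<times> V. (block_avg V c A (fst x) (snd x))\<^sup>2)"
        then show ?thesis using bound[of c] by linarith
      qed (intro exI conjI)
    qed
    then obtain c :: "'v \<Rightarrow> nat" where c: "c ` V \<subseteq> {..<4 ^ M}" "cut_small V \<epsilon> (\<lambda>i j. A i j - block_avg V c A i j)" by blast
    have "block_avg V (restrict c V) A i j = block_avg V c A i j" if "i \<in> V" "j \<in> V" for i j
      by (rule block_avg_cong[OF that]) simp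
    then have "cut_small V \<epsilon> (\<lambda>i j. A i j - block_avg V (restrict c V) A i j)"
      using c(2) unfolding cut_small_def by (smt (verit) subset_iff sum.cong)
    moreover have "restrict c V \<in> V \<rightarrow>\<^sub>E {..<4 ^ M}" using c(1) by auto
    ultimately show "\<exists>c \<in> V \<rightarrow>\<^sub>E {..<4 ^ M :: nat}. cut_small V \<epsilon> (\<lambda>i j. A i j - block_avg V c A i j)" by blast
  qed
qed

section \<open>Step graphons\<close>

text \<open>The edge weights as a symmetric matrix with zero diagonal.\<close>

definition adj :: "nat \<Rightarrow> (nat set \<Rightarrow> real) \<Rightarrow> nat \<Rightarrow> nat \<Rightarrow> real" where
  "adj n w i j = (if {i, j} \<in> complete_edges n then w {i, j} else 0)"

text \<open>The points that the graphon assigns to vertex \<open>i\<close>. Index 0 is included so that the cells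
  partition the closed unit interval; it carries no mass.\<close>

definition cell :: "nat \<Rightarrow> nat \<Rightarrow> real set" where
  "cell n i = {x \<in> {0..1}. nat \<lceil>real n * x\<rceil> = i}"

lemma graphon_eq_adj: "graphon n w x y = adj n w (nat \<lceil>real n * x\<rceil>) (nat \<lceil>real n * y\<rceil>)"
  by (simp add: graphon_def adj_def Let_def)

lemma adj_sym: "adj n w i j = adj n w j i"
  by (simp add: adj_def insert_commute)

lemma adj_edge: "e \<in> complete_edges n \<Longrightarrow> adj n w (Min e) (Max e) = w e"
  using complete_edgesD(1)[of e n] by (simp add: adj_def)

lemma adj_diag: "adj n w i i = 0"
  by (simp add: adj_def complete_edges_def)

lemma adj_01:
  assumes "\<And>e. e \<in> complete_edges n \<Longrightarrow> w e \<in> {0..1}" shows "adj n w i j \<in> {0..1}"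
  using assms[of "{i, j}"] by (auto simp: adj_def)

lemma space_unit_measure [simp]: "space unit_measure = {0..1}"
  by (simp add: unit_measure_def space_restrict_space)

lemma sets_unit_measure_iff: "S \<in> sets unit_measure \<longleftrightarrow> S \<in> sets borel \<and> S \<subseteq> {0..1}"
  unfolding unit_measure_def by (subst sets_restrict_space_iff) auto

lemma emeasure_unit_measure: "S \<in> sets unit_measure \<Longrightarrow> emeasure unit_measure S = emeasure lborel S"
  unfolding unit_measure_def using sets_unit_measure_iff[of S]
  by (subst emeasure_restrict_space) (auto simp: unit_measure_def)

lemma prob_space_unit_measure: "prob_space unit_measure"
  by (rule prob_spaceI) (simp add: emeasure_unit_measure sets_unit_measure_iff)

interpretation unit_measure: prob_space unit_measure by (rule prob_space_unit_measure)

lemma cell_eq: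
  assumes "n > 0"
  shows "cell n 0 = {0}" and "1 \<le> i \<Longrightarrow> i \<le> n \<Longrightarrow> cell n i = {(real i - 1) / n <.. real i / n}"
proof -
  show "cell n 0 = {0}" using assms
    by (auto simp: cell_def mult_le_0_iff)
  assume i: "1 \<le> i" "i \<le> n"
  have "nat \<lceil>real n * x\<rceil> = i \<longleftrightarrow> x \<in> {(real i - 1) / n <.. real i / n}" for x
  proof -
    have "nat \<lceil>real n * x\<rceil> = i \<longleftrightarrow> \<lceil>real n * x\<rceil> = int i" using i by linarith
    also have "\<dots> \<longleftrightarrow> real i - 1 < real n * x \<and> real n * x \<le> real i" by (simp add: ceiling_eq_iff)
    also have "\<dots> \<longleftrightarrow> x \<in> {(real i - 1) / n <.. real i / n}" using assms by (simp add: field_simps)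
    finally show ?thesis .
  qed
  moreover have "x \<in> {0..1}" if "x \<in> {(real i - 1) / n <.. real i / n}" for x
  proof -
    have "0 \<le> (real i - 1) / n" "real i / n \<le> 1" using i assms by auto
    then show ?thesis using that by auto
  qed
  ultimately show "cell n i = {(real i - 1) / n <.. real i / n}" by (auto simp: cell_def)
qed

lemma cell_sets: "n > 0 \<Longrightarrow> i \<le> n \<Longrightarrow> cell n i \<in> sets unit_measure"
proof (cases i)
  case (Suc m)
  assume "n > 0" "i \<le> n"
  then show ?thesis using cell_eq(2)[of n i] Suc
    by (auto simp: sets_unit_measure_iff cell_def)
qed (auto simp: cell_eq sets_unit_measure_iff)

lemma measure_cell:
  assumes "n > 0" "i \<le> n" shows "measure unit_measure (cell n i) = (if i = 0 then 0 else 1 / real n)"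
proof (cases "i = 0")
  case True
  then show ?thesis using cell_sets[OF assms] cell_eq[OF assms(1)]
    by (simp add: measure_def emeasure_unit_measure)
next
  case False
  have "(real i - 1) / n \<le> real i / n" by (simp add: divide_right_mono)
  then have "measure unit_measure (cell n i) = real i / n - (real i - 1) / n"
    using cell_sets[OF assms] cell_eq(2)[OF assms(1), of i] assms False
    by (simp add: measure_def emeasure_unit_measure)
  then show ?thesis using False by (simp add: diff_divide_distrib)
qed

lemma cell_index_le: "x \<in> {0..1} \<Longrightarrow> nat \<lceil>real n * x\<rceil> \<le> n"
proof -
  assume "x \<in> {0..1}"
  then have "real n * x \<le> real n" by (simp add: mult_left_le)
  then have "\<lceil>real n * x\<rceil> \<le> int n" by (intro ceiling_le) simp
  then show ?thesis by (simp only: nat_le_iff)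
qed

text \<open>The integrand is constant on products of cells.\<close>

lemma hom_density_graphon:
  assumes n: "n > 0" and graph: "simple_graph k E"
  shows "hom_density k E (graphon n w) = hom_sum {1..n} k E (\<lambda>_. adj n w) / real n ^ k"
proof -
  let ?I = "{1..k}"
  let ?P = "Pi\<^sub>M ?I (\<lambda>_. unit_measure)"
  interpret P: finite_product_prob_space "\<lambda>_::nat. unit_measure" ?I by unfold_locales simp
  have edge: "Min e \<in> ?I" "Max e \<in> ?I" if "e \<in> E" for e
    using complete_edgesD[of e k] graph that by (auto simp: simple_graph_def)
  define c where "c y = (\<Prod>e\<in>E. adj n w (y (Min e)) (y (Max e)))" for y :: "nat \<Rightarrow> nat"
  define Q where "Q y = Pi\<^sub>E ?I (\<lambda>i. cell n (y i))" for y :: "nat \<Rightarrow> nat"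
  have Q_sets: "Q y \<in> sets ?P" if "y \<in> ?I \<rightarrow>\<^sub>E {..n}" for y
    unfolding Q_def using that by (intro sets_PiM_I_finite) (auto simp: PiE_iff intro!: cell_sets n)
  have fin: "finite (?I \<rightarrow>\<^sub>E {..n})" by (intro finite_PiE) auto
  have step: "(\<Prod>e\<in>E. graphon n w (x (Min e)) (x (Max e))) = (\<Sum>y\<in>?I \<rightarrow>\<^sub>E {..n}. c y * indicator (Q y) x)"
    if x: "x \<in> space ?P" for x
  proof -
    have x01: "x i \<in> {0..1}" if "i \<in> ?I" for i
      using x that by (simp add: space_PiM) (metis PiE_mem atLeastAtMost_iff space_unit_measure)
    have xext: "x \<in> extensional ?I" using x by (simp add: space_PiM PiE_iff)
    define y0 where "y0 = (\<lambda>i\<in>?I. nat \<lceil>real n * x i\<rceil>)"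
    have y0: "y0 \<in> ?I \<rightarrow>\<^sub>E {..n}" using x01 cell_index_le by (auto simp: y0_def)
    have ind: "x \<in> Q y \<longleftrightarrow> y = y0" if y: "y \<in> ?I \<rightarrow>\<^sub>E {..n}" for y
    proof
      assume "x \<in> Q y"
      then have "y i = nat \<lceil>real n * x i\<rceil>" if "i \<in> ?I" for i
        using that unfolding Q_def by (auto simp: PiE_iff cell_def)
      then show "y = y0" using y by (auto simp: y0_def fun_eq_iff PiE_iff extensional_def)
    next
      assume "y = y0"
      then show "x \<in> Q y" using x01 xext by (auto simp: Q_def cell_def y0_def PiE_iff)
    qed
    have "(\<Sum>y\<in>?I \<rightarrow>\<^sub>E {..n}. c y * indicator (Q y) x) = (\<Sum>y\<in>?I \<rightarrow>\<^sub>E {..n}. if y = y0 then c y else 0)"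
      using ind by (intro sum.cong refl) (auto simp: indicator_def)
    also have "\<dots> = c y0" using fin y0 by simp
    also have "\<dots> = (\<Prod>e\<in>E. graphon n w (x (Min e)) (x (Max e)))"
      unfolding c_def graphon_eq_adj using edge by (intro prod.cong refl) (simp add: y0_def)
    finally show ?thesis by simp
  qed
  have "hom_density k E (graphon n w) = (LINT x|?P. (\<Sum>y\<in>?I \<rightarrow>\<^sub>E {..n}. c y * indicator (Q y) x))"
    unfolding hom_density_def by (intro Bochner_Integration.integral_cong refl step)
  also have "\<dots> = (\<Sum>y\<in>?I \<rightarrow>\<^sub>E {..n}. c y * measure ?P (Q y))"
  proof -
    have int: "integrable ?P (\<lambda>x. c y * indicator (Q y) x)" if "y \<in> ?I \<rightarrow>\<^sub>E {..n}" for y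
      using Q_sets[OF that] by (intro integrable_mult_right integrable_real_indicator)
        (use P.emeasure_finite[of "Q y"] in \<open>auto simp: less_top[symmetric]\<close>)
    show ?thesis
      by (subst Bochner_Integration.integral_sum) (use int Q_sets in \<open>auto intro!: sum.cong\<close>)
  qed
  also have "\<dots> = (\<Sum>y\<in>?I \<rightarrow>\<^sub>E {1..n}. c y * measure ?P (Q y))"
  proof (rule sum.mono_neutral_right[OF fin])
    show "?I \<rightarrow>\<^sub>E {1..n} \<subseteq> ?I \<rightarrow>\<^sub>E {..n}" by (intro PiE_mono) auto
    show "\<forall>y\<in>(?I \<rightarrow>\<^sub>E {..n}) - (?I \<rightarrow>\<^sub>E {1..n}). c y * measure ?P (Q y) = 0"
    proof
      fix y assume y: "y \<in> (?I \<rightarrow>\<^sub>E {..n}) - (?I \<rightarrow>\<^sub>E {1..n})"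
      then obtain i where i: "i \<in> ?I" "y i = 0" by (auto simp: PiE_iff not_le)
      have "measure ?P (Q y) = (\<Prod>i\<in>?I. measure unit_measure (cell n (y i)))"
        unfolding Q_def using y by (intro P.prob_times cell_sets n) (auto simp: PiE_iff)
      also have "\<dots> = 0" using i measure_cell[OF n, of 0] by (intro prod_zero bexI[of _ i]) auto
      finally show "c y * measure ?P (Q y) = 0" by simp
    qed
  qed
  also have "\<dots> = (\<Sum>y\<in>?I \<rightarrow>\<^sub>E {1..n}. c y / real n ^ k)"
  proof (intro sum.cong refl)
    fix y assume y: "y \<in> ?I \<rightarrow>\<^sub>E {1..n}"
    have yi: "1 \<le> y i" "y i \<le> n" if "i \<in> ?I" for i using y that by (auto simp: PiE_iff)
    have "measure ?P (Q y) = (\<Prod>i\<in>?I. measure unit_measure (cell n (y i)))"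
      unfolding Q_def using yi by (intro P.prob_times cell_sets n) auto
    also have "\<dots> = (\<Prod>i\<in>?I. 1 / real n)"
      using yi by (intro prod.cong refl) (subst measure_cell[OF n]; force)
    finally show "c y * measure ?P (Q y) = c y / real n ^ k" by (simp add: power_divide)
  qed
  finally show ?thesis by (simp add: hom_sum_def c_def sum_divide_distrib)
qed

lemma set_integral_graphon:
  assumes n: "n > 0" and S: "S \<in> sets unit_measure" and T: "T \<in> sets unit_measure"
  shows "(LINT z:S \<times> T|unit_measure \<Otimes>\<^sub>M unit_measure. graphon n w (fst z) (snd z) - u)
     = (\<Sum>i\<in>{1..n}. \<Sum>j\<in>{1..n}. (adj n w i j - u) * (measure unit_measure (S \<inter> cell n i) * measure unit_measure (T \<inter> cell n j)))"
proof -
  let ?U = "unit_measure \<Otimes>\<^sub>M unit_measure"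
  interpret U: pair_prob_space unit_measure unit_measure by unfold_locales
  define R where "R i j = (S \<inter> cell n i) \<times> (T \<inter> cell n j)" for i j
  have R_sets: "R i j \<in> sets ?U" if "i \<le> n" "j \<le> n" for i j
    unfolding R_def using that S T cell_sets[OF n] by (intro pair_measureI) auto
  have R_measure: "measure ?U (R i j) = measure unit_measure (S \<inter> cell n i) * measure unit_measure (T \<inter> cell n j)"
    if "i \<le> n" "j \<le> n" for i j
    unfolding R_def using that S T cell_sets[OF n]
    by (subst measure_def, subst unit_measure.emeasure_pair_measure_Times) (auto simp: measure_def enn2real_mult)
  have "(LINT z:S \<times> T|?U. graphon n w (fst z) (snd z) - u)
    = (LINT z|?U. (\<Sum>i\<in>{..n}. \<Sum>j\<in>{..n}. (adj n w i j - u) * indicator (R i j) z))"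
    unfolding set_lebesgue_integral_def
  proof (intro Bochner_Integration.integral_cong refl)
    fix z assume "z \<in> space ?U"
    then obtain x y where z: "z = (x, y)" "x \<in> {0..1}" "y \<in> {0..1}"
      by (cases z) (auto simp: space_pair_measure)
    define i0 where "i0 = nat \<lceil>real n * x\<rceil>"
    define j0 where "j0 = nat \<lceil>real n * y\<rceil>"
    have le: "i0 \<le> n" "j0 \<le> n" using z cell_index_le by (auto simp: i0_def j0_def)
    have ind: "indicator (R i j) z = (if i = i0 then if j = j0 then indicator (S \<times> T) z else 0 else 0 :: real)" for i j
      using z by (auto simp: R_def cell_def i0_def j0_def indicator_def)
    define X where "X = (adj n w i0 j0 - u) * indicator (S \<times> T) z"
    have "(\<Sum>i\<in>{..n}. \<Sum>j\<in>{..n}. (adj n w i j - u) * indicator (R i j) z) = (\<Sum>i\<in>{..n}. if i = i0 then X else 0)"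
    proof (rule sum.cong[OF refl])
      fix i
      have "(\<Sum>j\<in>{..n}. (adj n w i j - u) * indicator (R i j) z) = (\<Sum>j\<in>{..n}. if j = j0 then (if i = i0 then X else 0) else 0)"
        by (intro sum.cong refl) (simp add: ind X_def)
      also have "\<dots> = (if i = i0 then X else 0)" using le by simp
      finally show "(\<Sum>j\<in>{..n}. (adj n w i j - u) * indicator (R i j) z) = (if i = i0 then X else 0)" .
    qed
    also have "\<dots> = (adj n w i0 j0 - u) * indicator (S \<times> T) z" using le by (simp add: X_def)
    finally show "indicator (S \<times> T) z *\<^sub>R (graphon n w (fst z) (snd z) - u)
        = (\<Sum>i\<in>{..n}. \<Sum>j\<in>{..n}. (adj n w i j - u) * indicator (R i j) z)"
      by (simp add: z graphon_eq_adj i0_def j0_def)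
  qed
  also have "\<dots> = (\<Sum>i\<in>{..n}. \<Sum>j\<in>{..n}. (adj n w i j - u) * measure ?U (R i j))"
  proof -
    have int: "integrable ?U (\<lambda>z. (adj n w i j - u) * indicator (R i j) z)" if "i \<le> n" "j \<le> n" for i j
      using R_sets[OF that] by (intro integrable_mult_right integrable_real_indicator) (auto simp: less_top[symmetric])
    have "(LINT z|?U. (\<Sum>i\<in>{..n}. \<Sum>j\<in>{..n}. (adj n w i j - u) * indicator (R i j) z))
       = (\<Sum>i\<in>{..n}. \<Sum>j\<in>{..n}. (LINT z|?U. (adj n w i j - u) * indicator (R i j) z))"
    proof (subst Bochner_Integration.integral_sum)
      show "integrable ?U (\<lambda>z. \<Sum>j\<in>{..n}. (adj n w i j - u) * indicator (R i j) z)" if "i \<in> {..n}" for i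
        using that by (intro Bochner_Integration.integrable_sum int) auto
      show "(\<Sum>i\<in>{..n}. LINT z|?U. (\<Sum>j\<in>{..n}. (adj n w i j - u) * indicator (R i j) z))
        = (\<Sum>i\<in>{..n}. \<Sum>j\<in>{..n}. (LINT z|?U. (adj n w i j - u) * indicator (R i j) z))"
        by (intro sum.cong refl Bochner_Integration.integral_sum int) auto
    qed
    also have "\<dots> = (\<Sum>i\<in>{..n}. \<Sum>j\<in>{..n}. (adj n w i j - u) * measure ?U (R i j))"
      using R_sets by (intro sum.cong refl) simp
    finally show ?thesis .
  qed
  also have "\<dots> = (\<Sum>i\<in>{1..n}. \<Sum>j\<in>{1..n}. (adj n w i j - u) * (measure unit_measure (S \<inter> cell n i) * measure unit_measure (T \<inter> cell n j)))"
  proof -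
    have zero: "measure unit_measure (A \<inter> cell n 0) = 0" if "A \<in> sets unit_measure" for A
    proof -
      have "measure unit_measure (A \<inter> cell n 0) \<le> measure unit_measure (cell n 0)"
        using cell_sets[OF n, of 0] by (intro unit_measure.finite_measure_mono) auto
      then show ?thesis using measure_cell[OF n, of 0] by (simp add: measure_le_0_iff)
    qed
    have "(\<Sum>i\<in>{..n}. \<Sum>j\<in>{..n}. (adj n w i j - u) * measure ?U (R i j))
       = (\<Sum>i\<in>{1..n}. \<Sum>j\<in>{..n}. (adj n w i j - u) * measure ?U (R i j))"
    proof (rule sum.mono_neutral_right)
      show "\<forall>i\<in>{..n} - {1..n}. (\<Sum>j\<in>{..n}. (adj n w i j - u) * measure ?U (R i j)) = 0"
        using R_measure zero[OF S] by (auto simp: not_le)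
    qed auto
    also have "\<dots> = (\<Sum>i\<in>{1..n}. \<Sum>j\<in>{1..n}. (adj n w i j - u) * measure ?U (R i j))"
    proof (rule sum.cong[OF refl], rule sum.mono_neutral_right)
      fix i assume "i \<in> {1..n}"
      then show "\<forall>j\<in>{..n} - {1..n}. (adj n w i j - u) * measure ?U (R i j) = 0"
        using R_measure zero[OF T] by (auto simp: not_le)
    qed auto
    finally show ?thesis using R_measure by (auto intro!: sum.cong)
  qed
  finally show ?thesis .
qed

text \<open>Measurable sets \<open>S\<close> and \<open>T\<close> meet the cells in fractions, which act as weights on the vertices.\<close>

lemma cut_dist_graphon_le:
  assumes n: "n > 0" and cut: "cut_small {1..n} \<epsilon> (\<lambda>i j. adj n w i j - u)"
  shows "cut_dist (graphon n w) (\<lambda>_ _. u) \<le> \<epsilon>"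
  unfolding cut_dist_def
proof (rule cSUP_least)
  show "sets unit_measure \<times> sets unit_measure \<noteq> {}" by auto
  fix ST assume "ST \<in> sets unit_measure \<times> sets unit_measure"
  then obtain S T where ST: "ST = (S, T)" "S \<in> sets unit_measure" "T \<in> sets unit_measure" by auto
  define a where "a i = real n * measure unit_measure (S \<inter> cell n i)" for i
  define b where "b i = real n * measure unit_measure (T \<inter> cell n i)" for i
  have le1: "real n * measure unit_measure (A \<inter> cell n i) \<in> {0..1}" if "i \<in> {1..n}" for A i
  proof -
    have "measure unit_measure (A \<inter> cell n i) \<le> measure unit_measure (cell n i)"
      using cell_sets[OF n, of i] that by (intro unit_measure.finite_measure_mono) auto
    also have "\<dots> = 1 / real n" using measure_cell[OF n, of i] that by auto
    finally show ?thesis using n by (simp add: field_simps)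
  qed
  have "(LINT z:S \<times> T|unit_measure \<Otimes>\<^sub>M unit_measure. graphon n w (fst z) (snd z) - u)
     = (\<Sum>i\<in>{1..n}. \<Sum>j\<in>{1..n}. (adj n w i j - u) * (a i * b j)) / (real n)\<^sup>2"
    unfolding set_integral_graphon[OF n ST(2,3)] a_def b_def sum_divide_distrib
    using n by (intro sum.cong refl) (simp add: power2_eq_square)
  moreover have "\<bar>\<Sum>i\<in>{1..n}. \<Sum>j\<in>{1..n}. (adj n w i j - u) * (a i * b j)\<bar> \<le> \<epsilon> * (real (card {1..n}))\<^sup>2"
    unfolding a_def b_def by (rule cut_small_weighted[OF _ cut le1 le1]) auto
  then have "\<bar>\<Sum>i\<in>{1..n}. \<Sum>j\<in>{1..n}. (adj n w i j - u) * (a i * b j)\<bar> / (real n)\<^sup>2 \<le> \<epsilon>"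
    using n by (subst pos_divide_le_eq) auto
  ultimately show "(case ST of (S, T) \<Rightarrow>
      \<bar>LINT z:S \<times> T|unit_measure \<Otimes>\<^sub>M unit_measure. graphon n w (fst z) (snd z) - u\<bar>) \<le> \<epsilon>"
    unfolding ST by (simp only: prod.case abs_divide abs_power2)
qed

lemma cut_dist_nonneg:
  assumes C: "\<And>x y. \<bar>f x y - h x y\<bar> \<le> C"
  shows "cut_dist f h \<ge> 0"
proof -
  let ?U = "unit_measure \<Otimes>\<^sub>M unit_measure"
  interpret U: pair_prob_space unit_measure unit_measure by unfold_locales
  have C0: "C \<ge> 0" using C[of 0 0] by linarith
  have bound: "\<bar>LINT z:S \<times> T|?U. f (fst z) (snd z) - h (fst z) (snd z)\<bar> \<le> C" for S T
  proof (cases "set_integrable ?U (S \<times> T) (\<lambda>z. f (fst z) (snd z) - h (fst z) (snd z))")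
    case True
    have "norm (LINT z:S \<times> T|?U. f (fst z) (snd z) - h (fst z) (snd z)) \<le> (LINT z|?U. C)"
      unfolding set_lebesgue_integral_def
      by (rule order_trans[OF integral_norm_bound integral_mono])
        (use True C C0 in \<open>auto simp: set_integrable_def indicator_def\<close>)
    then show ?thesis by (simp add: U.prob_space)
  next
    case False
    then show ?thesis using C0 by (simp add: set_lebesgue_integral_def set_integrable_def not_integrable_integral_eq)
  qed
  have "bdd_above ((\<lambda>(S, T). \<bar>LINT z:S \<times> T|?U. f (fst z) (snd z) - h (fst z) (snd z)\<bar>) ` (sets unit_measure \<times> sets unit_measure))"
    using bound by (intro bdd_aboveI[of _ C]) auto
  then have "(case ({}, {}) of (S, T) \<Rightarrow> \<bar>LINT z:S \<times> T|?U. f (fst z) (snd z) - h (fst z) (snd z)\<bar>) \<le> cut_dist f h"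
    unfolding cut_dist_def by (intro cSUP_upper) auto
  then show ?thesis by (simp add: set_lebesgue_integral_def)
qed

text \<open>Non-negativity is not automatic for a conditionally complete infimum of suprema: boundedness of
  the graphon keeps all of these well defined.\<close>

lemma delta_cut_graphon:
  shows "0 \<le> delta_cut (graphon n w) (\<lambda>_ _. u)"
    and "delta_cut (graphon n w) (\<lambda>_ _. u) \<le> cut_dist (graphon n w) (\<lambda>_ _. u)"
proof -
  have bound: "\<bar>graphon n w x y - u\<bar> \<le> (\<Sum>e\<in>complete_edges n. \<bar>w e\<bar>) + \<bar>u\<bar>" for x y
  proof -
    have "\<bar>graphon n w x y\<bar> \<le> (\<Sum>e\<in>complete_edges n. \<bar>w e\<bar>)"
    proof (cases "{nat \<lceil>real n * x\<rceil>, nat \<lceil>real n * y\<rceil>} \<in> complete_edges n")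
      case True
      then show ?thesis
        using member_le_sum[of "{nat \<lceil>real n * x\<rceil>, nat \<lceil>real n * y\<rceil>}" "complete_edges n" "\<lambda>e. \<bar>w e\<bar>"]
        by (simp add: graphon_def Let_def)
    qed (simp add: graphon_def Let_def sum_nonneg)
    then show ?thesis by linarith
  qed
  have nonneg: "0 \<le> (case s of (\<sigma>1, \<sigma>2) \<Rightarrow> cut_dist (\<lambda>x y. graphon n w (\<sigma>1 x) (\<sigma>1 y)) (\<lambda>x y. u))" for s
    using cut_dist_nonneg[OF bound] by (auto split: prod.splits)
  have id: "(\<lambda>x. x) \<in> mp_bijections"
    unfolding mp_bijections_def by (auto simp: bij_betw_def distr_id2)
  show "0 \<le> delta_cut (graphon n w) (\<lambda>_ _. u)"
    unfolding delta_cut_def using id by (intro cINF_greatest nonneg) auto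
  define F where "F = (\<lambda>(\<sigma>1 :: real \<Rightarrow> real, \<sigma>2 :: real \<Rightarrow> real). cut_dist (\<lambda>x y. graphon n w (\<sigma>1 x) (\<sigma>1 y)) (\<lambda>x y. u))"
  have "delta_cut (graphon n w) (\<lambda>_ _. u) = (INF s\<in>mp_bijections \<times> mp_bijections. F s)"
    by (simp add: delta_cut_def F_def)
  also have "\<dots> \<le> F (\<lambda>x. x, \<lambda>x. x)"
  proof (rule cINF_lower)
    show "bdd_below (F ` (mp_bijections \<times> mp_bijections))"
      using nonneg unfolding F_def by (intro bdd_belowI[of _ 0]) auto
  qed (use id in auto)
  finally show "delta_cut (graphon n w) (\<lambda>_ _. u) \<le> cut_dist (graphon n w) (\<lambda>_ _. u)" by (simp add: F_def)
qed

lemma hamiltonian_eq: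
  assumes n: "n > 0" and graph: "simple_graph k E"
  shows "(real n)\<^sup>2 * hamiltonian k E \<beta>1 \<beta>2 n w =
     \<beta>1 * (\<Sum>i\<in>{1..n}. \<Sum>j\<in>{1..n}. adj n w i j)
     + \<beta>2 * ((real n)\<^sup>2 * hom_sum {1..n} k E (\<lambda>_. adj n w) / real n ^ k)"
proof -
  have "simple_graph 2 {{1, 2}}" by (auto simp: simple_graph_def complete_edges_def)
  from hom_density_graphon[OF n this]
  have 1: "hom_density 2 {{1, 2}} (graphon n w) = hom_sum {1..n} 2 {{1, 2}} (\<lambda>_. adj n w) / (real n)\<^sup>2" .
  have "(real n)\<^sup>2 * hom_sum {1..n} 2 {{1, 2}} (\<lambda>_. adj n w) = (real n)\<^sup>2 * (\<Sum>i\<in>{1..n}. \<Sum>j\<in>{1..n}. adj n w i j)"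
    unfolding hom_sum_def using sum_PiE_pair[of "{1..2::nat}" 1 2 "{1..n}" "adj n w"] by (simp add: numeral_2_eq_2)
  then have 2: "hom_sum {1..n} 2 {{1, 2}} (\<lambda>_. adj n w) = (\<Sum>i\<in>{1..n}. \<Sum>j\<in>{1..n}. adj n w i j)"
    using n by simp
  show ?thesis
    unfolding hamiltonian_def 1 2 hom_density_graphon[OF n graph] using n by (simp add: field_simps)
qed

section \<open>An upper bound for graphs far from a constant\<close>

locale ergm_model = ferromagnetic_model +
  fixes k :: nat and E :: "nat set set" and \<beta>1 \<beta>2 :: real
  assumes graph: "simple_graph k E" and edges: "card E = p" and \<beta>2_nonneg: "\<beta>2 \<ge> 0"
begin

abbreviation "P n \<equiv> weighted_graphs \<mu> n"
abbreviation "L \<equiv> objective \<beta>1 \<beta>2"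
abbreviation "energy n w \<equiv> (real n)\<^sup>2 * hamiltonian k E \<beta>1 \<beta>2 n w"

sublocale PP: product_prob_space "\<lambda>_ :: nat set. \<mu>" "complete_edges n" for n
  by unfold_locales

lemma prob_space_P: "prob_space (P n)"
  unfolding weighted_graphs_def by (rule PP.prob_space_axioms)

lemma E_nonempty: "E \<noteq> {}" using edges p_ge_2 by auto

lemma AE_P_01: "AE w in P n. \<forall>e\<in>complete_edges n. w e \<in> {0..1}"
proof (rule AE_finite_allI)
  fix e assume "e \<in> complete_edges n"
  then show "AE w in P n. w e \<in> {0..1}"
    unfolding weighted_graphs_def by (intro AE_PiM_component prob_space_axioms supported)
qed simp

lemma measurable_weight: "e \<in> complete_edges n \<Longrightarrow> (\<lambda>w. w e) \<in> borel_measurable (P n)"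
proof -
  assume "e \<in> complete_edges n"
  then have "(\<lambda>w. w e) \<in> measurable (P n) \<mu>" unfolding weighted_graphs_def by (rule measurable_component_singleton)
  then show ?thesis using measurable_cong_sets[OF refl sets_eq] by blast
qed

lemma measurable_adj [measurable]: "(\<lambda>w. adj n w i j) \<in> borel_measurable (P n)"
  unfolding adj_def using measurable_weight[of "{i, j}" n] by (cases "{i, j} \<in> complete_edges n") auto

lemma measurable_energy: "n > 0 \<Longrightarrow> energy n \<in> borel_measurable (P n)"
proof -
  assume "n > 0"
  then have "energy n = (\<lambda>w. \<beta>1 * (\<Sum>i\<in>{1..n}. \<Sum>j\<in>{1..n}. adj n w i j)
     + \<beta>2 * ((real n)\<^sup>2 * hom_sum {1..n} k E (\<lambda>_. adj n w) / real n ^ k))"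
    by (intro ext hamiltonian_eq graph)
  then show ?thesis unfolding hom_sum_def by simp
qed

text \<open>Each edge may be tilted by its own parameter; the normalization makes every such product a
  probability density.\<close>

lemma nn_integral_tilt:
  "(\<integral>\<^sup>+ w. ennreal (exp (\<Sum>e\<in>complete_edges n. t e * w e - K (t e))) \<partial>P n) = 1"
proof -
  have single: "(\<integral>\<^sup>+ x. ennreal (exp (\<theta> * x - K \<theta>)) \<partial>\<mu>) = 1" for \<theta>
  proof -
    have "integrable \<mu> (\<lambda>x. exp (\<theta> * x - K \<theta>))"
      unfolding exp_diff by (intro integrable_divide integrable_exp)
    then have "(\<integral>\<^sup>+ x. ennreal (exp (\<theta> * x - K \<theta>)) \<partial>\<mu>) = ennreal (LINT x|\<mu>. exp (\<theta> * x - K \<theta>))"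
      by (intro nn_integral_eq_integral) auto
    also have "(LINT x|\<mu>. exp (\<theta> * x - K \<theta>)) = 1" by (simp add: exp_diff exp_K[symmetric])
    finally show ?thesis by simp
  qed
  have meas: "(\<lambda>x. ennreal (exp (\<theta> * x - K \<theta>))) \<in> borel_measurable \<mu>" for \<theta>
    by (subst measurable_cong_sets[OF sets_eq refl]) measurable
  have "(\<integral>\<^sup>+ w. ennreal (exp (\<Sum>e\<in>complete_edges n. t e * w e - K (t e))) \<partial>P n)
      = (\<integral>\<^sup>+ w. (\<Prod>e\<in>complete_edges n. ennreal (exp (t e * w e - K (t e)))) \<partial>P n)"
    by (simp add: exp_sum prod_ennreal)
  also have "\<dots> = (\<Prod>e\<in>complete_edges n. \<integral>\<^sup>+ x. ennreal (exp (t e * x - K (t e))) \<partial>\<mu>)"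
    unfolding weighted_graphs_def by (rule PP.product_nn_integral_prod[OF finite_complete_edges meas])
  also have "\<dots> = 1" by (simp add: single)
  finally show ?thesis .
qed

text \<open>The loss away from a unique maximizer, in a form that is affine in \<open>\<bar>v - u\<bar>\<close> and can therefore be
  summed over pairs of vertices.\<close>

lemma objective_gap:
  assumes max: "maximizers \<mu> p \<beta>1 \<beta>2 = {u}" and "r > 0"
  shows "\<exists>\<kappa>>0. \<forall>v\<in>{0..1}. L v \<le> L u - \<kappa> * (\<bar>v - u\<bar> - r)"
proof -
  have u01: "u \<in> {0..1}" and umax: "\<And>v. v \<in> {0..1} \<Longrightarrow> L v \<le> L u"
    using maximizers_iff[of u \<beta>1 \<beta>2] max by auto
  define S where "S = {v\<in>{0..1}. r \<le> \<bar>v - u\<bar>}"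
  have "\<exists>\<kappa>>0. \<forall>v\<in>S. L v \<le> L u - \<kappa>"
  proof (cases "S = {}")
    case True then show ?thesis by (auto intro: exI[of _ 1])
  next
    case False
    have S: "S = {0..1} \<inter> {v. r \<le> \<bar>v - u\<bar>}" by (auto simp: S_def)
    have "closed {v. r \<le> \<bar>v - u\<bar>}" by (intro closed_Collect_le continuous_intros)
    then have "compact S" unfolding S by (intro compact_Int_closed) auto
    moreover have "continuous_on S L" by (rule continuous_on_subset[OF objective_continuous]) (auto simp: S_def)
    ultimately obtain v0 where v0: "v0 \<in> S" "\<And>v. v \<in> S \<Longrightarrow> L v \<le> L v0"
      using continuous_attains_sup[of S L] False by blast
    have "v0 \<notin> maximizers \<mu> p \<beta>1 \<beta>2" using v0(1) max \<open>r > 0\<close> by (auto simp: S_def)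
    then obtain v where "v \<in> {0..1}" "L v > L v0" using v0(1) maximizers_iff[of v0] by (auto simp: S_def not_le)
    then have "L v0 < L u" using umax[of v] by simp
    then show ?thesis using v0(2) by (intro exI[of _ "L u - L v0"]) auto
  qed
  then obtain \<kappa> where \<kappa>: "\<kappa> > 0" "\<And>v. v \<in> S \<Longrightarrow> L v \<le> L u - \<kappa>" by blast
  show ?thesis
  proof (intro exI[of _ \<kappa>] conjI ballI \<kappa>(1))
    fix v :: real assume v: "v \<in> {0..1}"
    show "L v \<le> L u - \<kappa> * (\<bar>v - u\<bar> - r)"
    proof (cases "v \<in> S")
      case True
      have "\<bar>v - u\<bar> - r \<le> 1" using v u01 \<open>r > 0\<close> by auto
      then have "\<kappa> * (\<bar>v - u\<bar> - r) \<le> \<kappa> * 1" using \<kappa>(1) by (intro mult_left_mono) auto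
      then show ?thesis using \<kappa>(2)[OF True] by simp
    next
      case False
      then have "\<kappa> * (\<bar>v - u\<bar> - r) \<le> 0" using v \<kappa>(1) by (auto simp: S_def mult_le_0_iff)
      then show ?thesis using umax[OF v] by simp
    qed
  qed
qed

text \<open>Passing to block averages changes the edge density by nothing and the density of \<open>E\<close> by at most
  \<open>p \<epsilon>\<close>. The sign of \<open>\<beta>2\<close> is used for the upper bound by the power mean.\<close>

lemma energy_le_block_objective:
  assumes n: "n > 0" and w: "\<And>e. e \<in> complete_edges n \<Longrightarrow> w e \<in> {0..1}"
    and cut: "cut_small {1..n} \<epsilon> (\<lambda>i j. adj n w i j - block_avg {1..n} c (adj n w) i j)"
  defines "B \<equiv> block_avg {1..n} c (adj n w)"
  shows "energy n w \<le> (\<Sum>i\<in>{1..n}. \<Sum>j\<in>{1..n}. L (B i j) + J (B i j) / 2) + \<beta>2 * real p * \<epsilon> * (real n)\<^sup>2"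
proof -
  let ?A = "adj n w"
  have A01: "?A i j \<in> {0..1}" for i j by (rule adj_01[OF w])
  have B01: "B i j \<in> {0..1}" if "i \<in> {1..n}" "j \<in> {1..n}" for i j
    unfolding B_def using that A01 by (intro block_avg_01) auto
  have sumA: "(\<Sum>i\<in>{1..n}. \<Sum>j\<in>{1..n}. ?A i j) = (\<Sum>i\<in>{1..n}. \<Sum>j\<in>{1..n}. B i j)"
    using block_avg_inner[of "{1..n}" ?A "\<lambda>_ _. 1" c] by (simp add: B_def)
  have nk: "real n ^ k > 0" using n by simp
  have ne: "{1..n} \<noteq> {}" using n by auto
  have "hom_sum {1..n} k E (\<lambda>_. ?A) \<le> hom_sum {1..n} k E (\<lambda>_. B) + real p * \<epsilon> * real n ^ k"
    using hom_sum_counting[of "{1..n}" k E ?A B \<epsilon>] A01 B01 cut ne graph by (auto simp: edges B_def)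
  then have "(real n)\<^sup>2 * hom_sum {1..n} k E (\<lambda>_. ?A) \<le> (real n)\<^sup>2 * (hom_sum {1..n} k E (\<lambda>_. B) + real p * \<epsilon> * real n ^ k)"
    by (intro mult_left_mono) auto
  also have "\<dots> = (real n)\<^sup>2 * hom_sum {1..n} k E (\<lambda>_. B) + real n ^ k * (real p * \<epsilon> * (real n)\<^sup>2)"
    by (simp add: algebra_simps)
  also have "\<dots> \<le> real n ^ k * (\<Sum>i\<in>{1..n}. \<Sum>j\<in>{1..n}. B i j ^ p) + real n ^ k * (real p * \<epsilon> * (real n)\<^sup>2)"
    using hom_sum_le_power_mean[of "{1..n}" k E B] graph E_nonempty B01 by (auto simp: edges)
  finally have "(real n)\<^sup>2 * hom_sum {1..n} k E (\<lambda>_. ?A) / real n ^ k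
      \<le> (\<Sum>i\<in>{1..n}. \<Sum>j\<in>{1..n}. B i j ^ p) + real p * \<epsilon> * (real n)\<^sup>2"
    using nk by (simp add: pos_divide_le_eq algebra_simps)
  then have "energy n w \<le> \<beta>1 * (\<Sum>i\<in>{1..n}. \<Sum>j\<in>{1..n}. B i j)
      + \<beta>2 * ((\<Sum>i\<in>{1..n}. \<Sum>j\<in>{1..n}. B i j ^ p) + real p * \<epsilon> * (real n)\<^sup>2)"
    unfolding hamiltonian_eq[OF n graph] sumA using \<beta>2_nonneg by (intro add_left_mono mult_left_mono) auto
  also have "\<dots> = (\<Sum>i\<in>{1..n}. \<Sum>j\<in>{1..n}. L (B i j) + J (B i j) / 2) + \<beta>2 * real p * \<epsilon> * (real n)\<^sup>2"
    by (simp add: objective_def sum.distrib sum_distrib_left algebra_simps)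
  finally show ?thesis .
qed

text \<open>A cut that separates the graph from \<open>u\<close> by \<open>\<epsilon>0\<close> separates its block averages from \<open>u\<close> by
  \<open>\<epsilon>0/2\<close>, which is a lower bound for their mean distance to \<open>u\<close>.\<close>

lemma block_objective_far:
  assumes n: "n > 0" and w: "\<And>e. e \<in> complete_edges n \<Longrightarrow> w e \<in> {0..1}"
    and cut: "cut_small {1..n} \<epsilon> (\<lambda>i j. adj n w i j - block_avg {1..n} c (adj n w) i j)"
    and far: "\<not> cut_small {1..n} \<epsilon>0 (\<lambda>i j. adj n w i j - u)" and \<epsilon>: "\<epsilon> \<le> \<epsilon>0 / 2"
    and gap: "\<kappa> > 0" "\<And>v. v \<in> {0..1} \<Longrightarrow> L v \<le> L u - \<kappa> * (\<bar>v - u\<bar> - \<epsilon>0 / 4)"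
  shows "(\<Sum>i\<in>{1..n}. \<Sum>j\<in>{1..n}. L (block_avg {1..n} c (adj n w) i j)) \<le> (real n)\<^sup>2 * (L u - \<kappa> * \<epsilon>0 / 4)"
proof -
  let ?A = "adj n w" and ?V = "{1..n}"
  define B where "B = block_avg ?V c ?A"
  have B01: "B i j \<in> {0..1}" if "i \<in> ?V" "j \<in> ?V" for i j
    unfolding B_def using that adj_01[OF w] by (intro block_avg_01) auto
  define dB where "dB = (\<Sum>i\<in>?V. \<Sum>j\<in>?V. \<bar>B i j - u\<bar>)"
  have dB: "dB \<ge> \<epsilon>0 / 2 * (real n)\<^sup>2"
  proof -
    obtain S T where ST: "S \<subseteq> ?V" "T \<subseteq> ?V" "\<bar>\<Sum>i\<in>S. \<Sum>j\<in>T. ?A i j - u\<bar> > \<epsilon>0 * (real n)\<^sup>2"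
      using far by (auto simp: cut_small_def not_le)
    have "(\<Sum>i\<in>S. \<Sum>j\<in>T. ?A i j - u) = (\<Sum>i\<in>S. \<Sum>j\<in>T. ?A i j - B i j) + (\<Sum>i\<in>S. \<Sum>j\<in>T. B i j - u)"
      by (simp add: sum.distrib[symmetric])
    moreover have "\<bar>\<Sum>i\<in>S. \<Sum>j\<in>T. ?A i j - B i j\<bar> \<le> \<epsilon> * (real (card ?V))\<^sup>2"
      using cut ST unfolding cut_small_def B_def by blast
    moreover have "\<bar>\<Sum>i\<in>S. \<Sum>j\<in>T. B i j - u\<bar> \<le> dB"
    proof -
      have "\<bar>\<Sum>i\<in>S. \<Sum>j\<in>T. B i j - u\<bar> \<le> (\<Sum>i\<in>S. \<Sum>j\<in>T. \<bar>B i j - u\<bar>)"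
        by (intro order_trans[OF sum_abs] sum_mono sum_abs)
      also have "\<dots> \<le> (\<Sum>i\<in>?V. \<Sum>j\<in>T. \<bar>B i j - u\<bar>)" using ST by (intro sum_mono2 sum_nonneg) auto
      also have "\<dots> \<le> dB" unfolding dB_def using ST by (intro sum_mono sum_mono2) auto
      finally show ?thesis .
    qed
    moreover have "\<epsilon> * (real n)\<^sup>2 \<le> \<epsilon>0 / 2 * (real n)\<^sup>2" using \<epsilon> by (intro mult_right_mono) auto
    ultimately show ?thesis using ST(3) by simp
  qed
  have "(\<Sum>i\<in>?V. \<Sum>j\<in>?V. L (B i j)) \<le> (\<Sum>i\<in>?V. \<Sum>j\<in>?V. L u - \<kappa> * (\<bar>B i j - u\<bar> - \<epsilon>0 / 4))"
    by (intro sum_mono gap(2) B01)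
  also have "\<dots> = (real n)\<^sup>2 * (L u + \<kappa> * \<epsilon>0 / 4) - \<kappa> * dB"
    by (simp add: dB_def sum_subtractf sum_distrib_left[symmetric] right_diff_distrib power2_eq_square algebra_simps)
  also have "\<dots> \<le> (real n)\<^sup>2 * (L u + \<kappa> * \<epsilon>0 / 4) - \<kappa> * (\<epsilon>0 / 2 * (real n)\<^sup>2)"
    using dB gap(1) by (intro diff_left_mono mult_left_mono) auto
  also have "\<dots> = (real n)\<^sup>2 * (L u - \<kappa> * \<epsilon>0 / 4)" by (simp add: algebra_simps)
  finally show ?thesis by (simp add: B_def)
qed

text \<open>On each block the rate is replaced by one of finitely many affine functions, chosen according to
  the average on that block. Being affine, it has the same sum over the block for the averages
  and for the weights themselves. The diagonal, which carries no weights, accounts for the last term.\<close>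

lemma block_rate_le_tilt:
  assumes w: "\<And>e. e \<in> complete_edges n \<Longrightarrow> w e \<in> {0..1}" and c: "c \<in> {1..n} \<rightarrow>\<^sub>E {..<m}"
    and net: "finite \<Theta>" "\<And>v. v \<in> {0..1} \<Longrightarrow> \<exists>\<theta>\<in>\<Theta>. J v \<le> \<theta> * v - K \<theta> + \<eta>"
  shows "\<exists>t \<in> {..<m} \<times> {..<m} \<rightarrow>\<^sub>E \<Theta>.
    (\<Sum>i\<in>{1..n}. \<Sum>j\<in>{1..n}. J (block_avg {1..n} c (adj n w) i j) / 2) \<le>
      (\<Sum>e\<in>complete_edges n. t (c (Min e), c (Max e)) * w e - K (t (c (Min e), c (Max e))))
      + \<eta> / 2 * (real n)\<^sup>2 + real n * (\<Sum>\<theta>\<in>\<Theta>. \<bar>K \<theta>\<bar>)"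
proof -
  let ?A = "adj n w" and ?V = "{1..n}"
  define B where "B = block_avg ?V c ?A"
  have B01: "B i j \<in> {0..1}" if "i \<in> ?V" "j \<in> ?V" for i j
    unfolding B_def using that adj_01[OF w] by (intro block_avg_01) auto
  have Bsym: "B i j = B j i" for i j unfolding B_def by (intro block_avg_sym adj_sym)
  obtain h where h: "\<And>i j. B i j = h (c i) (c j)" unfolding B_def using block_avg_factor by metis
  \<comment> \<open>The choice is made for all \<open>v\<close>, so that empty blocks get a tilt from the net as well.\<close>
  have "\<exists>\<theta>\<in>\<Theta>. v \<in> {0..1} \<longrightarrow> J v \<le> \<theta> * v - K \<theta> + \<eta>" for v
    using net(2)[of v] net(2)[of 0] by (cases "v \<in> {0..1}") auto
  then obtain \<tau> where \<tau>: "\<And>v. \<tau> v \<in> \<Theta>" "\<And>v. v \<in> {0..1} \<Longrightarrow> J v \<le> \<tau> v * v - K (\<tau> v) + \<eta>" by metis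
  define t where "t = (\<lambda>(a, b)\<in>{..<m} \<times> {..<m}. \<tau> (h a b))"
  have t: "t (c i, c j) = \<tau> (B i j)" if "i \<in> ?V" "j \<in> ?V" for i j
    using that c by (auto simp: t_def h PiE_iff)
  have "(\<Sum>i\<in>?V. \<Sum>j\<in>?V. J (B i j)) \<le> (\<Sum>i\<in>?V. \<Sum>j\<in>?V. B i j * \<tau> (B i j) - K (\<tau> (B i j)) + \<eta>)"
    by (intro sum_mono) (metis \<tau>(2) B01 mult.commute)
  also have "\<dots> = (\<Sum>i\<in>?V. \<Sum>j\<in>?V. B i j * \<tau> (B i j)) - (\<Sum>i\<in>?V. \<Sum>j\<in>?V. K (\<tau> (B i j))) + \<eta> * (real n)\<^sup>2"
    by (simp add: sum.distrib sum_subtractf power2_eq_square)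
  also have "(\<Sum>i\<in>?V. \<Sum>j\<in>?V. B i j * \<tau> (B i j)) = (\<Sum>i\<in>?V. \<Sum>j\<in>?V. ?A i j * \<tau> (B i j))"
    using block_avg_inner[of ?V ?A "\<lambda>a b. \<tau> (h a b)" c] unfolding h[symmetric] B_def[symmetric] by simp
  also have "\<dots> - (\<Sum>i\<in>?V. \<Sum>j\<in>?V. K (\<tau> (B i j))) = (\<Sum>i\<in>?V. \<Sum>j\<in>?V. ?A i j * \<tau> (B i j) - K (\<tau> (B i j)))"
    by (simp add: sum_subtractf)
  also have "\<dots> = 2 * (\<Sum>e\<in>complete_edges n. ?A (Min e) (Max e) * \<tau> (B (Min e) (Max e)) - K (\<tau> (B (Min e) (Max e))))
      + (\<Sum>i\<in>?V. ?A i i * \<tau> (B i i) - K (\<tau> (B i i)))"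
    using adj_sym Bsym by (intro sum_pairs_eq_edges) metis
  also have "(\<Sum>e\<in>complete_edges n. ?A (Min e) (Max e) * \<tau> (B (Min e) (Max e)) - K (\<tau> (B (Min e) (Max e))))
      = (\<Sum>e\<in>complete_edges n. t (c (Min e), c (Max e)) * w e - K (t (c (Min e), c (Max e))))"
    using complete_edgesD t by (intro sum.cong refl) (simp add: adj_edge)
  also have "(\<Sum>i\<in>?V. ?A i i * \<tau> (B i i) - K (\<tau> (B i i))) \<le> (\<Sum>i\<in>?V. \<Sum>\<theta>\<in>\<Theta>. \<bar>K \<theta>\<bar>)"
  proof (rule sum_mono)
    fix i
    have "\<bar>K (\<tau> (B i i))\<bar> \<le> (\<Sum>\<theta>\<in>\<Theta>. \<bar>K \<theta>\<bar>)" using net(1) \<tau>(1) by (intro member_le_sum) auto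
    then show "?A i i * \<tau> (B i i) - K (\<tau> (B i i)) \<le> (\<Sum>\<theta>\<in>\<Theta>. \<bar>K \<theta>\<bar>)" by (simp add: adj_diag)
  qed
  finally have main: "(\<Sum>i\<in>?V. \<Sum>j\<in>?V. J (B i j)) \<le>
      2 * (\<Sum>e\<in>complete_edges n. t (c (Min e), c (Max e)) * w e - K (t (c (Min e), c (Max e))))
      + real n * (\<Sum>\<theta>\<in>\<Theta>. \<bar>K \<theta>\<bar>) + \<eta> * (real n)\<^sup>2" by simp
  have nonneg: "real n * (\<Sum>\<theta>\<in>\<Theta>. \<bar>K \<theta>\<bar>) \<ge> 0" by (simp add: sum_nonneg)
  have half: "s / 2 \<le> x + \<eta> / 2 * q + d" if "s \<le> 2 * x + d + \<eta> * q" "d \<ge> 0" for s x d q :: real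
    using that by (simp add: field_simps)
  have "(\<Sum>i\<in>?V. \<Sum>j\<in>?V. J (B i j) / 2) \<le>
      (\<Sum>e\<in>complete_edges n. t (c (Min e), c (Max e)) * w e - K (t (c (Min e), c (Max e))))
      + \<eta> / 2 * (real n)\<^sup>2 + real n * (\<Sum>\<theta>\<in>\<Theta>. \<bar>K \<theta>\<bar>)"
    unfolding sum_divide_distrib[symmetric] by (rule half[OF main nonneg])
  moreover have "t \<in> {..<m} \<times> {..<m} \<rightarrow>\<^sub>E \<Theta>" using \<tau>(1) by (auto simp: t_def)
  ultimately show ?thesis unfolding B_def by blast
qed

definition far_graphs :: "real \<Rightarrow> real \<Rightarrow> nat \<Rightarrow> (nat set \<Rightarrow> real) set" where
  "far_graphs u \<epsilon> n = {w \<in> space (P n). \<not> cut_small {1..n} \<epsilon> (\<lambda>i j. adj n w i j - u)}"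

lemma far_graphs_sets: "far_graphs u \<epsilon> n \<in> sets (P n)"
proof -
  have "far_graphs u \<epsilon> n = (\<Union>S\<in>Pow {1..n}. \<Union>T\<in>Pow {1..n}.
      {w \<in> space (P n). \<epsilon> * (real (card {1..n}))\<^sup>2 < \<bar>\<Sum>i\<in>S. \<Sum>j\<in>T. adj n w i j - u\<bar>})"
    by (auto simp: far_graphs_def cut_small_def not_le)
  also have "\<dots> \<in> sets (P n)"
    by (intro sets.finite_UN) auto
  finally show ?thesis .
qed

text \<open>The union bound over colourings and choices of tilts. All errors are chosen so that half of
  the loss \<open>\<kappa> \<epsilon>0 / 4\<close> survives in the quadratic term.\<close>

lemma far_graphs_weight:
  assumes max: "maximizers \<mu> p \<beta>1 \<beta>2 = {u}" and "\<epsilon>0 > 0"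
  shows "\<exists>\<gamma>>0. \<exists>C. \<forall>n>0. (\<integral>\<^sup>+ w. ennreal (exp (energy n w)) * indicator (far_graphs u \<epsilon>0 n) w \<partial>P n)
     \<le> ennreal (exp ((real n)\<^sup>2 * (L u - \<gamma>) + C * real n))"
proof -
  obtain \<kappa> where \<kappa>: "\<kappa> > 0" "\<And>v. v \<in> {0..1} \<Longrightarrow> L v \<le> L u - \<kappa> * (\<bar>v - u\<bar> - \<epsilon>0 / 4)"
    using objective_gap[OF max, of "\<epsilon>0 / 4"] \<open>\<epsilon>0 > 0\<close> by auto
  \<comment> \<open>The loss is \<open>2 \<gamma>\<close>; the counting lemma and the net may each use up \<open>\<gamma>/2\<close>.\<close>
  define \<gamma> where "\<gamma> = \<kappa> * \<epsilon>0 / 8"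
  have \<gamma>0: "\<gamma> > 0" using \<kappa> \<open>\<epsilon>0 > 0\<close> by (simp add: \<gamma>_def)
  define \<epsilon> where "\<epsilon> = min (\<epsilon>0 / 2) (\<gamma> / 2 / (\<beta>2 * real p + 1))"
  have bp: "\<beta>2 * real p \<ge> 0" using \<beta>2_nonneg by simp
  have \<epsilon>: "\<epsilon> > 0" "\<epsilon> \<le> \<epsilon>0 / 2" "\<beta>2 * real p * \<epsilon> \<le> \<gamma> / 2"
  proof -
    show pos: "\<epsilon> > 0" using \<open>\<epsilon>0 > 0\<close> \<gamma>0 bp by (simp add: \<epsilon>_def add_nonneg_pos)
    show "\<epsilon> \<le> \<epsilon>0 / 2" unfolding \<epsilon>_def by (rule min.cobounded1)
    have "\<epsilon> \<le> \<gamma> / 2 / (\<beta>2 * real p + 1)" unfolding \<epsilon>_def by (rule min.cobounded2)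
    then have "(\<beta>2 * real p + 1) * \<epsilon> \<le> \<gamma> / 2" using bp by (simp add: pos_le_divide_eq add_nonneg_pos algebra_simps)
    then show "\<beta>2 * real p * \<epsilon> \<le> \<gamma> / 2" using pos by (simp add: algebra_simps)
  qed
  obtain \<Theta> where net: "finite \<Theta>" "\<And>v. v \<in> {0..1} \<Longrightarrow> \<exists>\<theta>\<in>\<Theta>. J v \<le> \<theta> * v - K \<theta> + \<gamma>"
    using finite_dual_net[OF \<gamma>0] by blast
  obtain m :: nat where m: "\<forall>(V :: nat set) A. finite V \<longrightarrow> (\<forall>i\<in>V. \<forall>j\<in>V. A i j \<in> {0..1}) \<longrightarrow>
     (\<exists>c \<in> V \<rightarrow>\<^sub>E {..<m}. cut_small V \<epsilon> (\<lambda>i j. A i j - block_avg V c A i j))"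
    by (rule exE[OF weak_regularity[OF \<epsilon>(1)]])
  define D where "D = (\<Sum>\<theta>\<in>\<Theta>. \<bar>K \<theta>\<bar>)"
  define C where "C = D + real m + real (card \<Theta> * (m * m))"
  define tilt where "tilt n c t w = (\<Sum>e\<in>complete_edges n. t (c (Min e), c (Max e)) * w e - K (t (c (Min e), c (Max e))))"
    for n and c :: "nat \<Rightarrow> nat" and t :: "nat \<times> nat \<Rightarrow> real" and w :: "nat set \<Rightarrow> real"
  have pointwise: "\<exists>c\<in>{1..n} \<rightarrow>\<^sub>E {..<m}. \<exists>t\<in>{..<m} \<times> {..<m} \<rightarrow>\<^sub>E \<Theta>.
      energy n w \<le> (real n)\<^sup>2 * (L u - \<gamma>) + real n * D + tilt n c t w"
    if n: "n > 0" and w: "\<And>e. e \<in> complete_edges n \<Longrightarrow> w e \<in> {0..1}" and far: "w \<in> far_graphs u \<epsilon>0 n" for n w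
  proof -
    obtain c where c: "c \<in> {1..n} \<rightarrow>\<^sub>E {..<m}"
      and cut: "cut_small {1..n} \<epsilon> (\<lambda>i j. adj n w i j - block_avg {1..n} c (adj n w) i j)"
      using m[rule_format, of "{1..n}" "adj n w"] adj_01[of n w, OF w] by blast
    obtain t where t: "t \<in> {..<m} \<times> {..<m} \<rightarrow>\<^sub>E \<Theta>"
      and tJ: "(\<Sum>i\<in>{1..n}. \<Sum>j\<in>{1..n}. J (block_avg {1..n} c (adj n w) i j) / 2) \<le>
        tilt n c t w + \<gamma> / 2 * (real n)\<^sup>2 + real n * D"
      using block_rate_le_tilt[where w = w, OF w c net] unfolding tilt_def D_def by blast
    have far': "\<not> cut_small {1..n} \<epsilon>0 (\<lambda>i j. adj n w i j - u)" using far by (simp add: far_graphs_def)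
    have "\<beta>2 * real p * \<epsilon> * (real n)\<^sup>2 \<le> \<gamma> / 2 * (real n)\<^sup>2" using \<epsilon>(3) by (intro mult_right_mono) auto
    moreover have "(real n)\<^sup>2 * (L u - \<kappa> * \<epsilon>0 / 4) = (real n)\<^sup>2 * (L u - \<gamma>) - \<gamma> * (real n)\<^sup>2"
      by (simp add: \<gamma>_def algebra_simps)
    ultimately have "energy n w \<le> (real n)\<^sup>2 * (L u - \<gamma>) + real n * D + tilt n c t w"
      using energy_le_block_objective[where w = w, OF n w cut]
        block_objective_far[where w = w, OF n w cut far' \<epsilon>(2) \<kappa>] tJ
      by (simp add: sum.distrib)
    then show ?thesis using c t by blast
  qed
  have "(\<integral>\<^sup>+ w. ennreal (exp (energy n w)) * indicator (far_graphs u \<epsilon>0 n) w \<partial>P n)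
     \<le> ennreal (exp ((real n)\<^sup>2 * (L u - \<gamma>) + C * real n))" if n: "n > 0" for n
  proof -
    let ?CC = "{1..n} \<rightarrow>\<^sub>E {..<m}" and ?TT = "{..<m} \<times> {..<m} \<rightarrow>\<^sub>E \<Theta>"
    define a where "a = exp ((real n)\<^sup>2 * (L u - \<gamma>) + real n * D)"
    have fin: "finite ?CC" "finite ?TT" using net(1) by (auto intro!: finite_PiE)
    have meas: "(\<lambda>w. ennreal (exp (tilt n c t w))) \<in> borel_measurable (P n)" for c t
      unfolding tilt_def using measurable_weight by measurable
    have "AE w in P n. ennreal (exp (energy n w)) * indicator (far_graphs u \<epsilon>0 n) w
        \<le> (\<Sum>c\<in>?CC. \<Sum>t\<in>?TT. ennreal a * ennreal (exp (tilt n c t w)))"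
      using AE_P_01[of n]
    proof eventually_elim
      case (elim w)
      show ?case
      proof (cases "w \<in> far_graphs u \<epsilon>0 n")
        case True
        obtain c t where ct: "c \<in> ?CC" "t \<in> ?TT" "energy n w \<le> (real n)\<^sup>2 * (L u - \<gamma>) + real n * D + tilt n c t w"
          using pointwise[OF n _ True] elim by blast
        have "ennreal (exp (energy n w)) \<le> ennreal (a * exp (tilt n c t w))"
          using ct(3) by (intro ennreal_leI) (simp add: a_def flip: exp_add)
        also have "\<dots> = ennreal a * ennreal (exp (tilt n c t w))" by (simp add: ennreal_mult a_def)
        also have "\<dots> \<le> (\<Sum>t\<in>?TT. ennreal a * ennreal (exp (tilt n c t w)))"
          using fin ct by (intro member_le_sum) auto
        also have "\<dots> \<le> (\<Sum>c\<in>?CC. \<Sum>t\<in>?TT. ennreal a * ennreal (exp (tilt n c t w)))"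
          using fin ct by (intro member_le_sum[of c ?CC "\<lambda>c. \<Sum>t\<in>?TT. ennreal a * ennreal (exp (tilt n c t w))"]) auto
        finally show ?thesis using True by simp
      qed simp
    qed
    then have "(\<integral>\<^sup>+ w. ennreal (exp (energy n w)) * indicator (far_graphs u \<epsilon>0 n) w \<partial>P n)
        \<le> (\<integral>\<^sup>+ w. (\<Sum>c\<in>?CC. \<Sum>t\<in>?TT. ennreal a * ennreal (exp (tilt n c t w))) \<partial>P n)"
      by (rule nn_integral_mono_AE)
    also have "\<dots> = (\<Sum>c\<in>?CC. \<Sum>t\<in>?TT. ennreal a * (\<integral>\<^sup>+ w. ennreal (exp (tilt n c t w)) \<partial>P n))"
      using meas by (simp add: nn_integral_sum nn_integral_cmult)
    also have "\<dots> = (\<Sum>c\<in>?CC. \<Sum>t\<in>?TT. ennreal a)"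
    proof -
      have "(\<integral>\<^sup>+ w. ennreal (exp (tilt n c t w)) \<partial>P n) = 1" for c t
        unfolding tilt_def by (rule nn_integral_tilt)
      then show ?thesis by simp
    qed
    also have "\<dots> = ennreal (real (card ?CC) * (real (card ?TT) * a))"
      by (simp add: ennreal_mult a_def ennreal_of_nat_eq_real_of_nat)
    also have "\<dots> \<le> ennreal (exp ((real n)\<^sup>2 * (L u - \<gamma>) + C * real n))"
    proof (rule ennreal_leI)
      have le_exp: "real x \<le> exp (real x)" for x :: nat using exp_ge_add_one_self[of "real x"] by linarith
      have "real (card ?CC) = real m ^ n" by (simp add: card_PiE)
      also have "\<dots> \<le> exp (real m) ^ n" by (intro power_mono le_exp) auto
      also have "\<dots> = exp (real n * real m)" by (simp add: exp_of_nat_mult)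
      finally have c1: "real (card ?CC) \<le> exp (real n * real m)" .
      have "real (card ?TT) = real (card \<Theta>) ^ (m * m)" by (simp add: card_PiE card_cartesian_product)
      also have "\<dots> \<le> exp (real (card \<Theta>)) ^ (m * m)" by (intro power_mono le_exp) auto
      also have "\<dots> = exp (real (m * m) * real (card \<Theta>))" by (simp only: exp_of_nat_mult)
      also have "\<dots> \<le> exp (real n * real (card \<Theta> * (m * m)))"
      proof -
        have "1 * real (card \<Theta> * (m * m)) \<le> real n * real (card \<Theta> * (m * m))" using n by (intro mult_right_mono) auto
        then show ?thesis by (simp add: mult_ac)
      qed
      finally have c2: "real (card ?TT) \<le> exp (real n * real (card \<Theta> * (m * m)))" .
      have "real (card ?CC) * (real (card ?TT) * a) \<le> exp (real n * real m) * (exp (real n * real (card \<Theta> * (m * m))) * a)"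
        using c1 c2 by (intro mult_mono) (auto simp: a_def)
      also have "\<dots> = exp ((real n)\<^sup>2 * (L u - \<gamma>) + C * real n)"
        unfolding a_def C_def by (simp add: algebra_simps flip: exp_add)
      finally show "real (card ?CC) * (real (card ?TT) * a) \<le> exp ((real n)\<^sup>2 * (L u - \<gamma>) + C * real n)" .
    qed
    finally show ?thesis .
  qed
  then show ?thesis using \<gamma>0 by blast
qed

end

section \<open>A lower bound for the partition function\<close>

lemma card_complete_edges: "2 * real (card (complete_edges n)) = real n * (real n - 1)"
  using sum_pairs_eq_edges[of "\<lambda>_ _. 1" n] by (simp add: algebra_simps)

lemma prod_edge_weights_injective:
  assumes x: "x \<in> {1..k} \<rightarrow>\<^sub>E {1..n}" "inj_on x {1..k}" and graph: "simple_graph k E"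
  shows "(\<Prod>e\<in>E. adj n w (x (Min e)) (x (Max e))) = (\<Prod>f\<in>(`) x ` E. w f)"
    and "(`) x ` E \<subseteq> complete_edges n" and "card ((`) x ` E) = card E"
proof -
  have sub: "e \<subseteq> {1..k}" "card e = 2" if "e \<in> E" for e
    using graph that by (auto simp: simple_graph_def complete_edges_def)
  have inj: "inj_on ((`) x) E"
    by (rule inj_onI) (metis inj_on_image_eq_iff sub(1) x(2))
  show "card ((`) x ` E) = card E" by (rule card_image[OF inj])
  show "(`) x ` E \<subseteq> complete_edges n"
  proof
    fix f assume "f \<in> (`) x ` E"
    then obtain e where e: "e \<in> E" "f = x ` e" by auto
    have "card f = 2" using sub[OF e(1)] e(2) x(2) by (metis card_image inj_on_subset)
    moreover have "f \<subseteq> {1..n}" using sub(1)[OF e(1)] e(2) x(1) by (auto simp: PiE_iff)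
    ultimately show "f \<in> complete_edges n" by (simp add: complete_edges_def)
  qed
  then have "adj n w (x (Min e)) (x (Max e)) = w (x ` e)" if "e \<in> E" for e
  proof -
    have "e = {Min e, Max e}" using complete_edgesD(1)[of e k] graph that by (auto simp: simple_graph_def)
    then have "x ` e = {x (Min e), x (Max e)}" by (metis image_empty image_insert)
    moreover have "x ` e \<in> complete_edges n" using \<open>(`) x ` E \<subseteq> complete_edges n\<close> that by blast
    ultimately show ?thesis by (simp add: adj_def)
  qed
  then show "(\<Prod>e\<in>E. adj n w (x (Min e)) (x (Max e))) = (\<Prod>f\<in>(`) x ` E. w f)"
    using inj by (simp add: prod.reindex)
qed

text \<open>An injective map sends distinct edges of \<open>E\<close> to distinct edges, so that the edge weights in the
  product are independent; asymptotically almost all maps are injective.\<close>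

definition injective_fraction :: "nat \<Rightarrow> nat \<Rightarrow> real" where
  "injective_fraction k n = real (card {x \<in> {1..k} \<rightarrow>\<^sub>E {1..n}. inj_on x {1..k}}) / real n ^ k"

lemma injective_fraction_tendsto: "injective_fraction k \<longlonglongrightarrow> 1"
proof -
  have eq: "injective_fraction k n = (\<Prod>i\<in>{0..<k}. (real n - real i) / real n)" if "n \<ge> k" for n
  proof -
    have "real (card {x \<in> {1..k} \<rightarrow>\<^sub>E {1..n}. inj_on x {1..k}}) = (\<Prod>i\<in>{0..<k}. real (n - i))"
      using card_inj_on_subset_funcset[of "{1..k}" "{1..n}" "{1..k}"] by simp
    also have "\<dots> = (\<Prod>i\<in>{0..<k}. real n - real i)" using that by (intro prod.cong refl) (auto simp: of_nat_diff)
    finally show ?thesis by (simp add: injective_fraction_def prod_dividef)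
  qed
  have "(\<lambda>n. \<Prod>i\<in>{0..<k}. (real n - real i) / real n) \<longlonglongrightarrow> (\<Prod>i\<in>{0..<k}. 1)"
  proof (rule tendsto_prod)
    fix i
    have "(\<lambda>n. 1 - real i / real n) \<longlonglongrightarrow> 1 - 0" by (intro tendsto_intros lim_const_over_n)
    moreover have "\<forall>\<^sub>F n in sequentially. 1 - real i / real n = (real n - real i) / real n"
      using eventually_gt_at_top[of 0] by eventually_elim (simp add: diff_divide_distrib)
    ultimately show "(\<lambda>n. (real n - real i) / real n) \<longlonglongrightarrow> 1" by (simp add: Lim_transform_eventually)
  qed
  then have "(\<lambda>n. \<Prod>i\<in>{0..<k}. (real n - real i) / real n) \<longlonglongrightarrow> 1" by simp
  moreover have "\<forall>\<^sub>F n in sequentially. (\<Prod>i\<in>{0..<k}. (real n - real i) / real n) = injective_fraction k n"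
    using eventually_ge_at_top[of k] by eventually_elim (simp add: eq)
  ultimately show ?thesis by (rule Lim_transform_eventually)
qed

context ergm_model
begin

text \<open>Under the tilt the weights are independent with mean \<open>K'(\<theta>)\<close>.\<close>

lemma tilted_moment:
  fixes \<theta> :: real
  assumes "F \<subseteq> complete_edges n"
  defines "f \<equiv> \<lambda>w. exp (\<Sum>e\<in>complete_edges n. \<theta> * w e - K \<theta>) * (\<Prod>e\<in>F. w e)"
  shows "integrable (P n) f" and "(LINT w|P n. f w) = K1 \<theta> ^ card F"
proof -
  define h where "h e x = exp (\<theta> * x - K \<theta>) * (if e \<in> F then x else 1)" for e and x :: real
  have f: "f = (\<lambda>w. \<Prod>e\<in>complete_edges n. h e (w e))"
  proof
    fix w :: "nat set \<Rightarrow> real"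
    have "(\<Prod>e\<in>complete_edges n. if e \<in> F then w e else 1) = (\<Prod>e\<in>F. w e)"
      using assms(1) by (simp add: prod.If_cases Int_absorb1)
    then show "f w = (\<Prod>e\<in>complete_edges n. h e (w e))"
      by (simp add: f_def h_def exp_sum prod.distrib)
  qed
  have h_eq: "h e = (\<lambda>x. (x ^ (if e \<in> F then 1 else 0) * exp (\<theta> * x)) / exp (K \<theta>))" for e
    by (auto simp: h_def exp_diff)
  have int: "integrable \<mu> (h e)" for e
    unfolding h_eq by (intro integrable_divide integrable_pow_exp)
  show "integrable (P n) f"
    unfolding f weighted_graphs_def by (rule PP.product_integrable_prod) (use int in auto)
  have "(LINT w|P n. f w) = (\<Prod>e\<in>complete_edges n. LINT x|\<mu>. h e x)"
    unfolding f weighted_graphs_def by (rule PP.product_integral_prod) (use int in auto)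
  also have "\<dots> = (\<Prod>e\<in>complete_edges n. if e \<in> F then K1 \<theta> else 1)"
  proof (intro prod.cong refl)
    fix e
    have "(LINT x|\<mu>. h e x) = mom (if e \<in> F then 1 else 0) \<theta> / mom 0 \<theta>"
      unfolding h_eq using mom_0_pos[of \<theta>] by (simp add: mom_def K_eq)
    then show "(LINT x|\<mu>. h e x) = (if e \<in> F then K1 \<theta> else 1)"
      using mom_0_pos[of \<theta>] by (simp add: K1_def)
  qed
  also have "\<dots> = K1 \<theta> ^ card F" using assms(1) by (simp add: prod.If_cases Int_absorb1)
  finally show "(LINT w|P n. f w) = K1 \<theta> ^ card F" .
qed

lemma energy_upper_bound:
  assumes n: "n > 0" and w: "\<And>e. e \<in> complete_edges n \<Longrightarrow> w e \<in> {0..1}"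
  shows "energy n w \<le> (\<bar>\<beta>1\<bar> + \<beta>2) * (real n)\<^sup>2"
proof -
  have A: "adj n w i j \<in> {0..1}" for i j by (rule adj_01[OF w])
  have A0: "0 \<le> adj n w i j" and A1: "adj n w i j \<le> 1" for i j using A[of i j] by auto
  have "(\<Sum>i\<in>{1..n}. \<Sum>j\<in>{1..n}. adj n w i j) \<le> (\<Sum>i\<in>{1..n}. \<Sum>j\<in>{1..n}. 1)" by (intro sum_mono A1)
  then have s1: "(\<Sum>i\<in>{1..n}. \<Sum>j\<in>{1..n}. adj n w i j) \<le> (real n)\<^sup>2" by (simp add: power2_eq_square)
  have s0: "0 \<le> (\<Sum>i\<in>{1..n}. \<Sum>j\<in>{1..n}. adj n w i j)" by (intro sum_nonneg A0)
  have "hom_sum {1..n} k E (\<lambda>_. adj n w) \<le> (\<Sum>x\<in>{1..k} \<rightarrow>\<^sub>E {1..n}. 1)"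
    unfolding hom_sum_def using A0 A1 by (intro sum_mono prod_le_1) auto
  then have "hom_sum {1..n} k E (\<lambda>_. adj n w) / real n ^ k \<le> 1" using n by (simp add: card_PiE)
  then have "\<beta>2 * (real n)\<^sup>2 * (hom_sum {1..n} k E (\<lambda>_. adj n w) / real n ^ k) \<le> \<beta>2 * (real n)\<^sup>2 * 1"
    using \<beta>2_nonneg by (intro mult_left_mono) auto
  moreover have "\<beta>1 * (\<Sum>i\<in>{1..n}. \<Sum>j\<in>{1..n}. adj n w i j) \<le> \<bar>\<beta>1\<bar> * (real n)\<^sup>2"
    using s0 s1 by (meson abs_ge_self abs_ge_zero mult_mono)
  ultimately show ?thesis unfolding hamiltonian_eq[OF n graph] by (simp add: algebra_simps)
qed

lemma integrable_exp_energy: "n > 0 \<Longrightarrow> integrable (P n) (\<lambda>w. exp (energy n w))"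
proof -
  assume n: "n > 0"
  interpret PN: prob_space "P n" by (rule prob_space_P)
  show ?thesis
  proof (rule PN.integrable_const_bound)
    show "AE w in P n. norm (exp (energy n w)) \<le> exp ((\<bar>\<beta>1\<bar> + \<beta>2) * (real n)\<^sup>2)"
      using AE_P_01[of n] by eventually_elim (use energy_upper_bound[OF n] in simp)
    show "(\<lambda>w. exp (energy n w)) \<in> borel_measurable (P n)" using measurable_energy[OF n] by measurable
  qed
qed

text \<open>Jensen's inequality for the tilted measure, in the elementary form \<open>exp y \<ge> exp c (1 + y - c)\<close>
  with \<open>c\<close> the tilted mean of the exponent minus the log-likelihood ratio. Non-injective maps
  only contribute non-negative terms and are dropped.\<close>

lemma partition_function_lower:
  assumes n: "n > 0" and u: "u = K1 \<theta>"
  shows "exp (real n * (real n - 1) * (\<beta>1 * u - J u / 2) + \<beta>2 * (real n)\<^sup>2 * injective_fraction k n * u ^ p)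
    \<le> (LINT w|P n. exp (energy n w))"
proof -
  interpret PN: prob_space "P n" by (rule prob_space_P)
  let ?C = "complete_edges n"
  define N where "N = {x \<in> {1..k} \<rightarrow>\<^sub>E {1..n}. inj_on x {1..k}}"
  define a where "a = \<beta>2 * (real n)\<^sup>2 / real n ^ k"
  have a0: "a \<ge> 0" using \<beta>2_nonneg by (simp add: a_def)
  define D where "D w = exp (\<Sum>e\<in>?C. \<theta> * w e - K \<theta>)" for w
  define M where "M F w = D w * (\<Prod>e\<in>F. w e)" for F w
  have M: "integrable (P n) (M F)" "(LINT w|P n. M F w) = u ^ card F" if "F \<subseteq> ?C" for F
    using tilted_moment[OF that, of \<theta>] unfolding M_def D_def u by auto
  define X where "X w = \<beta>1 * (2 * (\<Sum>e\<in>?C. w e)) + a * (\<Sum>x\<in>N. \<Prod>f\<in>(`) x ` E. w f)" for w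
  define S where "S w = (\<Sum>e\<in>?C. \<theta> * w e - K \<theta>)" for w
  define c where "c = real n * (real n - 1) * (\<beta>1 * u - J u / 2) + \<beta>2 * (real n)\<^sup>2 * injective_fraction k n * u ^ p"
  have finN: "finite N" unfolding N_def by (rule finite_subset[of _ "{1..k} \<rightarrow>\<^sub>E {1..n}"]) (auto intro: finite_PiE)
  have NE: "(`) x ` E \<subseteq> ?C" "card ((`) x ` E) = p"
     "(\<Prod>e\<in>E. adj n w (x (Min e)) (x (Max e))) = (\<Prod>f\<in>(`) x ` E. w f)" if "x \<in> N" for x w
    using prod_edge_weights_injective[of x k n E] that graph edges unfolding N_def by auto
  have X_le: "X w \<le> energy n w" if w: "\<And>e. e \<in> ?C \<Longrightarrow> w e \<in> {0..1}" for w
  proof -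
    have A0: "0 \<le> adj n w i j" for i j using adj_01[of n w, OF w] by auto
    have "(\<Sum>i\<in>{1..n}. \<Sum>j\<in>{1..n}. adj n w i j) = 2 * (\<Sum>e\<in>?C. w e)"
      using sum_pairs_eq_edges[of "adj n w" n, OF adj_sym] by (simp add: adj_diag adj_edge)
    moreover have "(\<Sum>x\<in>N. \<Prod>f\<in>(`) x ` E. w f) \<le> hom_sum {1..n} k E (\<lambda>_. adj n w)"
    proof -
      have "(\<Sum>x\<in>N. \<Prod>f\<in>(`) x ` E. w f) = (\<Sum>x\<in>N. \<Prod>e\<in>E. adj n w (x (Min e)) (x (Max e)))"
        using NE by (intro sum.cong refl) simp
      also have "\<dots> \<le> hom_sum {1..n} k E (\<lambda>_. adj n w)"
        unfolding hom_sum_def N_def by (intro sum_mono2 prod_nonneg A0 finite_PiE) auto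
      finally show ?thesis .
    qed
    then have "a * (\<Sum>x\<in>N. \<Prod>f\<in>(`) x ` E. w f) \<le> a * hom_sum {1..n} k E (\<lambda>_. adj n w)"
      using a0 by (rule mult_left_mono)
    ultimately show ?thesis unfolding hamiltonian_eq[OF n graph] X_def by (simp add: a_def)
  qed
  \<comment> \<open>Expanded into tilted monomials, so that \<open>tilted_moment\<close> gives its integral; by the next
    step it is the linear lower bound of the exponential.\<close>
  define G where "G w = exp c * ((1 - c + real (card ?C) * K \<theta>) * M {} w
      + ((2 * \<beta>1 - \<theta>) * (\<Sum>e\<in>?C. M {e} w) + a * (\<Sum>x\<in>N. M ((`) x ` E) w)))" for w
  have G: "G w = exp c * (D w * (1 + (X w - S w - c)))" for w
    unfolding G_def M_def X_def S_def
    by (simp add: sum_distrib_left[symmetric] sum_subtractf algebra_simps)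
  have G_le: "G w \<le> exp (X w)" for w
  proof -
    have "D w * (1 + (X w - S w - c)) \<le> D w * exp (X w - S w - c)"
      by (intro mult_left_mono exp_ge_add_one_self) (simp add: D_def)
    then have "G w \<le> exp c * (D w * exp (X w - S w - c))" unfolding G by (rule mult_left_mono) simp
    also have "\<dots> = exp (X w)" by (simp add: D_def S_def flip: exp_add)
    finally show ?thesis .
  qed
  have int: "integrable (P n) (M {})" "integrable (P n) (\<lambda>w. \<Sum>e\<in>?C. M {e} w)"
    "integrable (P n) (\<lambda>w. \<Sum>x\<in>N. M ((`) x ` E) w)"
    using M(1) NE(1) by (auto intro!: Bochner_Integration.integrable_sum)
  have G_int: "integrable (P n) G"
    unfolding G_def by (intro integrable_mult_right Bochner_Integration.integrable_add int)
  have i1: "(LINT w|P n. (\<Sum>e\<in>?C. M {e} w)) = real (card ?C) * u"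
    using M by (subst Bochner_Integration.integral_sum) auto
  have i2: "(LINT w|P n. (\<Sum>x\<in>N. M ((`) x ` E) w)) = real (card N) * u ^ p"
    using M NE by (subst Bochner_Integration.integral_sum) auto
  have i0: "(LINT w|P n. M {} w) = 1" using M(2)[of "{}"] by simp
  have "(LINT w|P n. G w) = exp c * ((1 - c + real (card ?C) * K \<theta>) * (LINT w|P n. M {} w)
      + ((2 * \<beta>1 - \<theta>) * (LINT w|P n. (\<Sum>e\<in>?C. M {e} w)) + a * (LINT w|P n. (\<Sum>x\<in>N. M ((`) x ` E) w))))"
    unfolding G_def using int
    by (simp only: integral_mult_right_zero Bochner_Integration.integral_add integrable_mult_right Bochner_Integration.integrable_add)
  also have "\<dots> = exp c"
  proof -
    have cN: "a * real (card N) = \<beta>2 * (real n)\<^sup>2 * injective_fraction k n"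
      by (simp add: a_def injective_fraction_def N_def)
    have "c = (2 * real (card ?C)) * (\<beta>1 * u - (\<theta> * u - K \<theta>) / 2) + a * real (card N) * u ^ p"
      unfolding c_def cN card_complete_edges by (simp add: u J_K1)
    also have "\<dots> = real (card ?C) * K \<theta> + (2 * \<beta>1 - \<theta>) * (real (card ?C) * u) + a * (real (card N) * u ^ p)"
      by (simp add: field_simps)
    finally show ?thesis unfolding i0 i1 i2 by simp
  qed
  finally have "exp c = (LINT w|P n. G w)" by simp
  also have "\<dots> \<le> (LINT w|P n. exp (energy n w))"
  proof (rule integral_mono_AE[OF G_int integrable_exp_energy[OF n]])
    show "AE w in P n. G w \<le> exp (energy n w)"
      using AE_P_01[of n]
    proof eventually_elim
      case (elim w)
      then have "exp (X w) \<le> exp (energy n w)" using X_le[of w] by simp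
      then show ?case using G_le[of w] by linarith
    qed
  qed
  finally show ?thesis by (simp add: c_def)
qed

lemma partition_function_eventually:
  assumes u: "u = K1 \<theta>" and "\<gamma> > 0"
  shows "\<forall>\<^sub>F n in sequentially. exp ((real n)\<^sup>2 * (L u - \<gamma>)) \<le> (LINT w|P n. exp (energy n w))"
proof -
  define r where "r n = (1 - 1 / real n) * (\<beta>1 * u - J u / 2) + \<beta>2 * injective_fraction k n * u ^ p" for n
  have "(\<lambda>n. 1 - 1 / real n) \<longlonglongrightarrow> 1 - 0" by (intro tendsto_intros lim_1_over_n)
  then have "r \<longlonglongrightarrow> 1 * (\<beta>1 * u - J u / 2) + \<beta>2 * 1 * u ^ p"
    unfolding r_def by (intro tendsto_intros injective_fraction_tendsto) simp
  then have "r \<longlonglongrightarrow> L u" by (simp add: objective_def algebra_simps)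
  then have "\<forall>\<^sub>F n in sequentially. L u - \<gamma> < r n" using \<open>\<gamma> > 0\<close> by (intro order_tendstoD(1)) auto
  then show ?thesis using eventually_gt_at_top[of 0]
  proof eventually_elim
    case (elim n)
    have "(real n)\<^sup>2 * (L u - \<gamma>) \<le> (real n)\<^sup>2 * r n" using elim(1) by (intro mult_left_mono) auto
    also have "\<dots> = real n * (real n - 1) * (\<beta>1 * u - J u / 2) + \<beta>2 * (real n)\<^sup>2 * injective_fraction k n * u ^ p"
      using elim(2) by (simp add: r_def power2_eq_square field_simps)
    finally show ?case using partition_function_lower[OF elim(2) u] by (meson exp_le_cancel_iff order_trans)
  qed
qed

section \<open>Almost sure convergence\<close>

text \<open>The upper bound for far graphs divided by the lower bound for the partition function.\<close>

lemma ergm_far_graphs_small: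
  assumes max: "maximizers \<mu> p \<beta>1 \<beta>2 = {u}" and "\<epsilon> > 0"
  shows "\<forall>\<^sub>F n in sequentially. emeasure (ergm \<mu> k E \<beta>1 \<beta>2 n) (far_graphs u \<epsilon> n) \<le> ennreal (exp (- real n))"
proof -
  obtain \<theta> where u: "u = K1 \<theta>" using maximizer_has_dual[of u \<beta>1 \<beta>2] max by auto
  obtain \<gamma> C where \<gamma>: "\<gamma> > 0" and upper: "\<And>n. n > 0 \<Longrightarrow>
     (\<integral>\<^sup>+ w. ennreal (exp (energy n w)) * indicator (far_graphs u \<epsilon> n) w \<partial>P n)
     \<le> ennreal (exp ((real n)\<^sup>2 * (L u - \<gamma>) + C * real n))"
    using far_graphs_weight[OF max \<open>\<epsilon> > 0\<close>] by blast
  \<comment> \<open>From here on the quadratic gain \<open>\<gamma> n^2 / 2\<close> beats the linear loss \<open>C n\<close> by at least \<open>n\<close>.\<close>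
  obtain n0 :: nat where n0: "real n0 \<ge> 2 * (C + 1) / \<gamma>" using real_arch_simple by blast
  have "\<forall>\<^sub>F n in sequentially. exp ((real n)\<^sup>2 * (L u - \<gamma> / 2)) \<le> (LINT w|P n. exp (energy n w))"
    using partition_function_eventually[OF u, of "\<gamma> / 2"] \<gamma> by simp
  then show ?thesis using eventually_gt_at_top[of 0] eventually_ge_at_top[of n0]
  proof eventually_elim
    case (elim n)
    define Z where "Z = (LINT w|P n. exp (energy n w))"
    have Z: "exp ((real n)\<^sup>2 * (L u - \<gamma> / 2)) \<le> Z" using elim(1) by (simp add: Z_def)
    have Z0: "Z > 0" using Z exp_gt_zero less_le_trans by blast
    have psi: "(real n)\<^sup>2 * psi \<mu> k E \<beta>1 \<beta>2 n = ln Z" using elim(2) by (simp add: psi_def Z_def)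
    have dens: "exp ((real n)\<^sup>2 * (hamiltonian k E \<beta>1 \<beta>2 n w - psi \<mu> k E \<beta>1 \<beta>2 n)) = exp (energy n w) * (1 / Z)" for w
      using Z0 by (simp add: right_diff_distrib psi exp_diff)
    have meas: "(\<lambda>w. ennreal (exp (energy n w))) \<in> borel_measurable (P n)"
      using measurable_energy[OF elim(2)] by measurable
    have "emeasure (ergm \<mu> k E \<beta>1 \<beta>2 n) (far_graphs u \<epsilon> n)
      = (\<integral>\<^sup>+ w. ennreal (exp (energy n w) * (1 / Z)) * indicator (far_graphs u \<epsilon> n) w \<partial>P n)"
      unfolding ergm_def dens using measurable_energy[OF elim(2)] far_graphs_sets
      by (subst emeasure_density) auto
    also have "\<dots> = (\<integral>\<^sup>+ w. ennreal (1 / Z) * (ennreal (exp (energy n w)) * indicator (far_graphs u \<epsilon> n) w) \<partial>P n)"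
    proof (rule nn_integral_cong)
      fix w
      have "ennreal (exp (energy n w) * (1 / Z)) = ennreal (1 / Z) * ennreal (exp (energy n w))"
        using Z0 by (subst mult.commute) (intro ennreal_mult, auto)
      then show "ennreal (exp (energy n w) * (1 / Z)) * indicator (far_graphs u \<epsilon> n) w
          = ennreal (1 / Z) * (ennreal (exp (energy n w)) * indicator (far_graphs u \<epsilon> n) w)"
        by (simp only: mult.assoc)
    qed
    also have "\<dots> = ennreal (1 / Z) * (\<integral>\<^sup>+ w. ennreal (exp (energy n w)) * indicator (far_graphs u \<epsilon> n) w \<partial>P n)"
      using meas far_graphs_sets by (intro nn_integral_cmult) auto
    also have "\<dots> \<le> ennreal (1 / Z) * ennreal (exp ((real n)\<^sup>2 * (L u - \<gamma>) + C * real n))"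
      by (intro mult_left_mono upper elim(2)) auto
    also have "\<dots> = ennreal (exp ((real n)\<^sup>2 * (L u - \<gamma>) + C * real n) / Z)"
      using Z0 by (simp flip: ennreal_mult)
    also have "\<dots> \<le> ennreal (exp (- real n))"
    proof (rule ennreal_leI)
      have "exp ((real n)\<^sup>2 * (L u - \<gamma>) + C * real n) / Z
          \<le> exp ((real n)\<^sup>2 * (L u - \<gamma>) + C * real n) / exp ((real n)\<^sup>2 * (L u - \<gamma> / 2))"
        using Z Z0 by (intro divide_left_mono) auto
      also have "\<dots> = exp ((real n)\<^sup>2 * (L u - \<gamma>) + C * real n - (real n)\<^sup>2 * (L u - \<gamma> / 2))"
        by (simp only: exp_diff)
      also have "(real n)\<^sup>2 * (L u - \<gamma>) + C * real n - (real n)\<^sup>2 * (L u - \<gamma> / 2) = C * real n - real n * (real n * \<gamma> / 2)"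
        by (simp add: power2_eq_square algebra_simps)
      also have "exp (C * real n - real n * (real n * \<gamma> / 2)) \<le> exp (- real n)"
      proof -
        have "2 * (C + 1) / \<gamma> \<le> real n" using n0 elim(3) by linarith
        then have "C + 1 \<le> real n * \<gamma> / 2" using \<gamma> by (simp add: field_simps)
        then have "real n * (C + 1) \<le> real n * (real n * \<gamma> / 2)" by (intro mult_left_mono) auto
        then have "C * real n - real n * (real n * \<gamma> / 2) \<le> - real n" by (simp add: algebra_simps)
        then show ?thesis by (subst exp_le_cancel_iff)
      qed
      finally show "exp ((real n)\<^sup>2 * (L u - \<gamma>) + C * real n) / Z \<le> exp (- real n)" .
    qed
    finally show ?case .
  qed
qed

lemma sets_ergm: "sets (ergm \<mu> k E \<beta>1 \<beta>2 n) = sets (P n)" by (simp add: ergm_def)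

text \<open>The probabilities are summable, so only the marginal laws matter for almost sure convergence.\<close>

lemma looks_like_ER_unique_maximizer:
  assumes max: "maximizers \<mu> p \<beta>1 \<beta>2 = {u}"
  shows "looks_like_ER \<mu> k E \<beta>1 \<beta>2 u"
  unfolding looks_like_ER_def
proof (intro conjI allI impI)
  show "maximizers \<mu> (card E) \<beta>1 \<beta>2 = {u}" using max edges by simp
  fix Q assume "joint_law (ergm \<mu> k E \<beta>1 \<beta>2) Q"
  then have Q: "prob_space Q" "sets Q = sets (Pi\<^sub>M UNIV (ergm \<mu> k E \<beta>1 \<beta>2))"
    "\<And>n. distr Q (ergm \<mu> k E \<beta>1 \<beta>2 n) (\<lambda>\<omega>. \<omega> n) = ergm \<mu> k E \<beta>1 \<beta>2 n" by (auto simp: joint_law_def)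
  interpret Q: prob_space Q by (rule Q(1))
  have proj: "(\<lambda>\<omega>. \<omega> n) \<in> measurable Q (ergm \<mu> k E \<beta>1 \<beta>2 n)" for n
    by (subst measurable_cong_sets[OF Q(2) refl]) (rule measurable_component_singleton, simp)
  have close: "AE G in Q. \<forall>\<^sub>F n in sequentially. delta_cut (graphon n (G n)) (\<lambda>_ _. u) \<le> \<epsilon>"
    if "\<epsilon> > 0" for \<epsilon>
  proof -
    define B where "B n = (\<lambda>\<omega>. \<omega> n) -` far_graphs u \<epsilon> n \<inter> space Q" for n
    have far_sets: "far_graphs u \<epsilon> n \<in> sets (ergm \<mu> k E \<beta>1 \<beta>2 n)" for n
      using far_graphs_sets sets_ergm by simp
    have B_sets: "B n \<in> sets Q" for n unfolding B_def by (rule measurable_sets[OF proj far_sets])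
    have emB: "emeasure Q (B n) = emeasure (ergm \<mu> k E \<beta>1 \<beta>2 n) (far_graphs u \<epsilon> n)" for n
      unfolding B_def by (subst emeasure_distr[OF proj far_sets, symmetric]) (simp add: Q(3))
    have "summable (\<lambda>n. measure Q (B n))"
    proof (rule summable_comparison_test_ev)
      show "\<forall>\<^sub>F n in sequentially. norm (measure Q (B n)) \<le> exp (-1) ^ n"
        using ergm_far_graphs_small[OF max that]
      proof eventually_elim
        case (elim n)
        then have "ennreal (measure Q (B n)) \<le> ennreal (exp (- real n))"
          by (simp add: emB Q.emeasure_eq_measure[symmetric])
        then have "measure Q (B n) \<le> exp (- real n)" by simp
        then show ?case by (simp add: exp_of_nat_mult[symmetric])
      qed
      show "summable (\<lambda>n. exp (-1 :: real) ^ n)" by (intro summable_geometric) simp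
    qed
    then have "AE G in Q. \<forall>\<^sub>F n in sequentially. G \<in> space Q - B n"
      by (intro borel_cantelli_AE1 B_sets) (auto simp: less_top[symmetric])
    then show ?thesis
    proof eventually_elim
      case (elim G)
      then show ?case using eventually_gt_at_top[of 0]
      proof eventually_elim
        case (elim n)
        have "G n \<in> space (ergm \<mu> k E \<beta>1 \<beta>2 n)" using measurable_space[OF proj, of G n] elim by auto
        then have "G n \<in> space (P n)" using sets_eq_imp_space_eq[OF sets_ergm] by auto
        then have "cut_small {1..n} \<epsilon> (\<lambda>i j. adj n (G n) i j - u)"
          using elim by (auto simp: B_def far_graphs_def)
        then show ?case using cut_dist_graphon_le[OF elim(2)] delta_cut_graphon(2) order_trans by blast
      qed
    qed
  qed
  have "AE G in Q. \<forall>m::nat. \<forall>\<^sub>F n in sequentially. delta_cut (graphon n (G n)) (\<lambda>_ _. u) \<le> 1 / Suc m"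
    unfolding AE_all_countable using close by simp
  then show "AE G in Q. (\<lambda>n. delta_cut (graphon n (G n)) (\<lambda>_ _. u)) \<longlonglongrightarrow> 0"
  proof eventually_elim
    case (elim G)
    show ?case
    proof (rule tendstoI)
      fix \<epsilon> :: real assume "\<epsilon> > 0"
      then obtain m where m: "1 / real (Suc m) < \<epsilon>" using nat_approx_posE by blast
      have "\<forall>\<^sub>F n in sequentially. delta_cut (graphon n (G n)) (\<lambda>_ _. u) \<le> 1 / Suc m" using elim by blast
      then show "\<forall>\<^sub>F n in sequentially. dist (delta_cut (graphon n (G n)) (\<lambda>_ _. u)) 0 < \<epsilon>"
      proof eventually_elim
        case (elim n)
        then show ?case using m delta_cut_graphon(1)[of n "G n" u] by (simp add: dist_real_def)
      qed
    qed
  qed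
qed

end

theorem theorem5:
  fixes \<mu> :: "real measure" and k p :: nat and E :: "nat set set"
  assumes prob: "prob_space \<mu>" and borel: "sets \<mu> = sets borel"
    and supported: "AE x in \<mu>. x \<in> {0..1}"
    and nondegenerate: "\<not> (\<exists>c. AE x in \<mu>. x = c)"
    and symmetric: "distr \<mu> borel (\<lambda>x. 1 - x) = \<mu>"
    and bounded_rate: "\<exists>C. \<forall>u\<in>{0..1}. rate \<mu> u \<le> ereal C"
    and graph: "simple_graph k E" and edges: "card E = p" and p_ge_2: "p \<ge> 2"
    and one_zero: "\<exists>!\<theta>. (deriv ^^ 3) (cumulant \<mu>) \<theta> * deriv (cumulant \<mu>) \<theta>
                        = - (real p - 2) * ((deriv ^^ 2) (cumulant \<mu>) \<theta>)\<^sup>2"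
  shows "\<exists>u \<theta> :: real \<times> real \<Rightarrow> real. \<forall>\<delta>>0.
           (\<forall>\<^sub>F (\<beta>1, \<beta>2) in far_in_cone p \<delta>.
              u (\<beta>1, \<beta>2) \<in> {0<..<1} \<and>
              looks_like_ER \<mu> k E \<beta>1 \<beta>2 (u (\<beta>1, \<beta>2)) \<and>
              legendre_dual \<mu> (u (\<beta>1, \<beta>2)) (\<theta> (\<beta>1, \<beta>2))) \<and>
           \<theta> \<sim>[far_in_cone p \<delta>] (\<lambda>(\<beta>1, \<beta>2). 2 * (\<beta>1 + real p * \<beta>2))"
proof -
  interpret \<mu>: prob_space \<mu> by (rule prob)
  interpret ferromagnetic_model \<mu> p
    by unfold_locales (fact borel supported nondegenerate symmetric bounded_rate p_ge_2 one_zero)+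
  \<comment> \<open>The choice does not depend on \<open>\<delta>\<close>; where the maximizer is not unique its value is irrelevant.\<close>
  define \<theta> where "\<theta> = (\<lambda>(\<beta>1, \<beta>2). SOME t. K1 t \<in> maximizers \<mu> p \<beta>1 \<beta>2)"
  define u where "u = (\<lambda>\<beta>. K1 (\<theta> \<beta>))"
  show ?thesis
  proof (rule exI[of _ u], rule exI[of _ \<theta>], intro allI impI)
    fix \<delta> :: real assume "\<delta> > 0"
    have cone: "\<forall>\<^sub>F (\<beta>1, \<beta>2) in far_in_cone p \<delta>. \<beta>2 \<ge> 0"
      unfolding eventually_far_in_cone by auto
    have unique: "\<forall>\<^sub>F (\<beta>1, \<beta>2) in far_in_cone p \<delta>. maximizers \<mu> p \<beta>1 \<beta>2 = {K1 (\<theta> (\<beta>1, \<beta>2))}"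
      using unique_maximizer_far_in_cone[of 0 \<delta>, OF zero_less_one \<open>\<delta> > 0\<close>]
    proof eventually_elim
      case (elim \<beta>)
      obtain \<beta>1 \<beta>2 where \<beta>: "\<beta> = (\<beta>1, \<beta>2)" by force
      then have "\<exists>t. maximizers \<mu> p \<beta>1 \<beta>2 = {K1 t} \<and> 0 < K1 t" using elim by (simp only: prod.case)
      then obtain t where t: "maximizers \<mu> p \<beta>1 \<beta>2 = {K1 t}" by blast
      have "K1 (\<theta> (\<beta>1, \<beta>2)) \<in> maximizers \<mu> p \<beta>1 \<beta>2"
        unfolding \<theta>_def prod.case
        by (rule someI[of "\<lambda>t. K1 t \<in> maximizers \<mu> p \<beta>1 \<beta>2" t]) (simp add: t)
      then have "K1 (\<theta> (\<beta>1, \<beta>2)) = K1 t" using t by simp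
      then show ?case by (simp add: \<beta> t)
    qed
    have "\<forall>\<^sub>F (\<beta>1, \<beta>2) in far_in_cone p \<delta>.
              u (\<beta>1, \<beta>2) \<in> {0<..<1} \<and>
              looks_like_ER \<mu> k E \<beta>1 \<beta>2 (u (\<beta>1, \<beta>2)) \<and>
              legendre_dual \<mu> (u (\<beta>1, \<beta>2)) (\<theta> (\<beta>1, \<beta>2))"
      using unique cone
    proof eventually_elim
      case (elim \<beta>)
      obtain \<beta>1 \<beta>2 where \<beta>: "\<beta> = (\<beta>1, \<beta>2)" by force
      have max: "maximizers \<mu> p \<beta>1 \<beta>2 = {u (\<beta>1, \<beta>2)}" and "\<beta>2 \<ge> 0" using elim by (auto simp: \<beta> u_def)
      interpret ergm_model \<mu> p k E \<beta>1 \<beta>2 by unfold_locales (fact graph edges \<open>\<beta>2 \<ge> 0\<close>)+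
      have "looks_like_ER \<mu> k E \<beta>1 \<beta>2 (u (\<beta>1, \<beta>2))" by (rule looks_like_ER_unique_maximizer[OF max])
      then show ?case using K1_in(2) legendre_dual_K1 by (simp add: \<beta> u_def)
    qed
    then show "(\<forall>\<^sub>F (\<beta>1, \<beta>2) in far_in_cone p \<delta>.
              u (\<beta>1, \<beta>2) \<in> {0<..<1} \<and>
              looks_like_ER \<mu> k E \<beta>1 \<beta>2 (u (\<beta>1, \<beta>2)) \<and>
              legendre_dual \<mu> (u (\<beta>1, \<beta>2)) (\<theta> (\<beta>1, \<beta>2))) \<and>
           \<theta> \<sim>[far_in_cone p \<delta>] (\<lambda>(\<beta>1, \<beta>2). 2 * (\<beta>1 + real p * \<beta>2))"
      using dual_asymp_equiv[OF \<open>\<delta> > 0\<close> unique] by blast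
  qed
qed

end
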